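(* Let $m\ge1$ be an integer, $0\le\alpha<mn$, $1<p_1,\dots,p_m,q<\infty$, and let $\vec\sigma=(\sigma_1,\dots,\sigma_m)$ and $\omega$ be weights on $\mathbb R^n$. Put $\frac1p=\frac1{p_1}+\cdots+\frac1{p_m}$ and assume $p\le q$. Then there is a constant $C>0$ depending only on $n,m,\alpha,p_1,\dots,p_m,q$ such that for all $f_i\in L^{p_i}(\sigma_i)$, $i=1,\dots,m$, $$\|\mathcal M_\alpha(\sigma_1f_1,\dots,\sigma_mf_m)\|_{q,\omega}\le C\left([\vec\sigma,\omega]_{B_{\vec P,q}}\right)^{1/p}\prod_{i=1}^m\|f_i\|_{p_i,\sigma_i},$$ $$\|\mathcal M_\alpha(\sigma_1f_1,\dots,\sigma_mf_m)\|_{q,\omega}\le C\left([\vec\sigma,\omega]_{A_{\vec P,q}}\right)^{1/p}\left(\prod_{i=1}^m[\sigma_i]_{A_\infty}^{1/p_i}\right)\prod_{i=1}^m\|f_i\|_{p_i,\sigma_i},$$ and $$\|\mathcal M_\alpha(\sigma_1f_1,\dots,\sigma_mf_m)\|_{q,\omega}\le C\left([\vec\sigma,\omega]_{A_{\vec P,q}}[\vec\sigma]_{W_{\vec P}^\infty}\right)^{1/p}\prod_{i=1}^m\|f_i\|_{p_i,\sigma_i}.$$ (Each inequality is asserted when the weight constants on its right-hand side are finite.)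
   Context: Cubes $Q\subset\mathbb R^n$ are non-degenerate with sides parallel to the axes; $|Q|$ is Lebesgue measure. A weight is a locally integrable function on $\mathbb R^n$ that is positive almost everywhere; $\omega(Q)=\int_Q\omega$. $\|f\|_{p,\omega}^p=\int_{\mathbb R^n}|f|^p\omega\,dx$. $p_i'$ is the conjugate exponent of $p_i$. All suprema below are over all cubes $Q$. Multilinear fractional maximal function: $$\mathcal M_\alpha\vec f(x)=\sup_Q|Q|^{\alpha/n}\prod_{i=1}^m\frac{\chi_Q(x)}{|Q|}\int_Q|f_i(y)|\,dy.$$ Hardy–Littlewood maximal function: $Mf(x)=\sup_Q\frac{\chi_Q(x)}{|Q|}\int_Q|f(y)|\,dy$. Weight constants: $$[\vec\sigma,\omega]_{A_{\vec P,q}}=\sup_Q\frac{\omega(Q)^{p/q}\prod_{i=1}^m\sigma_i(Q)^{p/p_i'}}{|Q|^{p(m-\alpha/n)}},$$ $$[\vec\sigma,\omega]_{B_{\vec P,q}}=\sup_Q\frac{\omega(Q)^{p/q}\prod_{i=1}^m\sigma_i(Q)^{p}}{|Q|^{p(m-\alpha/n)+1}}\prod_{i=1}^m\left(\exp\left(\frac1{|Q|}\int_Q\log\sigma_i^{-1}\right)\right)^{p/p_i},$$ $$[\sigma_i]_{A_\infty}=\sup_Q\frac1{\sigma_i(Q)}\int_QM(\sigma_i\chi_Q)\,dx,\qquad [\vec\sigma]_{W_{\vec P}^\infty}=\sup_Q\frac{\int_Q\prod_{i=1}^mM(\sigma_i\chi_Q)(x)^{p/p_i}\,dx}{\int_Q\prod_{i=1}^m\sigma_i(x)^{p/p_i}\,dx}.$$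 *)

theory Defs
  imports "HOL-Analysis.Analysis"
begin

text \<open>
  The quantities below may be infinite, so they take values in \<^typ>\<open>ennreal\<close>.
  Families indexed by $i = 1,\dots,m$ are functions on \<^typ>\<open>nat\<close> of which only
  the values at \<open>{1..m}\<close> are used.
\<close>

text \<open>Used only with positive exponents, so that $\infty^a = \infty$ is the right convention.\<close>

definition epowr :: "ennreal \<Rightarrow> real \<Rightarrow> ennreal"  (infixr "epowr" 80)
  where "x epowr a = (if x = \<infinity> then \<infinity> else ennreal (enn2real x powr a))"

definition cubes :: "(real ^ 'n::finite) set set"
  where "cubes = {cbox a (\<chi> i. a $ i + l) | a l. 0 < l}"

abbreviation vol :: "(real ^ 'n::finite) set \<Rightarrow> real"
  where "vol Q \<equiv> measure lebesgue Q"

definition weight :: "(real ^ 'n::finite \<Rightarrow> real) \<Rightarrow> bool"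
  where "weight w \<longleftrightarrow>
    w \<in> borel_measurable lebesgue \<and>
    (\<forall>K. compact K \<longrightarrow> w absolutely_integrable_on K) \<and>
    (AE x in lebesgue. 0 < w x)"

definition wmeas :: "(real ^ 'n::finite \<Rightarrow> real) \<Rightarrow> (real ^ 'n) set \<Rightarrow> ennreal"
  where "wmeas w Q = (\<integral>\<^sup>+x\<in>Q. ennreal (w x) \<partial>lebesgue)"

text \<open>The norm takes an extended nonnegative function $g = |f|$, because maximal
  functions may take the value $\infty$.\<close>

definition wnorm :: "real \<Rightarrow> (real ^ 'n::finite \<Rightarrow> real) \<Rightarrow> (real ^ 'n \<Rightarrow> ennreal) \<Rightarrow> ennreal"
  where "wnorm r w g = (\<integral>\<^sup>+x. (g x) epowr r * ennreal (w x) \<partial>lebesgue) epowr (1 / r)"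

definition weighted_Lp :: "real \<Rightarrow> (real ^ 'n::finite \<Rightarrow> real) \<Rightarrow> (real ^ 'n \<Rightarrow> real) set"
  where "weighted_Lp r w =
    {f \<in> borel_measurable lebesgue. wnorm r w (\<lambda>x. ennreal \<bar>f x\<bar>) < \<infinity>}"

definition multi_frac_maximal ::
    "nat \<Rightarrow> real \<Rightarrow> (nat \<Rightarrow> real ^ 'n::finite \<Rightarrow> real) \<Rightarrow> real ^ 'n \<Rightarrow> ennreal"
  where "multi_frac_maximal m \<alpha> f x =
    (SUP Q\<in>cubes. ennreal (vol Q powr (\<alpha> / real CARD('n))) *
       (\<Prod>i=1..m. indicator Q x / ennreal (vol Q) * (\<integral>\<^sup>+y\<in>Q. ennreal \<bar>f i y\<bar> \<partial>lebesgue)))"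

definition HL_maximal :: "(real ^ 'n::finite \<Rightarrow> real) \<Rightarrow> real ^ 'n \<Rightarrow> ennreal"
  where "HL_maximal f x =
    (SUP Q\<in>cubes. indicator Q x / ennreal (vol Q) * (\<integral>\<^sup>+y\<in>Q. ennreal \<bar>f y\<bar> \<partial>lebesgue))"

definition conj_exp :: "real \<Rightarrow> real"
  where "conj_exp r = r / (r - 1)"

text \<open>
  $\exp\bigl(\frac1{|Q|}\int_Q\log w^{-1}\bigr)$. For a weight, the negative part of
  $\log w^{-1}$ is integrable over $Q$ since $\log^+ w \le w$ there; so the only way
  integrability can fail is that the integral is $+\infty$.
\<close>

definition geom_mean_inv :: "(real ^ 'n::finite \<Rightarrow> real) \<Rightarrow> (real ^ 'n) set \<Rightarrow> ennreal"
  where "geom_mean_inv w Q =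
    (if set_integrable lebesgue Q (\<lambda>x. ln (inverse (w x)))
     then ennreal (exp (1 / vol Q * (LINT x:Q|lebesgue. ln (inverse (w x)))))
     else \<infinity>)"

text \<open>In the weight constants, \<open>ps i\<close> is $p_i$ and \<open>p\<close> is the exponent with
  $1/p = \sum_i 1/p_i$.\<close>

definition A_const ::
    "nat \<Rightarrow> real \<Rightarrow> (nat \<Rightarrow> real) \<Rightarrow> real \<Rightarrow> real \<Rightarrow>
     (nat \<Rightarrow> real ^ 'n::finite \<Rightarrow> real) \<Rightarrow> (real ^ 'n \<Rightarrow> real) \<Rightarrow> ennreal"
  where "A_const m \<alpha> ps p q \<sigma> w =
    (SUP Q\<in>cubes.
       (wmeas w Q epowr (p / q) * (\<Prod>i=1..m. wmeas (\<sigma> i) Q epowr (p / conj_exp (ps i))))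
       / ennreal (vol Q powr (p * (real m - \<alpha> / real CARD('n)))))"

definition B_const ::
    "nat \<Rightarrow> real \<Rightarrow> (nat \<Rightarrow> real) \<Rightarrow> real \<Rightarrow> real \<Rightarrow>
     (nat \<Rightarrow> real ^ 'n::finite \<Rightarrow> real) \<Rightarrow> (real ^ 'n \<Rightarrow> real) \<Rightarrow> ennreal"
  where "B_const m \<alpha> ps p q \<sigma> w =
    (SUP Q\<in>cubes.
       (wmeas w Q epowr (p / q) * (\<Prod>i=1..m. wmeas (\<sigma> i) Q epowr p))
       / ennreal (vol Q powr (p * (real m - \<alpha> / real CARD('n)) + 1))
       * (\<Prod>i=1..m. geom_mean_inv (\<sigma> i) Q epowr (p / ps i)))"

definition Ainf_const :: "(real ^ 'n::finite \<Rightarrow> real) \<Rightarrow> ennreal"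
  where "Ainf_const w =
    (SUP Q\<in>cubes. 1 / wmeas w Q *
       (\<integral>\<^sup>+x\<in>Q. HL_maximal (\<lambda>y. w y * indicator Q y) x \<partial>lebesgue))"

definition Winf_const ::
    "nat \<Rightarrow> (nat \<Rightarrow> real) \<Rightarrow> real \<Rightarrow> (nat \<Rightarrow> real ^ 'n::finite \<Rightarrow> real) \<Rightarrow> ennreal"
  where "Winf_const m ps p \<sigma> =
    (SUP Q\<in>cubes.
       (\<integral>\<^sup>+x\<in>Q. (\<Prod>i=1..m. HL_maximal (\<lambda>y. \<sigma> i y * indicator Q y) x epowr (p / ps i)) \<partial>lebesgue)
       / (\<integral>\<^sup>+x\<in>Q. (\<Prod>i=1..m. ennreal (\<sigma> i x) epowr (p / ps i)) \<partial>lebesgue))"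

end

theory Submission
  imports Defs
begin

text \<open>
  Every cube is contained in a comparable cube of one of $2^n$ shifted dyadic grids, so it suffices
  to bound the maximal function of a finite family $F$ of nested or disjoint cubes, uniformly in $F$.
  Put $s = m - \alpha/n$, $\theta_i = p/p_i$, $c_{i,Q} = \sigma_i(Q)^{-1}\int_Q |f_i| \sigma_i$ and
  $\Phi(Q) = |Q|^{-s} \prod_i \int_Q |f_i|\sigma_i$. Selecting the cubes $Q$ with
  $\Phi(Q) > 2^s \Phi(R)$ for all previously selected $R \supset Q$ gives a sparse subfamily $S$
  that dominates $\Phi$ up to the factor $2^s$; sparseness uses $0 < s \le m$. Since $p \le q$,
  the norm to the power $p$ is then at most a constant times
  $\sum_{Q \in S} \Phi(Q)^p \omega(Q)^{p/q}$.

  For the $B$ constant, Jensen's inequality replaces the geometric mean of $\sigma_i$ by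
  $(|Q|^{-1}\int_Q \sigma_i^{1/2})^2$. After Hoelder's inequality with exponents $1/\theta_i$
  each factor is handled by the maximal theorem for $\sigma_i$ followed by the one for
  Lebesgue measure on $L^2$. For the $A$ constant one is left with
  $\sum_Q c_{i,Q}^{p_i} \sigma_i(Q)$ (after Hoelder), respectively
  $\sum_Q \prod_i c_{i,Q}^p \sigma_i(Q)^{\theta_i}$; by sparseness the $A_\infty$,
  respectively $W^\infty$, condition is a Carleson condition for the coefficients, and the
  Carleson embedding theorem reduces both to the maximal theorem for $\sigma_i$.
\<close>

section \<open>Maximal functions of finite laminar families\<close>

text \<open>The operator is a supremum, so its q-th power is at most the sum over S of the powers
  \<open>\<Phi> Q powr q\<close>: overlapping cubes cost nothing, and duality, which fails because p
  may be smaller than 1, is avoided. Sparseness is saved for Carleson sums. The obstacle behind the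
  three different hypotheses is the failure of the maximal theorem on L^1: over sparse cubes inside
  R, the sum of the masses of \<sigma>_i need not be bounded by its mass on R. The A_infinity and
  W_infinity conditions assume a replacement; the B condition puts |Q| times the squared mean of the
  square root in the place of \<sigma>_i(Q), and then the exponent is 2. The maximal theorem is
  needed for \<sigma>_i dx, which need not be doubling, so it is proved for nested or disjoint sets
  in a sigma-finite space, where the maximal sets of a family replace a covering lemma. In finite
  families all maxima are attained and all quantities are real numbers. Grid cubes are half-open,
  since closed dyadic cubes overlap on faces; the passage to closed cubes changes only null
  sets.\<close>

definition laminar :: "'a set set \<Rightarrow> bool" where
  "laminar F \<longleftrightarrow> (\<forall>P\<in>F. \<forall>Q\<in>F. P \<subseteq> Q \<or> Q \<subseteq> P \<or> P \<inter> Q = {})"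

definition tops :: "'a set set \<Rightarrow> 'a set set" where
  "tops F = {Q\<in>F. \<forall>R\<in>F. Q \<subseteq> R \<longrightarrow> R = Q}"

text \<open>The inserted 0 is the value at points covered by no member of \<open>F\<close>; it keeps
  \<open>Max\<close> off the empty set and makes the function nonnegative whatever the sign of
  \<open>c\<close>.\<close>

definition family_max :: "'a set set \<Rightarrow> ('a set \<Rightarrow> real) \<Rightarrow> 'a \<Rightarrow> real" where
  "family_max F c x = Max (insert 0 (c ` {Q\<in>F. x \<in> Q}))"

lemma laminar_subset: "laminar F \<Longrightarrow> G \<subseteq> F \<Longrightarrow> laminar G"
  unfolding laminar_def by blast

lemma tops_subset: "tops F \<subseteq> F"
  by (auto simp: tops_def)

lemma ex_tops:
  assumes "finite F" "Q \<in> F"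
  obtains R where "R \<in> tops F" "Q \<subseteq> R"
proof -
  obtain R where "R \<in> F" "Q \<subseteq> R" "\<forall>b\<in>F. R \<subseteq> b \<longrightarrow> R = b"
    using finite_has_maximal2[OF assms] by auto
  then show ?thesis
    by (intro that[of R]) (auto simp: tops_def)
qed

lemma Union_tops:
  assumes "finite F"
  shows "\<Union>(tops F) = \<Union>F"
proof
  show "\<Union>F \<subseteq> \<Union>(tops F)"
  proof
    fix x assume "x \<in> \<Union>F"
    then obtain Q where "Q \<in> F" "x \<in> Q" by blast
    then show "x \<in> \<Union>(tops F)" using ex_tops[OF assms, of Q] by blast
  qed
qed (auto simp: tops_def)

lemma tops_disjoint:
  assumes "laminar F"
  shows "disjoint_family_on (\<lambda>Q. Q) (tops F)"
  unfolding disjoint_family_on_def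
proof (intro ballI impI)
  fix P Q assume "P \<in> tops F" "Q \<in> tops F" "P \<noteq> Q"
  then have "\<not> P \<subseteq> Q" "\<not> Q \<subseteq> P" "P \<in> F" "Q \<in> F"
    unfolding tops_def by blast+
  then show "P \<inter> Q = {}"
    using assms unfolding laminar_def by blast
qed

lemma sum_tops_emeasure:
  assumes "finite F" "laminar F" "F \<subseteq> sets M"
  shows "(\<Sum>Q\<in>tops F. emeasure M Q) = emeasure M (\<Union>F)"
proof -
  have "finite (tops F)" by (rule finite_subset[OF tops_subset assms(1)])
  moreover have "tops F \<subseteq> sets M" using assms(3) tops_subset[of F] by blast
  ultimately have "(\<Sum>Q\<in>tops F. emeasure M ((\<lambda>Q. Q) Q)) = emeasure M (\<Union>Q\<in>tops F. (\<lambda>Q. Q) Q)"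
    by (intro sum_emeasure tops_disjoint assms(2)) auto
  then show ?thesis
    using Union_tops[OF assms(1)] by simp
qed

text \<open>A covering lemma with constant 1: the maximal members of a laminar family are disjoint
  and already have the full union, so the hypothesis is summed over them alone.\<close>

lemma emeasure_Union_le_of_laminar:
  assumes "finite F" "laminar F" "F \<subseteq> sets M" "sets N = sets M"
    and "\<And>Q. Q \<in> F \<Longrightarrow> t * emeasure M Q \<le> emeasure N Q"
  shows "t * emeasure M (\<Union>F) \<le> emeasure N (\<Union>F)"
proof -
  have "t * emeasure M (\<Union>F) = (\<Sum>Q\<in>tops F. t * emeasure M Q)"
    by (simp add: sum_distrib_left sum_tops_emeasure[OF assms(1-3), symmetric])
  also have "\<dots> \<le> (\<Sum>Q\<in>tops F. emeasure N Q)"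
    by (rule sum_mono) (use assms(5) tops_subset[of F] in auto)
  also have "\<dots> = emeasure N (\<Union>F)"
    by (rule sum_tops_emeasure) (use assms in auto)
  finally show ?thesis .
qed

section \<open>Pointwise properties and measurability of the maximal function\<close>

lemma family_max_nonneg: "finite F \<Longrightarrow> 0 \<le> family_max F c x"
  unfolding family_max_def by (rule Max_ge) auto

lemma family_max_ge: "finite F \<Longrightarrow> Q \<in> F \<Longrightarrow> x \<in> Q \<Longrightarrow> c Q \<le> family_max F c x"
  unfolding family_max_def by (rule Max_ge) auto

lemma family_max_le:
  "finite F \<Longrightarrow> 0 \<le> b \<Longrightarrow> (\<And>Q. Q \<in> F \<Longrightarrow> x \<in> Q \<Longrightarrow> c Q \<le> b) \<Longrightarrow> family_max F c x \<le> b"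
  unfolding family_max_def by (subst Max_le_iff) auto

lemma less_family_max_iff: "finite F \<Longrightarrow> 0 \<le> t \<Longrightarrow> t < family_max F c x \<longleftrightarrow> x \<in> \<Union>{Q\<in>F. t < c Q}"
  unfolding family_max_def by (subst Max_gr_iff) auto

lemma family_max_attained:
  assumes "finite F"
  shows "family_max F c x = 0 \<or> (\<exists>Q\<in>F. x \<in> Q \<and> family_max F c x = c Q)"
proof -
  have "family_max F c x \<in> insert 0 (c ` {Q\<in>F. x \<in> Q})"
    unfolding family_max_def by (rule Max_in) (use assms in auto)
  then show ?thesis by auto
qed

lemma family_max_powr:
  assumes "finite F" "\<And>Q. Q \<in> F \<Longrightarrow> 0 \<le> c Q" "0 < r"
  shows "family_max F (\<lambda>Q. c Q powr r) x = family_max F c x powr r"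
proof (rule antisym)
  show "family_max F (\<lambda>Q. c Q powr r) x \<le> family_max F c x powr r"
    by (rule family_max_le) (use assms family_max_ge[of F _ x c] in \<open>auto intro!: powr_mono2\<close>)
  show "family_max F c x powr r \<le> family_max F (\<lambda>Q. c Q powr r) x"
    using family_max_attained[OF assms(1), of c x] family_max_nonneg[OF assms(1), of "\<lambda>Q. c Q powr r" x]
      family_max_ge[OF assms(1), of _ x "\<lambda>Q. c Q powr r"] by auto
qed

lemma borel_measurable_family_max [measurable]:
  assumes "finite F" "F \<subseteq> sets M"
  shows "family_max F c \<in> borel_measurable M"
proof (rule borel_measurable_iff_greater[THEN iffD2], rule allI)
  fix t :: real
  show "{x \<in> space M. t < family_max F c x} \<in> sets M"
  proof (cases "0 \<le> t")
    case True
    have "{x \<in> space M. t < family_max F c x} = \<Union>{Q\<in>F. t < c Q}"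
      using assms(2) by (auto dest: sets.sets_into_space simp: less_family_max_iff[OF assms(1) True])
    also have "\<dots> \<in> sets M"
      using assms by (intro sets.finite_Union) auto
    finally show ?thesis .
  next
    case False
    then have "t < family_max F c x" for x
      using family_max_nonneg[OF assms(1), of c x] by linarith
    then have "{x \<in> space M. t < family_max F c x} = space M" by auto
    then show ?thesis by simp
  qed
qed

text \<open>Layer-cake kernel; the open interval matches the strict conditions on \<open>t\<close>
  under which it is integrated below.\<close>

lemma nn_integral_powr_initial:
  fixes r a :: real
  assumes "0 < r" "0 \<le> a"
  shows "(\<integral>\<^sup>+t. ennreal (indicator {0<..<a} t * t powr (r - 1)) \<partial>lborel) = ennreal (a powr r / r)"
proof -
  have "((\<lambda>t. t powr (r - 1)) has_integral (a powr (r - 1 + 1) / (r - 1 + 1))) {0..a}"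
    by (rule has_integral_powr_from_0) (use assms in auto)
  then have 1: "((\<lambda>t. t powr (r - 1)) has_integral (a powr r / r)) {0..a}" by simp
  have 2: "((\<lambda>t. if t \<in> {0..a} then t powr (r - 1) else 0) has_integral (a powr r / r)) UNIV"
    using 1 by (simp only: has_integral_restrict_UNIV)
  have "((\<lambda>t. indicator {0<..<a} t * t powr (r - 1)) has_integral (a powr r / r)) UNIV"
    by (rule has_integral_spike[OF _ _ 2, of "{0,a}"]) (auto simp: indicator_def)
  then show ?thesis
    by (intro nn_integral_has_integral_lborel) auto
qed

section \<open>Weak and strong type bounds\<close>

text \<open>Cutting \<open>f\<close> off at height \<open>t\<close> makes the strong type bound a plain integration in \<open>t\<close>,
  with no absorption argument.\<close>

lemma laminar_weak_type:
  fixes f :: "'a \<Rightarrow> real" and t :: real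
  assumes F: "finite F" "laminar F" "F \<subseteq> sets M"
    and fin: "\<And>Q. Q \<in> F \<Longrightarrow> emeasure M Q < \<infinity>"
    and f: "f \<in> borel_measurable M" "\<And>x. 0 \<le> f x"
    and c: "\<And>Q. Q \<in> F \<Longrightarrow> ennreal (c Q) * emeasure M Q \<le> (\<integral>\<^sup>+x\<in>Q. ennreal (f x) \<partial>M)"
    and t: "0 < t"
  shows "ennreal t * emeasure M {x\<in>space M. 2 * t < family_max F c x}
    \<le> (\<integral>\<^sup>+x. ennreal (if t < f x then f x else 0) \<partial>M)"
proof -
  define G where "G = {Q\<in>F. 2 * t < c Q}"
  define N where "N = density M (\<lambda>x. ennreal (if t < f x then f x else 0))"
  note [measurable] = f(1)
  have G: "finite G" "laminar G" "G \<subseteq> sets M"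
    using F laminar_subset[of F G] by (auto simp: G_def)
  have eq: "{x\<in>space M. 2 * t < family_max F c x} = \<Union>G"
    using F(3) t by (auto dest: sets.sets_into_space simp: less_family_max_iff[OF F(1)] G_def)
  have "ennreal t * emeasure M (\<Union>G) \<le> emeasure N (\<Union>G)"
  proof (rule emeasure_Union_le_of_laminar[OF G])
    show "sets N = sets M" by (simp add: N_def)
    fix Q assume Q: "Q \<in> G"
    then have QM: "Q \<in> sets M" and QF: "Q \<in> F" and cQ: "2 * t < c Q" using G by (auto simp: G_def)
    note [measurable] = QM
    have NQ: "emeasure N Q = (\<integral>\<^sup>+x\<in>Q. ennreal (if t < f x then f x else 0) \<partial>M)"
      unfolding N_def by (rule emeasure_density) auto
    \<comment> \<open>Half of the lower bound \<open>2 * t\<close> pays for the part of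
      \<open>f\<close> below height \<open>t\<close>, whose integral is at most
      \<open>t * emeasure M Q\<close>; the other half remains for the part above. The cancellation
      uses that this measure is finite.\<close>
    have "ennreal t * emeasure M Q + ennreal t * emeasure M Q = ennreal (2 * t) * emeasure M Q"
      using t by (simp add: distrib_right[symmetric] ennreal_plus[symmetric] del: ennreal_plus)
    also have "\<dots> \<le> ennreal (c Q) * emeasure M Q"
      using cQ by (intro mult_right_mono ennreal_leI) auto
    also have "\<dots> \<le> (\<integral>\<^sup>+x\<in>Q. ennreal (f x) \<partial>M)" by (rule c[OF QF])
    also have "\<dots> \<le> (\<integral>\<^sup>+x. ennreal t * indicator Q x + ennreal (if t < f x then f x else 0) * indicator Q x \<partial>M)"
      by (intro nn_integral_mono) (use t f(2) in \<open>auto simp: indicator_def ennreal_leI\<close>)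
    also have "\<dots> = ennreal t * emeasure M Q + emeasure N Q"
      by (subst nn_integral_add) (auto simp: NQ nn_integral_cmult_indicator)
    finally show "ennreal t * emeasure M Q \<le> emeasure N Q"
      using fin[OF QF] by (subst (asm) ennreal_add_left_cancel_le) (auto simp: ennreal_mult_eq_top_iff)
  qed
  also have "\<dots> = (\<integral>\<^sup>+x\<in>\<Union>G. ennreal (if t < f x then f x else 0) \<partial>M)"
    unfolding N_def by (rule emeasure_density) (use G in auto)
  also have "\<dots> \<le> (\<integral>\<^sup>+x. ennreal (if t < f x then f x else 0) \<partial>M)"
    by (intro nn_integral_mono) (auto simp: indicator_def)
  finally show ?thesis by (simp add: eq)
qed

text \<open>The factor \<open>2 powr p * p\<close> comes from the layer-cake formula at height
  \<open>2 * t\<close>, the factor \<open>1 / (p - 1)\<close> from integrating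
  \<open>t powr (p - 2)\<close> over \<open>0 < t < f x\<close>.\<close>

definition maximal_const :: "real \<Rightarrow> real" where
  "maximal_const p = 2 powr p * p / (p - 1)"

text \<open>Layer-cake formula, weak type bound at each height, and Fubini. The inner integral in
  \<open>t\<close> converges at 0 because 1 < p; it returns a multiple of
  \<open>f x powr (p - 1)\<close>, which the factor \<open>f x\<close> completes.\<close>

lemma laminar_maximal_theorem:
  fixes f :: "'a \<Rightarrow> real" and p :: real
  assumes M: "sigma_finite_measure M"
    and F: "finite F" "laminar F" "F \<subseteq> sets M"
    and fin: "\<And>Q. Q \<in> F \<Longrightarrow> emeasure M Q < \<infinity>"
    and f: "f \<in> borel_measurable M" "\<And>x. 0 \<le> f x"
    and c: "\<And>Q. Q \<in> F \<Longrightarrow> ennreal (c Q) * emeasure M Q \<le> (\<integral>\<^sup>+x\<in>Q. ennreal (f x) \<partial>M)"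
    and p: "1 < p"
  shows "(\<integral>\<^sup>+x. ennreal (family_max F c x powr p) \<partial>M) \<le> ennreal (maximal_const p) * (\<integral>\<^sup>+x. ennreal (f x powr p) \<partial>M)"
proof -
  interpret sigma_finite_measure M by fact
  interpret P: pair_sigma_finite lborel M ..
  note [measurable] = f(1) borel_measurable_family_max[OF F(1,3)]
  have int1: "ennreal (family_max F c x powr p) =
      (\<integral>\<^sup>+t. ennreal (2 powr p * p) * (ennreal (indicator {0<..} t * t powr (p - 1)) * (if 2 * t < family_max F c x then 1 else 0)) \<partial>lborel)" for x
  proof -
    have "(\<integral>\<^sup>+t. ennreal (2 powr p * p) * (ennreal (indicator {0<..} t * t powr (p - 1)) * (if 2 * t < family_max F c x then 1 else 0)) \<partial>lborel)
      = (\<integral>\<^sup>+t. ennreal (2 powr p * p) * ennreal (indicator {0<..<family_max F c x / 2} t * t powr (p - 1)) \<partial>lborel)"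
      by (intro nn_integral_cong) (auto simp: indicator_def)
    also have "\<dots> = ennreal (2 powr p * p) * ennreal ((family_max F c x / 2) powr p / p)"
      using p family_max_nonneg[OF F(1), of c x] by (subst nn_integral_cmult) (auto simp: nn_integral_powr_initial)
    also have "\<dots> = ennreal (family_max F c x powr p)"
      using p family_max_nonneg[OF F(1), of c x] by (simp add: ennreal_mult[symmetric] powr_divide)
    finally show ?thesis by simp
  qed
  have int2: "(\<integral>\<^sup>+t. ennreal (indicator {0<..} t * t powr (p - 2)) * ennreal (if t < f x then f x else 0) \<partial>lborel)
      = ennreal (1 / (p - 1)) * ennreal (f x powr p)" for x
  proof -
    have "(\<integral>\<^sup>+t. ennreal (indicator {0<..} t * t powr (p - 2)) * ennreal (if t < f x then f x else 0) \<partial>lborel)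
      = (\<integral>\<^sup>+t. ennreal (f x) * ennreal (indicator {0<..<f x} t * t powr ((p - 1) - 1)) \<partial>lborel)"
      by (intro nn_integral_cong) (auto simp: indicator_def mult.commute)
    also have "\<dots> = ennreal (f x) * ennreal (f x powr (p - 1) / (p - 1))"
      using p f(2) by (subst nn_integral_cmult) (auto simp: nn_integral_powr_initial[of "p - 1", simplified])
    also have "\<dots> = ennreal (1 / (p - 1)) * ennreal (f x powr p)"
      using p f(2)[of x] by (cases "f x = 0") (auto simp: ennreal_mult[symmetric] powr_diff)
    finally show ?thesis .
  qed
  have "(\<integral>\<^sup>+x. ennreal (family_max F c x powr p) \<partial>M) =
    (\<integral>\<^sup>+t. (\<integral>\<^sup>+x. ennreal (2 powr p * p) * (ennreal (indicator {0<..} t * t powr (p - 1)) * (if 2 * t < family_max F c x then 1 else 0)) \<partial>M) \<partial>lborel)"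
    unfolding int1 by (rule P.Fubini') measurable
  also have "\<dots> = (\<integral>\<^sup>+t. ennreal (2 powr p * p) * (ennreal (indicator {0<..} t * t powr (p - 1)) * emeasure M {x\<in>space M. 2 * t < family_max F c x}) \<partial>lborel)"
  proof (intro nn_integral_cong)
    fix t :: real
    have "(\<integral>\<^sup>+x. (if 2 * t < family_max F c x then 1 else 0) \<partial>M) = (\<integral>\<^sup>+x. indicator {x\<in>space M. 2 * t < family_max F c x} x \<partial>M)"
      by (intro nn_integral_cong) (auto simp: indicator_def)
    also have "\<dots> = emeasure M {x\<in>space M. 2 * t < family_max F c x}" by (rule nn_integral_indicator) measurable
    finally show "(\<integral>\<^sup>+x. ennreal (2 powr p * p) * (ennreal (indicator {0<..} t * t powr (p - 1)) * (if 2 * t < family_max F c x then 1 else 0)) \<partial>M)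
      = ennreal (2 powr p * p) * (ennreal (indicator {0<..} t * t powr (p - 1)) * emeasure M {x\<in>space M. 2 * t < family_max F c x})"
      by (simp add: nn_integral_cmult)
  qed
  also have "\<dots> \<le> (\<integral>\<^sup>+t. ennreal (2 powr p * p) * (\<integral>\<^sup>+x. ennreal (indicator {0<..} t * t powr (p - 2)) * ennreal (if t < f x then f x else 0) \<partial>M) \<partial>lborel)"
  proof (intro nn_integral_mono mult_left_mono)
    fix t :: real
    show "ennreal (indicator {0<..} t * t powr (p - 1)) * emeasure M {x\<in>space M. 2 * t < family_max F c x}
      \<le> (\<integral>\<^sup>+x. ennreal (indicator {0<..} t * t powr (p - 2)) * ennreal (if t < f x then f x else 0) \<partial>M)"
    proof (cases "0 < t")
      case True
      \<comment> \<open>One factor \<open>t\<close> is split off to meet the left side of the weak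
        type bound.\<close>
      have "ennreal (t powr (p - 1)) * emeasure M {x\<in>space M. 2 * t < family_max F c x}
        = ennreal (t powr (p - 2)) * (ennreal t * emeasure M {x\<in>space M. 2 * t < family_max F c x})"
        using True by (simp add: mult.assoc[symmetric] ennreal_mult[symmetric] powr_diff power2_eq_square)
      also have "\<dots> \<le> ennreal (t powr (p - 2)) * (\<integral>\<^sup>+x. ennreal (if t < f x then f x else 0) \<partial>M)"
        by (intro mult_left_mono laminar_weak_type[OF F fin f c True]) auto
      finally show ?thesis using True by (simp add: nn_integral_cmult)
    qed simp
  qed simp
  also have "\<dots> = ennreal (2 powr p * p) * (\<integral>\<^sup>+t. (\<integral>\<^sup>+x. ennreal (indicator {0<..} t * t powr (p - 2)) * ennreal (if t < f x then f x else 0) \<partial>M) \<partial>lborel)"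
    by (rule nn_integral_cmult) measurable
  also have "\<dots> = ennreal (2 powr p * p) * (\<integral>\<^sup>+x. (\<integral>\<^sup>+t. ennreal (indicator {0<..} t * t powr (p - 2)) * ennreal (if t < f x then f x else 0) \<partial>lborel) \<partial>M)"
    by (rule arg_cong[OF P.Fubini'[symmetric]]) measurable
  also have "\<dots> = ennreal (2 powr p * p) * (ennreal (1 / (p - 1)) * (\<integral>\<^sup>+x. ennreal (f x powr p) \<partial>M))"
    unfolding int2 by (subst nn_integral_cmult) simp_all
  also have "\<dots> = ennreal (maximal_const p) * (\<integral>\<^sup>+x. ennreal (f x powr p) \<partial>M)"
    using p by (simp add: maximal_const_def mult.assoc[symmetric] ennreal_mult[symmetric])
  finally show ?thesis .
qed

section \<open>Carleson embedding, sparse subfamilies and Hoelder's inequality\<close>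

text \<open>Each set is charged to one maximal set containing it; the packing hypothesis is then
  needed only on the maximal sets, whose measures add up to that of the union. This is the Carleson
  embedding for a constant \<open>c\<close>.\<close>

lemma sum_le_of_laminar_packing:
  fixes a :: "'a set \<Rightarrow> ennreal"
  assumes F: "finite F" "laminar F" "F \<subseteq> sets N"
    and a: "\<And>R. R \<in> F \<Longrightarrow> (\<Sum>Q\<in>{Q\<in>F. Q \<subseteq> R}. a Q) \<le> A * emeasure N R"
  shows "(\<Sum>Q\<in>F. a Q) \<le> A * emeasure N (\<Union>F)"
proof -
  have "\<forall>Q\<in>F. \<exists>R. R \<in> tops F \<and> Q \<subseteq> R"
    using ex_tops[OF F(1)] by metis
  then obtain r where r: "\<And>Q. Q \<in> F \<Longrightarrow> r Q \<in> tops F" "\<And>Q. Q \<in> F \<Longrightarrow> Q \<subseteq> r Q"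
    by metis
  have fin: "finite (tops F)" by (rule finite_subset[OF tops_subset F(1)])
  have "(\<Sum>Q\<in>F. a Q) = (\<Sum>R\<in>tops F. \<Sum>Q\<in>{Q\<in>F. r Q = R}. a Q)"
    by (rule sum.group[symmetric]) (use F(1) fin r in auto)
  also have "\<dots> \<le> (\<Sum>R\<in>tops F. \<Sum>Q\<in>{Q\<in>F. Q \<subseteq> R}. a Q)"
    by (intro sum_mono sum_mono2) (use F(1) r in auto)
  also have "\<dots> \<le> (\<Sum>R\<in>tops F. A * emeasure N R)"
    by (intro sum_mono a) (auto simp: tops_def)
  also have "\<dots> = A * emeasure N (\<Union>F)"
    by (simp add: sum_distrib_left[symmetric] sum_tops_emeasure[OF F])
  finally show ?thesis .
qed

text \<open>Induction on the number of sets: subtracting the smallest value of \<open>c\<close> from all values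
  removes at least one set, and the subtracted part is controlled by the measure of the union.\<close>

lemma laminar_carleson:
  fixes a :: "'a set \<Rightarrow> ennreal" and c :: "'a set \<Rightarrow> real"
  assumes "finite F" "laminar F" "F \<subseteq> sets N"
    and "\<And>R. R \<in> F \<Longrightarrow> (\<Sum>Q\<in>{Q\<in>F. Q \<subseteq> R}. a Q) \<le> A * emeasure N R"
    and "\<And>Q. Q \<in> F \<Longrightarrow> 0 \<le> c Q"
  shows "(\<Sum>Q\<in>F. a Q * ennreal (c Q)) \<le> A * (\<integral>\<^sup>+x. ennreal (family_max F c x) \<partial>N)"
  using assms
proof (induction F arbitrary: c rule: finite_psubset_induct)
  case (psubset F)
  show ?case
  proof (cases "F = {}")
    case False
    define l where "l = Min (c ` F)"
    \<comment> \<open>Strict inequality drops every set at which the minimum is attained, so the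
      induction hypothesis applies; on the dropped sets the shifted value is 0.\<close>
    define D where "D = {Q\<in>F. l < c Q}"
    have l: "l \<le> c Q" if "Q \<in> F" for Q
      using that psubset.hyps by (simp add: l_def)
    have "l \<in> c ` F" unfolding l_def by (rule Min_in) (use False psubset.hyps in auto)
    then obtain Q0 where Q0: "Q0 \<in> F" "l = c Q0" by blast
    then have l0: "0 \<le> l" using psubset.prems(4) by simp
    have DF: "D \<subset> F" "finite D" "D \<subseteq> F"
      using Q0 psubset.hyps by (auto simp: D_def)
    have IH: "(\<Sum>Q\<in>D. a Q * ennreal (c Q - l)) \<le> A * (\<integral>\<^sup>+x. ennreal (family_max D (\<lambda>Q. c Q - l) x) \<partial>N)"
    proof (rule psubset.IH[OF DF(1)])
      show "laminar D" using laminar_subset[OF psubset.prems(1) DF(3)] .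
      show "D \<subseteq> sets N" using DF(3) psubset.prems(2) by blast
      fix R assume R: "R \<in> D"
      have "(\<Sum>Q\<in>{Q\<in>D. Q \<subseteq> R}. a Q) \<le> (\<Sum>Q\<in>{Q\<in>F. Q \<subseteq> R}. a Q)"
        by (intro sum_mono2) (use DF psubset.hyps in auto)
      also have "\<dots> \<le> A * emeasure N R"
        by (rule psubset.prems(3)) (use R DF in auto)
      finally show "(\<Sum>Q\<in>{Q\<in>D. Q \<subseteq> R}. a Q) \<le> A * emeasure N R" .
    qed (auto simp: D_def)
    have meas: "family_max D (\<lambda>Q. c Q - l) \<in> borel_measurable N"
      by (rule borel_measurable_family_max) (use DF psubset.prems(2) in auto)
    have U: "\<Union>F \<in> sets N"
      using psubset.hyps psubset.prems(2) by (intro sets.finite_Union) auto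
    have "(\<Sum>Q\<in>F. a Q * ennreal (c Q)) = (\<Sum>Q\<in>F. ennreal l * a Q + a Q * ennreal (c Q - l))"
    proof (rule sum.cong)
      fix Q assume "Q \<in> F"
      then have "ennreal (c Q) = ennreal l + ennreal (c Q - l)"
        using l[of Q] l0 by (simp flip: ennreal_plus)
      then show "a Q * ennreal (c Q) = ennreal l * a Q + a Q * ennreal (c Q - l)"
        by (simp add: distrib_left mult.commute)
    qed simp
    also have "\<dots> = ennreal l * (\<Sum>Q\<in>F. a Q) + (\<Sum>Q\<in>F. a Q * ennreal (c Q - l))"
      by (simp add: sum.distrib sum_distrib_left)
    also have "(\<Sum>Q\<in>F. a Q * ennreal (c Q - l)) = (\<Sum>Q\<in>D. a Q * ennreal (c Q - l))"
    proof (rule sum.mono_neutral_right)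
      show "\<forall>Q\<in>F - D. a Q * ennreal (c Q - l) = 0"
        by (auto simp: D_def not_less intro!: ennreal_neg)
    qed (use DF psubset.hyps in auto)
    also have "ennreal l * (\<Sum>Q\<in>F. a Q) + (\<Sum>Q\<in>D. a Q * ennreal (c Q - l))
      \<le> ennreal l * (A * emeasure N (\<Union>F)) + A * (\<integral>\<^sup>+x. ennreal (family_max D (\<lambda>Q. c Q - l) x) \<partial>N)"
      by (rule add_mono[OF mult_left_mono[OF sum_le_of_laminar_packing[OF psubset.hyps(1) psubset.prems(1-3)]] IH]) auto
    also have "\<dots> = A * (ennreal l * emeasure N (\<Union>F) + (\<integral>\<^sup>+x. ennreal (family_max D (\<lambda>Q. c Q - l) x) \<partial>N))"
      by (simp add: distrib_left mult.left_commute)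
    also have "ennreal l * emeasure N (\<Union>F) + (\<integral>\<^sup>+x. ennreal (family_max D (\<lambda>Q. c Q - l) x) \<partial>N)
      = (\<integral>\<^sup>+x. ennreal l * indicator (\<Union>F) x + ennreal (family_max D (\<lambda>Q. c Q - l) x) \<partial>N)"
      using meas U by (subst nn_integral_add) (auto simp: nn_integral_cmult_indicator)
    also have "A * \<dots> \<le> A * (\<integral>\<^sup>+x. ennreal (family_max F c x) \<partial>N)"
    proof (intro mult_left_mono nn_integral_mono)
      fix x
      \<comment> \<open>At a point of the union the maximum over \<open>F\<close> is at least
        \<open>l\<close>, and every shifted value is at most that maximum minus \<open>l\<close>.
        Off the union the left side is 0.\<close>
      show "ennreal l * indicator (\<Union>F) x + ennreal (family_max D (\<lambda>Q. c Q - l) x) \<le> ennreal (family_max F c x)"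
      proof (cases "x \<in> \<Union>F")
        case True
        then obtain Q1 where Q1: "Q1 \<in> F" "x \<in> Q1" by blast
        have "family_max D (\<lambda>Q. c Q - l) x \<le> family_max F c x - l"
        proof (rule family_max_le[OF DF(2)])
          show "0 \<le> family_max F c x - l"
            using family_max_ge[OF psubset.hyps(1) Q1, of c] l[OF Q1(1)] by simp
          fix Q assume "Q \<in> D" "x \<in> Q"
          then show "c Q - l \<le> family_max F c x - l"
            using family_max_ge[OF psubset.hyps(1), of Q x c] DF by auto
        qed
        then have "ennreal (l + family_max D (\<lambda>Q. c Q - l) x) \<le> ennreal (family_max F c x)"
          by (intro ennreal_leI) simp
        then show ?thesis using True l0 family_max_nonneg[OF DF(2)] by simp
      next
        case F: False
        then have "family_max D (\<lambda>Q. c Q - l) x \<le> 0"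
          by (intro family_max_le DF(2)) (use DF in auto)
        then show ?thesis using F by (simp add: ennreal_neg)
      qed
    qed simp
    finally show ?thesis .
  qed simp
qed

section \<open>Principal sets and sparseness\<close>

text \<open>The equivalence defines \<open>S\<close> recursively from the largest sets downwards.\<close>

lemma ex_principal_family:
  fixes \<Phi> :: "'a set \<Rightarrow> real"
  assumes "finite F"
  shows "\<exists>S\<subseteq>F. \<forall>Q\<in>F. Q \<in> S \<longleftrightarrow> (\<forall>R\<in>S. Q \<subset> R \<longrightarrow> a * \<Phi> R < \<Phi> Q)"
  using assms
proof (induction F rule: finite_psubset_induct)
  case (psubset F)
  show ?case
  proof (cases "F = {}")
    case False
    \<comment> \<open>The condition on a set looks only at its strict supersets. A minimal
      \<open>Q0\<close> is a strict superset of no member, so the selection among the others can be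
      made first and \<open>Q0\<close> decided afterwards.\<close>
    then obtain Q0 where Q0: "Q0 \<in> F" "\<forall>b\<in>F. b \<subseteq> Q0 \<longrightarrow> Q0 = b"
      using finite_has_minimal[OF psubset.hyps] by auto
    have "F - {Q0} \<subset> F" using Q0 by blast
    from psubset.IH[OF this] obtain S where S: "S \<subseteq> F - {Q0}"
      "\<forall>Q\<in>F - {Q0}. Q \<in> S \<longleftrightarrow> (\<forall>R\<in>S. Q \<subset> R \<longrightarrow> a * \<Phi> R < \<Phi> Q)"
      by (elim exE conjE) (rule that)
    define S' where "S' = (if \<forall>R\<in>S. Q0 \<subset> R \<longrightarrow> a * \<Phi> R < \<Phi> Q0 then insert Q0 S else S)"
    have "S' \<subseteq> F" using S(1) Q0 by (auto simp: S'_def)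
    moreover have "Q \<in> S' \<longleftrightarrow> (\<forall>R\<in>S'. Q \<subset> R \<longrightarrow> a * \<Phi> R < \<Phi> Q)" if "Q \<in> F" for Q
    proof (cases "Q = Q0")
      case True
      then show ?thesis using S(1) by (auto simp: S'_def)
    next
      case Q: False
      then have "\<not> Q \<subset> Q0" using Q0 that by blast
      then have "(\<forall>R\<in>S'. Q \<subset> R \<longrightarrow> a * \<Phi> R < \<Phi> Q) \<longleftrightarrow> (\<forall>R\<in>S. Q \<subset> R \<longrightarrow> a * \<Phi> R < \<Phi> Q)"
        by (auto simp: S'_def)
      moreover have "Q \<in> S' \<longleftrightarrow> Q \<in> S" using Q by (auto simp: S'_def)
      ultimately show ?thesis using bspec[OF S(2), of Q] that Q by simp
    qed
    ultimately show ?thesis by (intro exI[of _ S'] conjI ballI)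
  qed simp
qed

text \<open>An unselected set lies, by the equivalence that defines \<open>S\<close>, in a selected
  one with comparable \<Phi>; a selected one serves for itself because 1 \<le> a. \<open>E R\<close>
  is \<open>R\<close> without the smaller selected sets: the maximal ones among these are disjoint
  and beat \<open>R\<close> in \<Phi> by the factor \<open>a\<close>, so \<open>pack\<close> leaves
  them at most half of the measure of \<open>R\<close>.\<close>

lemma ex_sparse_subfamily:
  fixes \<Phi> :: "'a set \<Rightarrow> real"
  assumes F: "finite F" "laminar F" "F \<subseteq> sets M"
    and fin: "\<And>Q. Q \<in> F \<Longrightarrow> emeasure M Q < \<infinity>"
    and \<Phi>: "\<And>Q. Q \<in> F \<Longrightarrow> 0 \<le> \<Phi> Q" and a: "1 \<le> a"
    and pack: "\<And>R G. R \<in> F \<Longrightarrow> G \<subseteq> F \<Longrightarrow> disjoint_family_on (\<lambda>Q. Q) G \<Longrightarrow>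
      (\<And>Q. Q \<in> G \<Longrightarrow> Q \<subseteq> R \<and> a * \<Phi> R < \<Phi> Q) \<Longrightarrow>
      2 * (\<Sum>Q\<in>G. emeasure M Q) \<le> emeasure M R"
  obtains S E where "S \<subseteq> F" "\<And>Q. Q \<in> F \<Longrightarrow> \<exists>R\<in>S. Q \<subseteq> R \<and> \<Phi> Q \<le> a * \<Phi> R"
    "disjoint_family_on E S" "\<And>R. R \<in> S \<Longrightarrow> E R \<in> sets M" "\<And>R. E R \<subseteq> R"
    "\<And>R. R \<in> S \<Longrightarrow> emeasure M R \<le> 2 * emeasure M (E R)"
proof -
  obtain S where S: "S \<subseteq> F"
    "\<forall>Q\<in>F. Q \<in> S \<longleftrightarrow> (\<forall>R\<in>S. Q \<subset> R \<longrightarrow> a * \<Phi> R < \<Phi> Q)"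
    using ex_principal_family[OF F(1), of a \<Phi>] by (elim exE conjE) (rule that)
  have fS: "finite S" using S(1) F(1) finite_subset by blast
  define U where "U R = \<Union>{Q\<in>S. Q \<subset> R}" for R
  define E where "E R = R - U R" for R
  have U: "U R \<in> sets M" for R
    unfolding U_def by (rule sets.finite_Union) (use S(1) F fS in auto)
  show ?thesis
  proof (rule that[OF S(1), of E])
    fix Q assume Q: "Q \<in> F"
    show "\<exists>R\<in>S. Q \<subseteq> R \<and> \<Phi> Q \<le> a * \<Phi> R"
    proof (cases "Q \<in> S")
      case True
      have "1 * \<Phi> Q \<le> a * \<Phi> Q" by (rule mult_right_mono[OF a \<Phi>[OF Q]])
      then show ?thesis using True by auto
    next
      case False
      then show ?thesis using bspec[OF S(2) Q] by (auto simp: not_less)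
    qed
  next
    show "disjoint_family_on E S"
      unfolding disjoint_family_on_def
    proof (intro ballI impI)
      fix P Q assume PQ: "P \<in> S" "Q \<in> S" "P \<noteq> Q"
      then consider "P \<subset> Q" | "Q \<subset> P" | "P \<inter> Q = {}"
        using F(2) S(1) unfolding laminar_def by blast
      then show "E P \<inter> E Q = {}"
        by cases (use PQ in \<open>auto simp: E_def U_def\<close>)
    qed
  next
    fix R assume R: "R \<in> S"
    then have RF: "R \<in> F" and RM: "R \<in> sets M" using S(1) F by auto
    show EM: "E R \<in> sets M" unfolding E_def using RM U by auto
    define G where "G = tops {Q\<in>S. Q \<subset> R}"
    have GS: "G \<subseteq> {Q\<in>S. Q \<subset> R}" unfolding G_def by (rule tops_subset)
    have lam: "laminar {Q\<in>S. Q \<subset> R}"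
      by (rule laminar_subset[OF F(2)]) (use S(1) in auto)
    have "2 * (\<Sum>Q\<in>G. emeasure M Q) \<le> emeasure M R"
    proof (rule pack[OF RF])
      show "disjoint_family_on (\<lambda>Q. Q) G" unfolding G_def by (rule tops_disjoint[OF lam])
      show "G \<subseteq> F" using GS S(1) by blast
      fix Q assume "Q \<in> G"
      then have "Q \<in> S" "Q \<subset> R" "Q \<in> F" using GS S(1) by auto
      then show "Q \<subseteq> R \<and> a * \<Phi> R < \<Phi> Q" using bspec[OF S(2), of Q] R by simp
    qed
    also have "(\<Sum>Q\<in>G. emeasure M Q) = emeasure M (U R)"
      unfolding G_def U_def by (rule sum_tops_emeasure) (use fS lam S(1) F in auto)
    finally have 1: "2 * emeasure M (U R) \<le> emeasure M R" .
    have "emeasure M R = emeasure M (E R) + emeasure M (U R)"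
      using EM U[of R] by (subst plus_emeasure) (auto simp: E_def U_def intro!: arg_cong[where f="emeasure M"])
    then have "emeasure M R + emeasure M R = 2 * emeasure M (E R) + 2 * emeasure M (U R)"
      by (simp add: mult_2 ac_simps)
    also have "\<dots> \<le> 2 * emeasure M (E R) + emeasure M R"
      using 1 by (intro add_left_mono)
    finally have "emeasure M R + emeasure M R \<le> emeasure M R + 2 * emeasure M (E R)"
      by (simp add: ac_simps)
    then show "emeasure M R \<le> 2 * emeasure M (E R)"
      using fin[OF RF] by (subst (asm) ennreal_add_left_cancel_le) auto
  qed (auto simp: E_def)
qed

section \<open>Inequalities between means, Hoelder's inequality and sums of powers\<close>

lemma weighted_am_gm:
  fixes x \<theta> :: "'i \<Rightarrow> real"
  assumes "finite I" "\<And>i. i \<in> I \<Longrightarrow> 0 \<le> \<theta> i" "(\<Sum>i\<in>I. \<theta> i) = 1" "\<And>i. i \<in> I \<Longrightarrow> 0 \<le> x i"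
  shows "(\<Prod>i\<in>I. x i powr \<theta> i) \<le> (\<Sum>i\<in>I. \<theta> i * x i)"
proof (cases "\<exists>i\<in>I. x i = 0")
  case True
  then have "(\<Prod>i\<in>I. x i powr \<theta> i) = 0" using assms(1) by (auto intro!: prod_zero)
  also have "\<dots> \<le> (\<Sum>i\<in>I. \<theta> i * x i)" using assms by (intro sum_nonneg) auto
  finally show ?thesis .
next
  case False
  have "(\<Prod>i\<in>I. x i powr \<theta> i) = exp (\<Sum>i\<in>I. \<theta> i *\<^sub>R ln (x i))"
    using False assms(1) by (auto simp: exp_sum powr_def intro!: prod.cong)
  also have "\<dots> \<le> (\<Sum>i\<in>I. \<theta> i * exp (ln (x i)))"
    by (rule convex_on_sum[OF _ _ exp_convex]) (use assms in auto)
  also have "\<dots> = (\<Sum>i\<in>I. \<theta> i * x i)"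
    using False assms(4) by (intro sum.cong) (auto simp: less_le)
  finally show ?thesis .
qed

text \<open>Hoelder's inequality with exponents \<open>1 / \<theta> i\<close>, for upper bounds
  \<open>J i\<close> in place of the integrals: after division by \<open>J i\<close> the weighted
  AM-GM inequality is applied pointwise, and its right side has integral at most the sum of the
  \<open>\<theta> i\<close>, which is 1. If some \<open>J k\<close> is 0, then \<open>h k\<close>
  vanishes almost everywhere and so does the product.\<close>

lemma nn_integral_prod_powr_le:
  fixes h :: "'i \<Rightarrow> 'a \<Rightarrow> real" and \<theta> J :: "'i \<Rightarrow> real"
  assumes I: "finite I" and \<theta>: "\<And>i. i \<in> I \<Longrightarrow> 0 < \<theta> i" "(\<Sum>i\<in>I. \<theta> i) = 1"
    and h: "\<And>i. i \<in> I \<Longrightarrow> h i \<in> borel_measurable M" "\<And>i x. i \<in> I \<Longrightarrow> 0 \<le> h i x"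
    and J: "\<And>i. i \<in> I \<Longrightarrow> 0 \<le> J i" "\<And>i. i \<in> I \<Longrightarrow> (\<integral>\<^sup>+x. ennreal (h i x) \<partial>M) \<le> ennreal (J i)"
  shows "(\<integral>\<^sup>+x. ennreal (\<Prod>i\<in>I. h i x powr \<theta> i) \<partial>M) \<le> ennreal (\<Prod>i\<in>I. J i powr \<theta> i)"
proof (cases "\<exists>i\<in>I. J i = 0")
  case True
  then obtain k where k: "k \<in> I" "J k = 0" by blast
  note [measurable] = h(1)
  have "(\<integral>\<^sup>+x. ennreal (h k x) \<partial>M) = 0" using J(2)[OF k(1)] k(2) by simp
  then have "AE x in M. h k x = 0"
    using k(1) h(2) by (subst (asm) nn_integral_0_iff_AE) (auto simp: ennreal_eq_0_iff antisym)
  then have "AE x in M. ennreal (\<Prod>i\<in>I. h i x powr \<theta> i) = 0"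
  proof eventually_elim
    case (elim x)
    then have "(\<Prod>i\<in>I. h i x powr \<theta> i) = 0" using k(1) I by (intro prod_zero) auto
    then show ?case by simp
  qed
  then have "(\<integral>\<^sup>+x. ennreal (\<Prod>i\<in>I. h i x powr \<theta> i) \<partial>M) = (\<integral>\<^sup>+x. 0 \<partial>M)"
    by (rule nn_integral_cong_AE)
  then show ?thesis by simp
next
  case False
  then have J0: "0 < J i" if "i \<in> I" for i using J(1)[OF that] that by (auto simp: less_le)
  define P where "P = (\<Prod>i\<in>I. J i powr \<theta> i)"
  have P: "0 \<le> P" unfolding P_def by (intro prod_nonneg) auto
  note [measurable] = h(1)
  have le: "(\<Prod>i\<in>I. h i x powr \<theta> i) \<le> P * (\<Sum>i\<in>I. \<theta> i / J i * h i x)" for x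
  proof -
    have "(\<Prod>i\<in>I. h i x powr \<theta> i) = P * (\<Prod>i\<in>I. (h i x / J i) powr \<theta> i)"
      unfolding P_def prod.distrib[symmetric]
      by (intro prod.cong) (use J0 h(2) in \<open>auto simp: powr_divide less_imp_le dest: J0\<close>)
    also have "\<dots> \<le> P * (\<Sum>i\<in>I. \<theta> i * (h i x / J i))"
      by (intro mult_left_mono weighted_am_gm P)
        (use I \<theta> h(2) J0 in \<open>auto intro: less_imp_le divide_nonneg_pos\<close>)
    finally show ?thesis by simp
  qed
  have "(\<integral>\<^sup>+x. ennreal (\<Prod>i\<in>I. h i x powr \<theta> i) \<partial>M)
      \<le> (\<integral>\<^sup>+x. ennreal P * (\<Sum>i\<in>I. ennreal (\<theta> i / J i) * ennreal (h i x)) \<partial>M)"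
  proof (intro nn_integral_mono)
    fix x
    have "ennreal (P * (\<Sum>i\<in>I. \<theta> i / J i * h i x)) = ennreal P * (\<Sum>i\<in>I. ennreal (\<theta> i / J i * h i x))"
      using P \<theta>(1) J0 h(2) by (subst sum_ennreal)
        (auto simp: ennreal_mult sum_nonneg less_imp_le divide_nonneg_pos)
    also have "\<dots> = ennreal P * (\<Sum>i\<in>I. ennreal (\<theta> i / J i) * ennreal (h i x))"
      using \<theta>(1) J0 h(2) by (intro arg_cong[where f="\<lambda>u. ennreal P * u"] sum.cong ennreal_mult)
        (auto simp: less_imp_le divide_nonneg_pos)
    finally show "ennreal (\<Prod>i\<in>I. h i x powr \<theta> i) \<le> ennreal P * (\<Sum>i\<in>I. ennreal (\<theta> i / J i) * ennreal (h i x))"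
      using ennreal_leI[OF le[of x]] by simp
  qed
  also have "\<dots> = ennreal P * (\<Sum>i\<in>I. ennreal (\<theta> i / J i) * (\<integral>\<^sup>+x. ennreal (h i x) \<partial>M))"
    by (subst nn_integral_cmult) (auto simp: nn_integral_sum nn_integral_cmult)
  also have "\<dots> \<le> ennreal P * (\<Sum>i\<in>I. ennreal (\<theta> i / J i) * ennreal (J i))"
    by (intro mult_left_mono sum_mono J(2)) auto
  also have "(\<Sum>i\<in>I. ennreal (\<theta> i / J i) * ennreal (J i)) = (\<Sum>i\<in>I. ennreal (\<theta> i))"
    by (intro sum.cong) (use J0 \<theta>(1) in \<open>auto simp: ennreal_mult[symmetric] less_imp_le dest: J0\<close>)
  also have "\<dots> = 1" using \<theta> by (simp add: sum_ennreal less_imp_le)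
  finally show ?thesis by (simp add: P_def)
qed

text \<open>Counting measure turns the integral inequality into the one for sums.\<close>

lemma sum_prod_powr_le:
  fixes h :: "'i \<Rightarrow> 'b \<Rightarrow> real" and \<theta> :: "'i \<Rightarrow> real"
  assumes "finite I" "\<And>i. i \<in> I \<Longrightarrow> 0 < \<theta> i" "(\<Sum>i\<in>I. \<theta> i) = 1" "finite S"
    and h: "\<And>i x. i \<in> I \<Longrightarrow> 0 \<le> h i x"
  shows "(\<Sum>x\<in>S. \<Prod>i\<in>I. h i x powr \<theta> i) \<le> (\<Prod>i\<in>I. (\<Sum>x\<in>S. h i x) powr \<theta> i)"
proof -
  have "(\<integral>\<^sup>+x. ennreal (\<Prod>i\<in>I. h i x powr \<theta> i) \<partial>count_space S) \<le> ennreal (\<Prod>i\<in>I. (\<Sum>x\<in>S. h i x) powr \<theta> i)"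
    by (rule nn_integral_prod_powr_le)
      (use assms in \<open>auto simp: nn_integral_count_space_finite sum_nonneg\<close>)
  then show ?thesis
    using assms(4) by (simp add: nn_integral_count_space_finite prod_nonneg sum_nonneg)
qed

text \<open>The embedding of l^r into l^1: one factor \<open>x Q powr r\<close> is kept, and its
  remaining power \<open>1 / r - 1\<close> is estimated by that of the whole sum. With r = p / q
  this is where p \<le> q enters.\<close>

lemma sum_le_powr_sum:
  fixes x :: "'b \<Rightarrow> real"
  assumes "\<And>Q. Q \<in> S \<Longrightarrow> 0 \<le> x Q" "0 < r" "r \<le> 1" "finite S"
  shows "(\<Sum>Q\<in>S. x Q) \<le> (\<Sum>Q\<in>S. x Q powr r) powr (1 / r)"
proof -
  define T where "T = (\<Sum>Q\<in>S. x Q powr r)"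
  have T: "0 \<le> T" unfolding T_def by (rule sum_nonneg) auto
  have "x Q \<le> x Q powr r * T powr (1 / r - 1)" if Q: "Q \<in> S" for Q
  proof -
    have "x Q powr r \<le> T" unfolding T_def by (rule member_le_sum) (use assms Q in auto)
    then have "(x Q powr r) powr (1 / r - 1) \<le> T powr (1 / r - 1)"
      by (intro powr_mono2) (use assms in auto)
    then have "x Q powr r * (x Q powr r) powr (1 / r - 1) \<le> x Q powr r * T powr (1 / r - 1)"
      by (intro mult_left_mono) auto
    also have "x Q powr r * (x Q powr r) powr (1 / r - 1) = x Q"
      using assms Q by (subst powr_mult_base) (auto simp: powr_powr)
    finally show ?thesis .
  qed
  then have "(\<Sum>Q\<in>S. x Q) \<le> (\<Sum>Q\<in>S. x Q powr r * T powr (1 / r - 1))" by (rule sum_mono)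
  also have "\<dots> = T * T powr (1 / r - 1)" by (simp add: T_def sum_distrib_right)
  also have "\<dots> = T powr (1 / r)" using T by (simp add: powr_mult_base)
  finally show ?thesis by (simp add: T_def)
qed

text \<open>All ratios are at most 1, so lowering the exponent from \<open>t\<close> to
  \<open>1 / card I\<close> only increases the terms; AM-GM with equal weights then bounds each
  product by a mean, and the sums over \<open>Q\<close> separate.\<close>

lemma sum_prod_powr_le_one:
  fixes r :: "'i \<Rightarrow> 'b \<Rightarrow> real"
  assumes I: "finite I" "I \<noteq> {}" and t: "1 / real (card I) \<le> t" and G: "finite G"
    and r: "\<And>i Q. i \<in> I \<Longrightarrow> Q \<in> G \<Longrightarrow> 0 \<le> r i Q" "\<And>i. i \<in> I \<Longrightarrow> (\<Sum>Q\<in>G. r i Q) \<le> 1"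
  shows "(\<Sum>Q\<in>G. \<Prod>i\<in>I. r i Q powr t) \<le> 1"
proof -
  have n: "0 < card I" using I by (simp add: card_gt_0_iff)
  have r1: "r i Q \<le> 1" if "i \<in> I" "Q \<in> G" for i Q
  proof -
    have "r i Q \<le> (\<Sum>Q\<in>G. r i Q)" by (rule member_le_sum) (use that r G in auto)
    then show ?thesis using r(2)[OF that(1)] by simp
  qed
  have "(\<Sum>Q\<in>G. \<Prod>i\<in>I. r i Q powr t) \<le> (\<Sum>Q\<in>G. \<Prod>i\<in>I. r i Q powr (1 / real (card I)))"
    by (intro sum_mono prod_mono conjI powr_mono') (use t r r1 in auto)
  also have "\<dots> \<le> (\<Sum>Q\<in>G. \<Sum>i\<in>I. 1 / real (card I) * r i Q)"
    by (intro sum_mono weighted_am_gm) (use I n r in auto)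
  also have "\<dots> = (\<Sum>i\<in>I. 1 / real (card I) * (\<Sum>Q\<in>G. r i Q))"
    by (subst sum.swap) (simp add: sum_distrib_left)
  also have "\<dots> \<le> (\<Sum>i\<in>I. 1 / real (card I) * 1)"
    by (intro sum_mono mult_left_mono r(2)) auto
  also have "\<dots> = 1" using n by simp
  finally show ?thesis .
qed

section \<open>Sparse domination for a finite family\<close>

text \<open>An infinite integral would become 0 here, so the passage back to \<open>ennreal\<close>
  always goes through a finiteness fact such as \<open>sg_fin\<close>, \<open>G_fin\<close> or
  \<open>om_fin\<close>.\<close>

definition weight_on :: "'a measure \<Rightarrow> ('a \<Rightarrow> real) \<Rightarrow> 'a set \<Rightarrow> real" where
  "weight_on M w Q = enn2real (\<integral>\<^sup>+x\<in>Q. ennreal (w x) \<partial>M)"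

lemma weight_on_nonneg: "0 \<le> weight_on M w Q"
  by (simp add: weight_on_def)

lemma ennreal_weight_on:
  "(\<integral>\<^sup>+x\<in>Q. ennreal (w x) \<partial>M) < \<infinity> \<Longrightarrow> ennreal (weight_on M w Q) = (\<integral>\<^sup>+x\<in>Q. ennreal (w x) \<partial>M)"
  by (simp add: weight_on_def less_top)

text \<open>Here \<open>s\<close> stands for $m - \alpha/n$ and \<open>F\<close> for a finite family of dyadic cubes; \<open>\<Phi> Q\<close> below is
  $|Q|^{\alpha/n} \prod_i |Q|^{-1} \int_Q f_i \sigma_i$.\<close>

locale weighted_family =
  fixes M :: "'a measure" and F :: "'a set set" and m :: nat and s p q :: real
    and ps :: "nat \<Rightarrow> real" and \<sigma> f :: "nat \<Rightarrow> 'a \<Rightarrow> real" and \<omega> :: "'a \<Rightarrow> real"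
  assumes sigma_fin: "sigma_finite_measure M"
    and F: "finite F" "laminar F" "F \<subseteq> sets M"
    and vol_pos: "\<And>Q. Q \<in> F \<Longrightarrow> 0 < emeasure M Q"
    and vol_fin: "\<And>Q. Q \<in> F \<Longrightarrow> emeasure M Q < \<infinity>"
    and m: "1 \<le> m" and s: "0 < s" "s \<le> real m"
    and ps: "\<And>i. i \<in> {1..m} \<Longrightarrow> 1 < ps i"
    and p: "1 / p = (\<Sum>i=1..m. 1 / ps i)" and q: "1 < q" "p \<le> q"
    and sg_meas: "\<And>i. i \<in> {1..m} \<Longrightarrow> \<sigma> i \<in> borel_measurable M"
    and sg_nonneg: "\<And>i x. i \<in> {1..m} \<Longrightarrow> 0 \<le> \<sigma> i x"
    and sg_pos: "\<And>i Q. i \<in> {1..m} \<Longrightarrow> Q \<in> F \<Longrightarrow> 0 < (\<integral>\<^sup>+x\<in>Q. ennreal (\<sigma> i x) \<partial>M)"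
    and sg_fin: "\<And>i Q. i \<in> {1..m} \<Longrightarrow> Q \<in> F \<Longrightarrow> (\<integral>\<^sup>+x\<in>Q. ennreal (\<sigma> i x) \<partial>M) < \<infinity>"
    and om_meas: "\<omega> \<in> borel_measurable M"
    and om_fin: "\<And>Q. Q \<in> F \<Longrightarrow> (\<integral>\<^sup>+x\<in>Q. ennreal (\<omega> x) \<partial>M) < \<infinity>"
    and f_meas: "\<And>i. i \<in> {1..m} \<Longrightarrow> f i \<in> borel_measurable M"
    and f_nonneg: "\<And>i x. i \<in> {1..m} \<Longrightarrow> 0 \<le> f i x"
    and f_fin: "\<And>i. i \<in> {1..m} \<Longrightarrow> (\<integral>\<^sup>+x. ennreal (f i x powr ps i) * ennreal (\<sigma> i x) \<partial>M) < \<infinity>"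
begin

definition V where "V Q = measure M Q"
definition sg where "sg i Q = weight_on M (\<sigma> i) Q"
definition G where "G i Q = weight_on M (\<lambda>x. \<sigma> i x * f i x) Q"
definition c where "c i Q = G i Q / sg i Q"
text \<open>The power \<open>ps i\<close> of the weighted norm of \<open>f i\<close>, with no root
  taken; the roots come in at \<open>powr_prod_N\<close>.\<close>

definition N where "N i = enn2real (\<integral>\<^sup>+x. ennreal (f i x powr ps i) * ennreal (\<sigma> i x) \<partial>M)"
definition \<Phi> where "\<Phi> Q = (\<Prod>i=1..m. G i Q) / V Q powr s"
definition \<theta> where "\<theta> i = p / ps i"
text \<open>The mean of the square root of \<sigma>_i; its square is what Jensen's inequality puts
  in the place of the geometric mean.\<close>

definition rt where "rt i Q = weight_on M (\<lambda>x. sqrt (\<sigma> i x)) Q / V Q"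

lemma p_pos: "0 < p"
proof -
  have "0 < (\<Sum>i=1..m. 1 / ps i)"
    by (rule sum_pos) (use m ps in \<open>force+\<close>)
  then show ?thesis using p by (metis zero_less_divide_1_iff)
qed

lemma \<theta>_pos: "i \<in> {1..m} \<Longrightarrow> 0 < \<theta> i"
  using p_pos ps[of i] by (simp add: \<theta>_def)

lemma sum_\<theta>: "(\<Sum>i=1..m. \<theta> i) = 1"
proof -
  have "(\<Sum>i=1..m. \<theta> i) = p * (\<Sum>i=1..m. 1 / ps i)"
    by (simp add: \<theta>_def sum_distrib_left)
  also have "\<dots> = 1" using p_pos by (subst p[symmetric]) simp
  finally show ?thesis .
qed

lemma V_pos: "Q \<in> F \<Longrightarrow> 0 < V Q"
  using vol_pos[of Q] vol_fin[of Q] by (simp add: V_def measure_def enn2real_positive_iff)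

lemma emeasure_eq_V: "Q \<in> F \<Longrightarrow> emeasure M Q = ennreal (V Q)"
  using vol_fin[of Q] by (simp add: V_def emeasure_eq_ennreal_measure less_top)

lemma ennreal_sg: "i \<in> {1..m} \<Longrightarrow> Q \<in> F \<Longrightarrow> ennreal (sg i Q) = (\<integral>\<^sup>+x\<in>Q. ennreal (\<sigma> i x) \<partial>M)"
  unfolding sg_def by (rule ennreal_weight_on[OF sg_fin])

lemma sg_gt_0: "i \<in> {1..m} \<Longrightarrow> Q \<in> F \<Longrightarrow> 0 < sg i Q"
  using sg_pos[of i Q] sg_fin[of i Q] by (simp add: sg_def weight_on_def enn2real_positive_iff)

lemma ennreal_N: "i \<in> {1..m} \<Longrightarrow> ennreal (N i) = (\<integral>\<^sup>+x. ennreal (f i x powr ps i) * ennreal (\<sigma> i x) \<partial>M)"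
  using f_fin[of i] by (simp add: N_def less_top)

lemma N_nonneg: "0 \<le> N i"
  by (simp add: N_def)

text \<open>Since only finiteness is wanted, the crude bound
  \<open>f i x \<le> 1 + f i x powr ps i\<close>, integrated against \<sigma>_i over a set of finite
  mass, does the work of Hoelder's inequality.\<close>

lemma G_fin:
  assumes i: "i \<in> {1..m}" and Q: "Q \<in> F"
  shows "(\<integral>\<^sup>+x\<in>Q. ennreal (\<sigma> i x * f i x) \<partial>M) < \<infinity>"
proof -
  note [measurable] = sg_meas[OF i] f_meas[OF i]
  have QM[measurable]: "Q \<in> sets M" using Q F by auto
  have "(\<integral>\<^sup>+x\<in>Q. ennreal (\<sigma> i x * f i x) \<partial>M)
      \<le> (\<integral>\<^sup>+x. ennreal (\<sigma> i x) * indicator Q x + ennreal (f i x powr ps i) * ennreal (\<sigma> i x) \<partial>M)"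
  proof (rule nn_integral_mono)
    fix x
    have "f i x \<le> 1 + f i x powr ps i"
    proof (cases "f i x \<le> 1")
      case False
      then have "f i x powr 1 \<le> f i x powr ps i" using ps[OF i] by (intro powr_mono) auto
      then show ?thesis using False by simp
    qed (auto intro: add_increasing2)
    then have "\<sigma> i x * f i x \<le> \<sigma> i x * (1 + f i x powr ps i)"
      by (intro mult_left_mono sg_nonneg[OF i])
    then have "ennreal (\<sigma> i x * f i x) \<le> ennreal (\<sigma> i x + f i x powr ps i * \<sigma> i x)"
      by (intro ennreal_leI) (simp add: algebra_simps)
    also have "\<dots> = ennreal (\<sigma> i x) + ennreal (f i x powr ps i) * ennreal (\<sigma> i x)"
      using sg_nonneg[OF i, of x] by (simp add: ennreal_mult)
    finally show "ennreal (\<sigma> i x * f i x) * indicator Q x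
      \<le> ennreal (\<sigma> i x) * indicator Q x + ennreal (f i x powr ps i) * ennreal (\<sigma> i x)"
      by (auto simp: indicator_def)
  qed
  also have "\<dots> = (\<integral>\<^sup>+x\<in>Q. ennreal (\<sigma> i x) \<partial>M) + (\<integral>\<^sup>+x. ennreal (f i x powr ps i) * ennreal (\<sigma> i x) \<partial>M)"
    by (rule nn_integral_add) measurable
  also have "\<dots> < \<infinity>" using sg_fin[OF i Q] f_fin[OF i] by simp
  finally show ?thesis .
qed

lemma ennreal_G: "i \<in> {1..m} \<Longrightarrow> Q \<in> F \<Longrightarrow> ennreal (G i Q) = (\<integral>\<^sup>+x\<in>Q. ennreal (\<sigma> i x * f i x) \<partial>M)"
  unfolding G_def by (rule ennreal_weight_on[OF G_fin])

lemma G_nonneg: "0 \<le> G i Q"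
  by (simp add: G_def weight_on_nonneg)

lemma sg_ge_0: "0 \<le> sg i Q"
  by (simp add: sg_def weight_on_nonneg)

lemma c_nonneg: "0 \<le> c i Q"
  by (simp add: c_def G_nonneg sg_ge_0)

lemma \<Phi>_nonneg: "0 \<le> \<Phi> Q"
  by (simp add: \<Phi>_def G_nonneg prod_nonneg)

lemma subfamily: "S \<subseteq> F \<Longrightarrow> finite S \<and> laminar S \<and> S \<subseteq> sets M"
  using F laminar_subset[of F S] finite_subset[of S F] by auto

text \<open>The maximal theorem for the measure \<sigma>_i dx, for which \<open>c i Q\<close> is the
  average of \<open>f i\<close>. Laminarity does here what a doubling condition would do.\<close>

lemma maximal_bound:
  assumes i: "i \<in> {1..m}" and S: "S \<subseteq> F"
  shows "(\<integral>\<^sup>+x. ennreal (family_max S (c i) x powr ps i) * ennreal (\<sigma> i x) \<partial>M) \<le> ennreal (maximal_const (ps i) * N i)"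
proof -
  interpret sigma_finite_measure M by (rule sigma_fin)
  note [measurable] = sg_meas[OF i] f_meas[OF i]
  note SF = subfamily[OF S]
  define D where "D = density M (\<lambda>x. ennreal (\<sigma> i x))"
  have D: "sets D = sets M" by (simp add: D_def)
  have DQ: "emeasure D Q = ennreal (sg i Q)" if "Q \<in> S" for Q
    using that S SF unfolding D_def by (subst emeasure_density) (auto simp: ennreal_sg[OF i])
  have [measurable]: "family_max S (c i) \<in> borel_measurable M"
    using SF by (intro borel_measurable_family_max) auto
  have 1: "(\<integral>\<^sup>+x. ennreal (family_max S (c i) x powr ps i) \<partial>D) \<le> ennreal (maximal_const (ps i)) * (\<integral>\<^sup>+x. ennreal (f i x powr ps i) \<partial>D)"
  proof (rule laminar_maximal_theorem)
    show "sigma_finite_measure D"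
      unfolding D_def by (subst sigma_finite_iff_density_finite) auto
    show "finite S" "laminar S" "S \<subseteq> sets D" using SF D by auto
    show "f i \<in> borel_measurable D" by (simp add: D_def)
    show "0 \<le> f i x" for x by (rule f_nonneg[OF i])
    show "1 < ps i" by (rule ps[OF i])
    fix Q assume Q: "Q \<in> S"
    then have QF: "Q \<in> F" and [measurable]: "Q \<in> sets M" using S SF by auto
    show "emeasure D Q < \<infinity>" by (simp add: DQ[OF Q])
    have "ennreal (c i Q) * emeasure D Q = ennreal (G i Q)"
      using sg_gt_0[OF i QF] by (simp add: DQ[OF Q] c_def G_nonneg ennreal_mult[symmetric])
    also have "\<dots> = (\<integral>\<^sup>+x\<in>Q. ennreal (f i x) \<partial>D)"
      unfolding D_def ennreal_G[OF i QF] using f_nonneg[OF i] sg_nonneg[OF i]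
      by (subst nn_integral_density) (auto simp: ennreal_mult mult.assoc)
    finally show "ennreal (c i Q) * emeasure D Q \<le> (\<integral>\<^sup>+x\<in>Q. ennreal (f i x) \<partial>D)" by simp
  qed
  have "(\<integral>\<^sup>+x. ennreal (family_max S (c i) x powr ps i) * ennreal (\<sigma> i x) \<partial>M) = (\<integral>\<^sup>+x. ennreal (family_max S (c i) x powr ps i) \<partial>D)"
    unfolding D_def by (subst nn_integral_density) (auto simp: mult.commute)
  also note 1
  also have "(\<integral>\<^sup>+x. ennreal (f i x powr ps i) \<partial>D) = ennreal (N i)"
    unfolding D_def ennreal_N[OF i] by (subst nn_integral_density) (auto simp: mult.commute)
  also have "ennreal (maximal_const (ps i)) * ennreal (N i) = ennreal (maximal_const (ps i) * N i)"
    using ps[OF i] N_nonneg[of i] by (intro ennreal_mult[symmetric]) (auto simp: maximal_const_def)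
  finally show ?thesis .
qed

section \<open>Packing of the selected sets\<close>

lemma sum_G_le:
  assumes i: "i \<in> {1..m}" and R: "R \<in> F" and H: "H \<subseteq> F" "disjoint_family_on (\<lambda>Q. Q) H"
    "\<And>Q. Q \<in> H \<Longrightarrow> Q \<subseteq> R"
  shows "(\<Sum>Q\<in>H. G i Q) \<le> G i R"
proof -
  note [measurable] = sg_meas[OF i] f_meas[OF i]
  note HF = subfamily[OF H(1)]
  define D where "D = density M (\<lambda>x. ennreal (\<sigma> i x * f i x))"
  have DQ: "emeasure D Q = ennreal (G i Q)" if "Q \<in> F" for Q
    using that F unfolding D_def by (subst emeasure_density) (auto simp: ennreal_G[OF i])
  have "ennreal (\<Sum>Q\<in>H. G i Q) = (\<Sum>Q\<in>H. emeasure D ((\<lambda>Q. Q) Q))"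
    using H(1) by (subst sum_ennreal[symmetric]) (auto simp: G_nonneg DQ subset_iff)
  also have "\<dots> = emeasure D (\<Union>Q\<in>H. (\<lambda>Q. Q) Q)"
    by (rule sum_emeasure[OF _ H(2)]) (use HF in \<open>auto simp: D_def\<close>)
  also have "\<dots> \<le> emeasure D R"
    by (rule emeasure_mono) (use H(3) R F in \<open>auto simp: D_def\<close>)
  also have "\<dots> = ennreal (G i R)" by (rule DQ[OF R])
  finally show ?thesis by (simp add: G_nonneg)
qed

text \<open>A cube \<open>Q \<subseteq> R\<close> with \<open>2\<^sup>s \<Phi> R < \<Phi> Q\<close> satisfies
  \<open>2 V Q / V R < \<Prod>\<^sub>i (G i Q / G i R) powr (1/s)\<close>, and these products sum to at most 1
  over disjoint cubes because \<open>m / s \<ge> 1\<close>.\<close>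

lemma packing:
  assumes R: "R \<in> F" and H: "H \<subseteq> F" "disjoint_family_on (\<lambda>Q. Q) H"
    and sel: "\<And>Q. Q \<in> H \<Longrightarrow> Q \<subseteq> R \<and> 2 powr s * \<Phi> R < \<Phi> Q"
  shows "2 * (\<Sum>Q\<in>H. emeasure M Q) \<le> emeasure M R"
proof (cases "\<exists>i\<in>{1..m}. G i R = 0")
  \<comment> \<open>If \<sigma>_i f_i has no mass on \<open>R\<close>, it has none on subsets of
    \<open>R\<close>, so \<Phi> vanishes there and nothing is selected. This frees the other case
    from zero denominators.\<close>
  case True
  then obtain i where i: "i \<in> {1..m}" "G i R = 0" by blast
  have "H = {}"
  proof (rule ccontr)
    assume "H \<noteq> {}"
    then obtain Q where Q: "Q \<in> H" by blast
    have "(\<Sum>Q\<in>{Q}. G i Q) \<le> G i R"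
      by (rule sum_G_le[OF i(1) R]) (use Q H sel in \<open>auto simp: disjoint_family_on_def\<close>)
    then have "G i Q = 0" using i(2) G_nonneg[of i Q] by simp
    then have "\<Phi> Q = 0" using i(1) by (auto simp: \<Phi>_def intro!: prod_zero)
    moreover have "0 \<le> 2 powr s * \<Phi> R" by (simp add: \<Phi>_nonneg)
    ultimately show False using sel[OF Q] by simp
  qed
  then show ?thesis by simp
next
  case False
  then have GR: "0 < G i R" if "i \<in> {1..m}" for i using G_nonneg[of i R] that by (auto simp: less_le)
  have fH: "finite H" using subfamily[OF H(1)] by simp
  define r where "r i Q = G i Q / G i R" for i Q
  have "(\<Sum>Q\<in>H. 2 * V Q / V R) \<le> (\<Sum>Q\<in>H. \<Prod>i=1..m. r i Q powr (1 / s))"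
  proof (rule sum_mono)
    fix Q assume Q: "Q \<in> H"
    then have VQ: "0 < V Q" "0 < V R" using V_pos H(1) R by auto
    have P: "0 < (\<Prod>i=1..m. G i R)" using GR by (intro prod_pos) auto
    have "2 powr s * ((\<Prod>i=1..m. G i R) / V R powr s) < (\<Prod>i=1..m. G i Q) / V Q powr s"
      using sel[OF Q] by (simp add: \<Phi>_def)
    then have "(2 * V Q / V R) powr s \<le> (\<Prod>i=1..m. G i Q) / (\<Prod>i=1..m. G i R)"
      using VQ P by (simp add: powr_divide powr_mult field_simps)
    also have "\<dots> = (\<Prod>i=1..m. r i Q)" by (simp add: r_def prod_dividef)
    finally have "((2 * V Q / V R) powr s) powr (1 / s) \<le> (\<Prod>i=1..m. r i Q) powr (1 / s)"
      using s by (intro powr_mono2) auto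
    also have "((2 * V Q / V R) powr s) powr (1 / s) = 2 * V Q / V R"
      using VQ s by (simp add: powr_powr)
    also have "(\<Prod>i=1..m. r i Q) powr (1 / s) = (\<Prod>i=1..m. r i Q powr (1 / s))"
      by (rule prod_powr_distrib)
    finally show "2 * V Q / V R \<le> (\<Prod>i=1..m. r i Q powr (1 / s))" .
  qed
  also have "\<dots> \<le> 1"
  proof (rule sum_prod_powr_le_one)
    show "1 / real (card {1..m}) \<le> 1 / s" using s m by (simp add: frac_le)
    fix i assume i: "i \<in> {1..m}"
    have "(\<Sum>Q\<in>H. G i Q) \<le> G i R" by (rule sum_G_le[OF i R H]) (use sel in auto)
    then show "(\<Sum>Q\<in>H. r i Q) \<le> 1"
      using GR[OF i] by (simp add: r_def sum_divide_distrib[symmetric])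
    show "0 \<le> r i Q" for Q by (simp add: r_def G_nonneg)
  qed (use m fH in auto)
  finally have "2 * (\<Sum>Q\<in>H. V Q) \<le> V R"
    using V_pos[OF R] by (simp add: sum_divide_distrib[symmetric] sum_distrib_left[symmetric])
  then have "ennreal (2 * (\<Sum>Q\<in>H. V Q)) \<le> ennreal (V R)" by (rule ennreal_leI)
  also have "ennreal (2 * (\<Sum>Q\<in>H. V Q)) = 2 * (\<Sum>Q\<in>H. ennreal (V Q))"
    by (simp add: ennreal_mult sum_nonneg V_def sum_ennreal)
  also have "(\<Sum>Q\<in>H. ennreal (V Q)) = (\<Sum>Q\<in>H. emeasure M Q)"
    using H(1) by (intro sum.cong) (auto simp: emeasure_eq_V)
  finally show ?thesis by (simp add: emeasure_eq_V[OF R])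
qed

section \<open>Domination by sparse subfamilies and sums over them\<close>

definition sparse :: "'a set set \<Rightarrow> ('a set \<Rightarrow> 'a set) \<Rightarrow> bool" where
  "sparse S E \<longleftrightarrow> S \<subseteq> F \<and> disjoint_family_on E S \<and>
    (\<forall>R\<in>S. E R \<in> sets M \<and> E R \<subseteq> R \<and> emeasure M R \<le> 2 * emeasure M (E R))"

text \<open>The threshold \<open>2 powr s\<close> is the number whose s-th root is 2, the ratio of
  volumes that \<open>packing\<close> demands; the same number is the loss in the
  domination.\<close>

lemma sparse_domination:
  obtains S E where "sparse S E" "\<And>Q. Q \<in> F \<Longrightarrow> \<exists>R\<in>S. Q \<subseteq> R \<and> \<Phi> Q \<le> 2 powr s * \<Phi> R"
proof (rule ex_sparse_subfamily[OF F vol_fin, of \<Phi> "2 powr s"])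
  show "1 \<le> 2 powr s" using s by (intro ge_one_powr_ge_zero) auto
  show "2 * sum (emeasure M) H \<le> emeasure M R"
    if "R \<in> F" "H \<subseteq> F" "disjoint_family_on (\<lambda>Q. Q) H" "\<And>Q. Q \<in> H \<Longrightarrow> Q \<subseteq> R \<and> 2 powr s * \<Phi> R < \<Phi> Q"
    for R H using packing[OF that] .
  fix S E
  assume "S \<subseteq> F" "\<And>Q. Q \<in> F \<Longrightarrow> \<exists>R\<in>S. Q \<subseteq> R \<and> \<Phi> Q \<le> 2 powr s * \<Phi> R"
    "disjoint_family_on E S" "\<And>R. R \<in> S \<Longrightarrow> E R \<in> sets M" "\<And>R. E R \<subseteq> R"
    "\<And>R. R \<in> S \<Longrightarrow> emeasure M R \<le> 2 * emeasure M (E R)"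
  then show thesis by (intro that[of S E]) (auto simp: sparse_def)
qed (auto simp: \<Phi>_nonneg)

text \<open>The volume of \<open>Q\<close> is at most twice that of \<open>E Q\<close>, and the sets
  \<open>E Q\<close> are disjoint, so at each point at most one term survives and \<open>h\<close>
  bounds it. With \<open>R\<close> a member of the family this yields Carleson conditions; with
  \<open>UNIV\<close> it leads to the maximal theorem.\<close>

lemma sparse_sum_le:
  fixes b :: "'a set \<Rightarrow> real" and h :: "'a \<Rightarrow> ennreal"
  assumes S: "sparse S E" and T: "T \<subseteq> S" "\<And>Q. Q \<in> T \<Longrightarrow> Q \<subseteq> R"
    and b: "\<And>Q. Q \<in> T \<Longrightarrow> 0 \<le> b Q"
    and h: "\<And>Q x. Q \<in> T \<Longrightarrow> x \<in> Q \<Longrightarrow> ennreal (b Q) \<le> h x"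
  shows "ennreal (\<Sum>Q\<in>T. V Q * b Q) \<le> 2 * (\<integral>\<^sup>+x\<in>R. h x \<partial>M)"
proof -
  have SF: "S \<subseteq> F" and dj: "disjoint_family_on E S"
    and E: "\<And>Q. Q \<in> S \<Longrightarrow> E Q \<in> sets M" "\<And>Q. Q \<in> S \<Longrightarrow> E Q \<subseteq> Q"
      "\<And>Q. Q \<in> S \<Longrightarrow> emeasure M Q \<le> 2 * emeasure M (E Q)"
    using S by (auto simp: sparse_def)
  have TF: "T \<subseteq> F" using T(1) SF by blast
  have fT: "finite T" using subfamily[OF TF] by simp
  have "ennreal (\<Sum>Q\<in>T. V Q * b Q) = (\<Sum>Q\<in>T. ennreal (b Q) * emeasure M Q)"
    using TF b by (subst sum_ennreal[symmetric])
      (auto simp: V_def ennreal_mult emeasure_eq_V subset_iff mult.commute intro!: sum.cong)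
  also have "\<dots> \<le> (\<Sum>Q\<in>T. ennreal (b Q) * (2 * emeasure M (E Q)))"
    by (intro sum_mono mult_left_mono E(3)) (use T in auto)
  also have "\<dots> = 2 * (\<Sum>Q\<in>T. ennreal (b Q) * emeasure M (E Q))"
    by (simp add: sum_distrib_left mult.left_commute)
  also have "(\<Sum>Q\<in>T. ennreal (b Q) * emeasure M (E Q)) = (\<integral>\<^sup>+x. (\<Sum>Q\<in>T. ennreal (b Q) * indicator (E Q) x) \<partial>M)"
    using T(1) E(1) by (subst nn_integral_sum) (auto simp: nn_integral_cmult_indicator subset_iff intro!: sum.cong)
  also have "2 * \<dots> \<le> 2 * (\<integral>\<^sup>+x\<in>R. h x \<partial>M)"
  proof (intro mult_left_mono nn_integral_mono)
    fix x
    show "(\<Sum>Q\<in>T. ennreal (b Q) * indicator (E Q) x) \<le> h x * indicator R x"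
    proof (cases "\<exists>Q\<in>T. x \<in> E Q")
      case True
      then obtain Q where Q: "Q \<in> T" "x \<in> E Q" by blast
      have "x \<notin> E P" if "P \<in> T" "P \<noteq> Q" for P
        using dj that Q T(1) unfolding disjoint_family_on_def by blast
      then have "(\<Sum>P\<in>T. ennreal (b P) * indicator (E P) x) = (\<Sum>P\<in>{Q}. ennreal (b P) * indicator (E P) x)"
        by (intro sum.mono_neutral_right) (use fT Q in auto)
      also have "\<dots> = ennreal (b Q)" using Q by simp
      also have "\<dots> \<le> h x" using h[of Q x] Q E(2)[of Q] T by auto
      finally show ?thesis using Q T E(2)[of Q] by (auto simp: indicator_def subset_iff)
    next
      case False
      then have "(\<Sum>Q\<in>T. ennreal (b Q) * indicator (E Q) x) = 0"
        by (intro sum.neutral) auto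
      then show ?thesis by simp
    qed
  qed simp
  finally show ?thesis .
qed

text \<open>The \<open>p / q\<close>-th power of
  \<open>\<Phi> Q powr q * weight_on M \<omega> Q\<close>, as it arises from the embedding of
  l^(p/q) into l^1.\<close>

definition summand where "summand Q = \<Phi> Q powr p * weight_on M \<omega> Q powr (p / q)"

lemma conclusion:
  assumes dom: "\<And>Q. Q \<in> F \<Longrightarrow> \<exists>R\<in>S. Q \<subseteq> R \<and> \<Phi> Q \<le> 2 powr s * \<Phi> R" and S: "S \<subseteq> F"
    and Z: "(\<Sum>Q\<in>S. summand Q) \<le> Z"
  shows "(\<integral>\<^sup>+x. ennreal (family_max F \<Phi> x powr q) * ennreal (\<omega> x) \<partial>M) \<le> ennreal (2 powr (s * q) * Z powr (q / p))"
proof -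
  note [measurable] = om_meas
  note SF = subfamily[OF S]
  \<comment> \<open>The maximum is attained at some \<open>Q\<close> through \<open>x\<close>; the
    selected \<open>R\<close> above it also contains \<open>x\<close>, and a single nonnegative term
    is at most the whole sum.\<close>
  have pw: "family_max F \<Phi> x powr q \<le> 2 powr (s * q) * (\<Sum>Q\<in>S. \<Phi> Q powr q * indicator Q x)" for x
  proof -
    have s0: "0 \<le> (\<Sum>Q\<in>S. \<Phi> Q powr q * indicator Q x)" by (intro sum_nonneg) auto
    consider "family_max F \<Phi> x = 0" | Q where "Q \<in> F" "x \<in> Q" "family_max F \<Phi> x = \<Phi> Q"
      using family_max_attained[OF F(1), of \<Phi> x] by blast
    then show ?thesis
    proof cases
      case 2
      obtain R where R: "R \<in> S" "Q \<subseteq> R" "\<Phi> Q \<le> 2 powr s * \<Phi> R" using dom[OF 2(1)] by blast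
      have "family_max F \<Phi> x powr q \<le> (2 powr s * \<Phi> R) powr q"
        unfolding 2(3) using R(3) q by (intro powr_mono2) (auto simp: \<Phi>_nonneg)
      also have "\<dots> = 2 powr (s * q) * (\<Phi> R powr q * indicator R x)"
        using R(2) 2(2) by (auto simp: powr_mult \<Phi>_nonneg powr_powr)
      also have "\<dots> \<le> 2 powr (s * q) * (\<Sum>Q\<in>S. \<Phi> Q powr q * indicator Q x)"
        by (intro mult_left_mono member_le_sum[of R S "\<lambda>Q. \<Phi> Q powr q * indicator Q x"])
          (use R SF in auto)
      finally show ?thesis .
    qed (use s0 in auto)
  qed
  have "(\<integral>\<^sup>+x. ennreal (family_max F \<Phi> x powr q) * ennreal (\<omega> x) \<partial>M)
    \<le> (\<integral>\<^sup>+x. ennreal (2 powr (s * q)) * (\<Sum>Q\<in>S. ennreal (\<Phi> Q powr q) * (ennreal (\<omega> x) * indicator Q x)) \<partial>M)"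
  proof (rule nn_integral_mono)
    fix x
    have "ennreal (family_max F \<Phi> x powr q) * ennreal (\<omega> x)
      \<le> ennreal (2 powr (s * q) * (\<Sum>Q\<in>S. \<Phi> Q powr q * indicator Q x)) * ennreal (\<omega> x)"
      by (intro mult_right_mono ennreal_leI pw) auto
    also have "\<dots> = ennreal (2 powr (s * q)) * ((\<Sum>Q\<in>S. ennreal (\<Phi> Q powr q) * indicator Q x) * ennreal (\<omega> x))"
      by (subst ennreal_mult) (auto simp: sum_nonneg sum_ennreal[symmetric] ennreal_mult ennreal_indicator mult.assoc)
    also have "(\<Sum>Q\<in>S. ennreal (\<Phi> Q powr q) * indicator Q x) * ennreal (\<omega> x)
      = (\<Sum>Q\<in>S. ennreal (\<Phi> Q powr q) * (ennreal (\<omega> x) * indicator Q x))"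
      by (simp only: sum_distrib_left mult_ac)
    finally show "ennreal (family_max F \<Phi> x powr q) * ennreal (\<omega> x)
      \<le> ennreal (2 powr (s * q)) * (\<Sum>Q\<in>S. ennreal (\<Phi> Q powr q) * (ennreal (\<omega> x) * indicator Q x))" .
  qed
  also have "\<dots> = ennreal (2 powr (s * q)) * (\<Sum>Q\<in>S. ennreal (\<Phi> Q powr q) * (\<integral>\<^sup>+x\<in>Q. ennreal (\<omega> x) \<partial>M))"
  proof -
    have QM: "Q \<in> sets M" if "Q \<in> S" for Q using SF that by blast
    have meas: "(\<lambda>x. ennreal (\<omega> x) * indicator Q x) \<in> borel_measurable M" if "Q \<in> S" for Q
      using QM[OF that] by measurable
    have meas': "(\<lambda>x. ennreal (\<Phi> Q powr q) * (ennreal (\<omega> x) * indicator Q x)) \<in> borel_measurable M"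
      if "Q \<in> S" for Q
      using QM[OF that] by measurable
    have "(\<integral>\<^sup>+x. ennreal (2 powr (s * q)) * (\<Sum>Q\<in>S. ennreal (\<Phi> Q powr q) * (ennreal (\<omega> x) * indicator Q x)) \<partial>M)
      = ennreal (2 powr (s * q)) * (\<integral>\<^sup>+x. (\<Sum>Q\<in>S. ennreal (\<Phi> Q powr q) * (ennreal (\<omega> x) * indicator Q x)) \<partial>M)"
      by (intro nn_integral_cmult borel_measurable_sum meas')
    also have "(\<integral>\<^sup>+x. (\<Sum>Q\<in>S. ennreal (\<Phi> Q powr q) * (ennreal (\<omega> x) * indicator Q x)) \<partial>M)
      = (\<Sum>Q\<in>S. \<integral>\<^sup>+x. ennreal (\<Phi> Q powr q) * (ennreal (\<omega> x) * indicator Q x) \<partial>M)"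
      by (intro nn_integral_sum meas')
    also have "\<dots> = (\<Sum>Q\<in>S. ennreal (\<Phi> Q powr q) * (\<integral>\<^sup>+x\<in>Q. ennreal (\<omega> x) \<partial>M))"
      by (intro sum.cong nn_integral_cmult meas refl)
    finally show ?thesis .
  qed
  also have "(\<Sum>Q\<in>S. ennreal (\<Phi> Q powr q) * (\<integral>\<^sup>+x\<in>Q. ennreal (\<omega> x) \<partial>M)) = (\<Sum>Q\<in>S. ennreal (\<Phi> Q powr q * weight_on M \<omega> Q))"
  proof (rule sum.cong)
    fix Q assume "Q \<in> S"
    then have "Q \<in> F" using S by blast
    then show "ennreal (\<Phi> Q powr q) * (\<integral>\<^sup>+x\<in>Q. ennreal (\<omega> x) \<partial>M) = ennreal (\<Phi> Q powr q * weight_on M \<omega> Q)"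
      by (simp only: ennreal_weight_on[OF om_fin, symmetric] ennreal_mult[OF powr_ge_zero weight_on_nonneg])
  qed simp
  also have "\<dots> = ennreal (\<Sum>Q\<in>S. \<Phi> Q powr q * weight_on M \<omega> Q)"
    by (rule sum_ennreal) (simp add: weight_on_nonneg)
  also have "\<dots> \<le> ennreal (Z powr (q / p))"
  proof (rule ennreal_leI)
    have "(\<Sum>Q\<in>S. \<Phi> Q powr q * weight_on M \<omega> Q)
      \<le> (\<Sum>Q\<in>S. (\<Phi> Q powr q * weight_on M \<omega> Q) powr (p / q)) powr (1 / (p / q))"
      by (rule sum_le_powr_sum) (use p_pos q SF in \<open>auto simp: weight_on_nonneg\<close>)
    also have "(\<Sum>Q\<in>S. (\<Phi> Q powr q * weight_on M \<omega> Q) powr (p / q)) = (\<Sum>Q\<in>S. summand Q)"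
      using q by (intro sum.cong) (auto simp: summand_def powr_mult weight_on_nonneg powr_powr)
    also have "(\<Sum>Q\<in>S. summand Q) powr (1 / (p / q)) \<le> Z powr (q / p)"
      using Z p_pos q by (auto intro!: powr_mono2 sum_nonneg simp: summand_def)
    finally show "(\<Sum>Q\<in>S. \<Phi> Q powr q * weight_on M \<omega> Q) \<le> Z powr (q / p)" .
  qed
  finally show ?thesis by (simp add: ennreal_mult mult_left_mono)
qed

text \<open>Substituting \<open>G = c * sg\<close> separates the averages of the functions from a
  factor that depends on the weights alone, which is what the A and B conditions estimate.\<close>

lemma summand_eq:
  assumes "Q \<in> F"
  shows "summand Q = (\<Prod>i=1..m. c i Q powr p) * ((\<Prod>i=1..m. sg i Q powr p) * weight_on M \<omega> Q powr (p / q) / V Q powr (p * s))"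
proof -
  have "(\<Prod>i=1..m. G i Q) powr p = (\<Prod>i=1..m. c i Q powr p * sg i Q powr p)"
    by (subst prod_powr_distrib)
      (use assms sg_gt_0 in \<open>force simp: G_nonneg c_def powr_divide sg_ge_0 intro!: prod.cong\<close>)+
  then show ?thesis
    using V_pos[OF assms] by (simp add: summand_def \<Phi>_def powr_divide prod_nonneg G_nonneg powr_powr prod.distrib mult.commute)
qed

text \<open>Since the \<open>\<theta> i\<close> sum to 1, one power of the volume can be shared
  among the m factors before Hoelder's inequality is applied.\<close>

lemma prod_V_powr: "Q \<in> F \<Longrightarrow> (\<Prod>i=1..m. V Q powr \<theta> i) = V Q"
  using V_pos[of Q] sum_\<theta> by (simp add: powr_sum[symmetric])

lemma c_powr: "i \<in> {1..m} \<Longrightarrow> (c i Q powr ps i) powr \<theta> i = c i Q powr p"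
  using ps[of i] by (simp add: powr_powr \<theta>_def)

end

section \<open>The three bounds for a finite family\<close>

context weighted_family
begin

lemma rt_fin:
  assumes i: "i \<in> {1..m}" and Q: "Q \<in> F"
  shows "(\<integral>\<^sup>+x\<in>Q. ennreal (sqrt (\<sigma> i x)) \<partial>M) < \<infinity>"
proof -
  note [measurable] = sg_meas[OF i]
  have [measurable]: "Q \<in> sets M" using Q F by auto
  have "(\<integral>\<^sup>+x\<in>Q. ennreal (sqrt (\<sigma> i x)) \<partial>M) \<le> (\<integral>\<^sup>+x. indicator Q x + ennreal (\<sigma> i x) * indicator Q x \<partial>M)"
  proof (rule nn_integral_mono)
    fix x
    \<comment> \<open>Expanding the square gives sqrt \<sigma>_i \<le> \<sigma>_i + 1/4.\<close>
    have "0 \<le> (sqrt (\<sigma> i x) - 1 / 2)\<^sup>2" by simp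
    then have "sqrt (\<sigma> i x) \<le> 1 + \<sigma> i x"
      using sg_nonneg[OF i, of x] by (simp add: power2_eq_square algebra_simps)
    then have "ennreal (sqrt (\<sigma> i x)) \<le> 1 + ennreal (\<sigma> i x)"
      using sg_nonneg[OF i, of x] by (metis ennreal_1 ennreal_leI ennreal_plus zero_le_one)
    then show "ennreal (sqrt (\<sigma> i x)) * indicator Q x \<le> indicator Q x + ennreal (\<sigma> i x) * indicator Q x"
      by (auto simp: indicator_def)
  qed
  also have "\<dots> = emeasure M Q + (\<integral>\<^sup>+x\<in>Q. ennreal (\<sigma> i x) \<partial>M)"
    by (subst nn_integral_add) auto
  also have "\<dots> < \<infinity>" using vol_fin[OF Q] sg_fin[OF i Q] by simp
  finally show ?thesis .
qed

text \<open>The number \<open>c i Q powr (ps i / 2) * rt i Q\<close> is at most the average over \<open>Q\<close> of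
  \<open>(family_max S (c i)) powr (ps i / 2) * sqrt (\<sigma> i)\<close>, so sparseness and the maximal theorem
  in unweighted \<open>L\<^sup>2\<close> suffice; no Carleson condition is needed here.\<close>

lemma B_coeff_sum:
  assumes S: "sparse S E" and i: "i \<in> {1..m}"
  shows "(\<Sum>Q\<in>S. c i Q powr ps i * (V Q * rt i Q powr 2)) \<le> 2 * maximal_const 2 * maximal_const (ps i) * N i"
proof -
  note [measurable] = sg_meas[OF i]
  have SF: "S \<subseteq> F" using S by (simp add: sparse_def)
  note S' = subfamily[OF SF]
  have rt0: "0 \<le> rt i Q" for Q by (simp add: rt_def V_def weight_on_nonneg)
  have mxm [measurable]: "family_max S (c i) \<in> borel_measurable M"
    using S' by (intro borel_measurable_family_max) auto
  \<comment> \<open>The exponent \<open>ps i / 2\<close> is chosen so that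
    \<open>V Q * d Q powr 2\<close> is the term to be summed, while the square of \<open>h\<close>
    is the \<sigma>_i-maximal function to the power \<open>ps i\<close>, times \<sigma>_i. The
    maximal theorem is then used for the exponents 2 and \<open>ps i\<close> in succession.\<close>
  define d where "d Q = c i Q powr (ps i / 2) * rt i Q" for Q
  define h where "h x = family_max S (c i) x powr (ps i / 2) * sqrt (\<sigma> i x)" for x
  have d0: "0 \<le> d Q" for Q by (simp add: d_def rt0)
  have [measurable]: "h \<in> borel_measurable M" unfolding h_def by measurable
  have h0: "0 \<le> h x" for x using sg_nonneg[OF i] by (simp add: h_def)
  have max2: "(\<integral>\<^sup>+x. ennreal (family_max S d x powr 2) \<partial>M) \<le> ennreal (maximal_const 2) * (\<integral>\<^sup>+x. ennreal (h x powr 2) \<partial>M)"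
  proof (rule laminar_maximal_theorem[OF sigma_fin])
    fix Q assume Q: "Q \<in> S"
    then have QF: "Q \<in> F" using SF by auto
    then have [measurable]: "Q \<in> sets M" using F by auto
    show "emeasure M Q < \<infinity>" by (rule vol_fin[OF QF])
    have "ennreal (d Q) * emeasure M Q = ennreal (c i Q powr (ps i / 2)) * ennreal (weight_on M (\<lambda>x. sqrt (\<sigma> i x)) Q)"
      using V_pos[OF QF] by (simp add: emeasure_eq_V[OF QF] d_def rt_def ennreal_mult[symmetric] weight_on_nonneg)
    also have "\<dots> = ennreal (c i Q powr (ps i / 2)) * (\<integral>\<^sup>+x\<in>Q. ennreal (sqrt (\<sigma> i x)) \<partial>M)"
      by (simp only: ennreal_weight_on[OF rt_fin[OF i QF]])
    also have "\<dots> = (\<integral>\<^sup>+x. ennreal (c i Q powr (ps i / 2)) * (ennreal (sqrt (\<sigma> i x)) * indicator Q x) \<partial>M)"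
      by (rule nn_integral_cmult[symmetric]) measurable
    also have "\<dots> \<le> (\<integral>\<^sup>+x\<in>Q. ennreal (h x) \<partial>M)"
    proof (rule nn_integral_mono)
      fix x
      show "ennreal (c i Q powr (ps i / 2)) * (ennreal (sqrt (\<sigma> i x)) * indicator Q x) \<le> ennreal (h x) * indicator Q x"
      proof (cases "x \<in> Q")
        case True
        have "c i Q powr (ps i / 2) * sqrt (\<sigma> i x) \<le> h x"
          unfolding h_def using family_max_ge[of S Q x "c i"] S' Q True ps[OF i] sg_nonneg[OF i, of x]
          by (intro mult_right_mono powr_mono2) (auto simp: c_nonneg)
        then have "ennreal (c i Q powr (ps i / 2) * sqrt (\<sigma> i x)) \<le> ennreal (h x)" by (rule ennreal_leI)
        then show ?thesis using True sg_nonneg[OF i, of x] by (simp add: ennreal_mult)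
      qed simp
    qed
    finally show "ennreal (d Q) * emeasure M Q \<le> (\<integral>\<^sup>+x\<in>Q. ennreal (h x) \<partial>M)" .
  qed (use S' h0 in auto)
  have "ennreal (\<Sum>Q\<in>S. V Q * d Q powr 2) \<le> 2 * (\<integral>\<^sup>+x\<in>UNIV. ennreal (family_max S d x powr 2) \<partial>M)"
  proof (rule sparse_sum_le[OF S order_refl])
    fix Q x assume "Q \<in> S" "x \<in> Q"
    then have "d Q \<le> family_max S d x" using S' by (intro family_max_ge) auto
    then show "ennreal (d Q powr 2) \<le> ennreal (family_max S d x powr 2)"
      using d0[of Q] by (intro ennreal_leI powr_mono2) auto
  qed auto
  also have "\<dots> \<le> 2 * (ennreal (maximal_const 2) * (\<integral>\<^sup>+x. ennreal (h x powr 2) \<partial>M))"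
    using max2 by (intro mult_left_mono) auto
  also have "(\<integral>\<^sup>+x. ennreal (h x powr 2) \<partial>M) = (\<integral>\<^sup>+x. ennreal (family_max S (c i) x powr ps i) * ennreal (\<sigma> i x) \<partial>M)"
    using sg_nonneg[OF i] by (intro nn_integral_cong)
      (simp add: h_def powr_mult powr_powr ennreal_mult[symmetric])
  also have "2 * (ennreal (maximal_const 2) * \<dots>) \<le> 2 * (ennreal (maximal_const 2) * ennreal (maximal_const (ps i) * N i))"
    by (intro mult_left_mono maximal_bound i SF) auto
  also have "\<dots> = ennreal (2 * maximal_const 2 * maximal_const (ps i) * N i)"
  proof -
    have "0 \<le> maximal_const 2" "0 \<le> maximal_const (ps i) * N i" using ps[OF i] N_nonneg[of i] by (auto simp: maximal_const_def)
    then show ?thesis by (simp add: ennreal_mult mult.assoc)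
  qed
  finally have "(\<Sum>Q\<in>S. V Q * d Q powr 2) \<le> 2 * maximal_const 2 * maximal_const (ps i) * N i"
    using ps[OF i] N_nonneg[of i] by (subst (asm) ennreal_le_iff) (auto simp: maximal_const_def)
  also have "(\<Sum>Q\<in>S. V Q * d Q powr 2) = (\<Sum>Q\<in>S. c i Q powr ps i * (V Q * rt i Q powr 2))"
    by (intro sum.cong) (auto simp: d_def powr_mult rt0 powr_powr)
  finally show ?thesis .
qed

text \<open>\<open>\<theta> i / p = 1 / ps i\<close>, so the root of order p restores the norms. The
  constants \<open>D i\<close> stay beside \<open>N i\<close> because both come out of one sum
  carrying the exponent \<open>\<theta> i\<close>.\<close>

lemma powr_prod_N:
  assumes "0 \<le> B" and D: "\<And>i. i \<in> {1..m} \<Longrightarrow> 0 \<le> D i"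
  shows "(B * (\<Prod>i=1..m. (D i * N i) powr \<theta> i)) powr (q / p)
    = (B powr (1 / p) * (\<Prod>i=1..m. D i powr (1 / ps i)) * (\<Prod>i=1..m. N i powr (1 / ps i))) powr q"
proof -
  have "(\<Prod>i=1..m. (D i * N i) powr \<theta> i) powr (1 / p) = (\<Prod>i=1..m. ((D i * N i) powr \<theta> i) powr (1 / p))"
    by (rule prod_powr_distrib)
  also have "\<dots> = (\<Prod>i=1..m. D i powr (1 / ps i) * N i powr (1 / ps i))"
    using p_pos by (intro prod.cong) (auto simp: powr_powr \<theta>_def powr_mult D N_nonneg)
  finally have *: "(\<Prod>i=1..m. (D i * N i) powr \<theta> i) powr (1 / p)
      = (\<Prod>i=1..m. D i powr (1 / ps i)) * (\<Prod>i=1..m. N i powr (1 / ps i))"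
    by (simp add: prod.distrib)
  have "(B * (\<Prod>i=1..m. (D i * N i) powr \<theta> i)) powr (q / p)
      = ((B * (\<Prod>i=1..m. (D i * N i) powr \<theta> i)) powr (1 / p)) powr q"
    by (simp add: powr_powr)
  also have "(B * (\<Prod>i=1..m. (D i * N i) powr \<theta> i)) powr (1 / p)
      = B powr (1 / p) * ((\<Prod>i=1..m. D i powr (1 / ps i)) * (\<Prod>i=1..m. N i powr (1 / ps i)))"
    unfolding *[symmetric] by (rule powr_mult)
  finally show ?thesis by (simp add: mult.assoc)
qed

text \<open>Common ending of the three bounds: \<open>B\<close> carries the joint weight constant,
  \<open>D i\<close> the loss in the i-th factor.\<close>

lemma conclusion_prod:
  assumes S: "sparse S E" and dom: "\<And>Q. Q \<in> F \<Longrightarrow> \<exists>R\<in>S. Q \<subseteq> R \<and> \<Phi> Q \<le> 2 powr s * \<Phi> R"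
    and B: "0 \<le> B" and D: "\<And>i. i \<in> {1..m} \<Longrightarrow> 0 \<le> D i"
    and le: "(\<Sum>Q\<in>S. summand Q) \<le> B * (\<Prod>i=1..m. (D i * N i) powr \<theta> i)"
  shows "(\<integral>\<^sup>+x. ennreal (family_max F \<Phi> x powr q) * ennreal (\<omega> x) \<partial>M)
    \<le> ennreal ((2 powr s * B powr (1 / p) * (\<Prod>i=1..m. D i powr (1 / ps i)) * (\<Prod>i=1..m. N i powr (1 / ps i))) powr q)"
proof -
  have SF: "S \<subseteq> F" using S by (simp add: sparse_def)
  have "(\<integral>\<^sup>+x. ennreal (family_max F \<Phi> x powr q) * ennreal (\<omega> x) \<partial>M)
      \<le> ennreal (2 powr (s * q) * (B * (\<Prod>i=1..m. (D i * N i) powr \<theta> i)) powr (q / p))"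
    by (rule conclusion[OF dom SF le])
  also have "(B * (\<Prod>i=1..m. (D i * N i) powr \<theta> i)) powr (q / p)
      = (B powr (1 / p) * (\<Prod>i=1..m. D i powr (1 / ps i)) * (\<Prod>i=1..m. N i powr (1 / ps i))) powr q"
    by (rule powr_prod_N[OF B]) (rule D)
  also have "2 powr (s * q) * (B powr (1 / p) * (\<Prod>i=1..m. D i powr (1 / ps i)) * (\<Prod>i=1..m. N i powr (1 / ps i))) powr q
      = (2 powr s * (B powr (1 / p) * (\<Prod>i=1..m. D i powr (1 / ps i)) * (\<Prod>i=1..m. N i powr (1 / ps i)))) powr q"
    by (simp only: powr_mult[of "2 powr s"] powr_powr)
  finally show ?thesis by (simp add: mult.assoc)
qed

text \<open>\<open>H\<close> is the B condition on one set, with the inverse geometric means already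
  moved across by Jensen's inequality. Its extra power of the volume is shared out by
  \<open>prod_V_powr\<close>, each factor becomes a term of \<open>B_coeff_sum\<close>, and
  Hoelder's inequality for sums separates them.\<close>

theorem B_bound:
  assumes B: "0 \<le> B"
    and H: "\<And>Q. Q \<in> F \<Longrightarrow> weight_on M \<omega> Q powr (p / q) * (\<Prod>i=1..m. sg i Q powr p)
      \<le> B * V Q powr (p * s + 1) * (\<Prod>i=1..m. (rt i Q powr 2) powr \<theta> i)"
  shows "(\<integral>\<^sup>+x. ennreal (family_max F \<Phi> x powr q) * ennreal (\<omega> x) \<partial>M)
    \<le> ennreal ((2 powr s * B powr (1 / p) * (\<Prod>i=1..m. (2 * maximal_const 2 * maximal_const (ps i)) powr (1 / ps i))
        * (\<Prod>i=1..m. N i powr (1 / ps i))) powr q)"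
proof -
  obtain S E where S: "sparse S E" and dom: "\<And>Q. Q \<in> F \<Longrightarrow> \<exists>R\<in>S. Q \<subseteq> R \<and> \<Phi> Q \<le> 2 powr s * \<Phi> R"
    using sparse_domination by blast
  have SF: "S \<subseteq> F" using S by (simp add: sparse_def)
  note S' = subfamily[OF SF]
  have rt0: "0 \<le> rt i Q" for i Q by (simp add: rt_def V_def weight_on_nonneg)
  have V0: "0 \<le> V Q" for Q by (simp add: V_def)
  have D0: "0 \<le> 2 * maximal_const 2 * maximal_const (ps i)" if "i \<in> {1..m}" for i
    using ps[OF that] by (simp add: maximal_const_def)
  have "summand Q \<le> B * (\<Prod>i=1..m. (c i Q powr ps i * (V Q * rt i Q powr 2)) powr \<theta> i)" if Q: "Q \<in> S" for Q
  proof -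
    have QF: "Q \<in> F" using Q SF by auto
    have "summand Q \<le> (\<Prod>i=1..m. c i Q powr p) * (B * V Q powr (p * s + 1) * (\<Prod>i=1..m. (rt i Q powr 2) powr \<theta> i) / V Q powr (p * s))"
      unfolding summand_eq[OF QF] using H[OF QF]
      by (intro mult_left_mono divide_right_mono prod_nonneg) (auto simp: mult.commute)
    also have "\<dots> = B * ((\<Prod>i=1..m. c i Q powr p) * (V Q * (\<Prod>i=1..m. (rt i Q powr 2) powr \<theta> i)))"
      using V_pos[OF QF] by (simp add: powr_add)
    also have "\<dots> = B * ((\<Prod>i=1..m. (c i Q powr ps i) powr \<theta> i) * ((\<Prod>i=1..m. V Q powr \<theta> i) * (\<Prod>i=1..m. (rt i Q powr 2) powr \<theta> i)))"
      by (simp only: prod_V_powr[OF QF]) (simp add: c_powr)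
    also have "\<dots> = B * (\<Prod>i=1..m. (c i Q powr ps i * (V Q * rt i Q powr 2)) powr \<theta> i)"
      by (simp add: prod.distrib[symmetric] powr_mult V0 rt0)
    finally show ?thesis .
  qed
  then have "(\<Sum>Q\<in>S. summand Q) \<le> (\<Sum>Q\<in>S. B * (\<Prod>i=1..m. (c i Q powr ps i * (V Q * rt i Q powr 2)) powr \<theta> i))"
    by (rule sum_mono)
  also have "\<dots> = B * (\<Sum>Q\<in>S. \<Prod>i=1..m. (c i Q powr ps i * (V Q * rt i Q powr 2)) powr \<theta> i)"
    by (simp add: sum_distrib_left)
  also have "\<dots> \<le> B * (\<Prod>i=1..m. (\<Sum>Q\<in>S. c i Q powr ps i * (V Q * rt i Q powr 2)) powr \<theta> i)"
    by (intro mult_left_mono sum_prod_powr_le B) (use S' \<theta>_pos sum_\<theta> V0 in auto)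
  also have "\<dots> \<le> B * (\<Prod>i=1..m. (2 * maximal_const 2 * maximal_const (ps i) * N i) powr \<theta> i)"
    by (intro mult_left_mono prod_mono conjI powr_mono2 B_coeff_sum[OF S] B)
      (use \<theta>_pos V0 in \<open>auto intro!: sum_nonneg simp: less_imp_le\<close>)
  finally show ?thesis by (intro conclusion_prod[OF S dom B D0])
qed

text \<open>\<open>h i R\<close> stands for the maximal function of \<sigma>_i restricted to
  \<open>R\<close>. Two properties of it suffice: it majorises the averages over members inside
  \<open>R\<close>, and its integral over \<open>R\<close> is at most \<open>K i\<close> times the
  mass of \<open>R\<close>. So the argument stays in an abstract measure space.\<close>

theorem A_bound:
  fixes h :: "nat \<Rightarrow> 'a set \<Rightarrow> 'a \<Rightarrow> ennreal"
  assumes A: "0 \<le> A" and K: "\<And>i. i \<in> {1..m} \<Longrightarrow> 0 \<le> K i"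
    and H: "\<And>Q. Q \<in> F \<Longrightarrow> weight_on M \<omega> Q powr (p / q) * (\<Prod>i=1..m. sg i Q powr (p - \<theta> i)) \<le> A * V Q powr (p * s)"
    and h: "\<And>i Q R x. i \<in> {1..m} \<Longrightarrow> R \<in> F \<Longrightarrow> Q \<in> F \<Longrightarrow> Q \<subseteq> R \<Longrightarrow> x \<in> Q \<Longrightarrow> ennreal (sg i Q / V Q) \<le> h i R x"
    and hK: "\<And>i R. i \<in> {1..m} \<Longrightarrow> R \<in> F \<Longrightarrow> (\<integral>\<^sup>+x\<in>R. h i R x \<partial>M) \<le> ennreal (K i) * (\<integral>\<^sup>+x\<in>R. ennreal (\<sigma> i x) \<partial>M)"
  shows "(\<integral>\<^sup>+x. ennreal (family_max F \<Phi> x powr q) * ennreal (\<omega> x) \<partial>M)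
    \<le> ennreal ((2 powr s * A powr (1 / p) * (\<Prod>i=1..m. (2 * K i * maximal_const (ps i)) powr (1 / ps i))
        * (\<Prod>i=1..m. N i powr (1 / ps i))) powr q)"
proof -
  obtain S E where S: "sparse S E" and dom: "\<And>Q. Q \<in> F \<Longrightarrow> \<exists>R\<in>S. Q \<subseteq> R \<and> \<Phi> Q \<le> 2 powr s * \<Phi> R"
    using sparse_domination by blast
  have SF: "S \<subseteq> F" using S by (simp add: sparse_def)
  note S' = subfamily[OF SF]
  have D0: "0 \<le> 2 * K i * maximal_const (ps i)" if "i \<in> {1..m}" for i
    using ps[OF that] K[OF that] by (simp add: maximal_const_def)
  have car: "(\<Sum>Q\<in>S. c i Q powr ps i * sg i Q) \<le> 2 * K i * maximal_const (ps i) * N i" if i: "i \<in> {1..m}" for i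
  proof -
    note [measurable] = sg_meas[OF i]
    have mxm [measurable]: "family_max S (c i) \<in> borel_measurable M"
      using S' by (intro borel_measurable_family_max) auto
    define D where "D = density M (\<lambda>x. ennreal (\<sigma> i x))"
    have DQ: "emeasure D Q = (\<integral>\<^sup>+x\<in>Q. ennreal (\<sigma> i x) \<partial>M)" if "Q \<in> S" for Q
      using that S' unfolding D_def by (subst emeasure_density) auto
    have "(\<Sum>Q\<in>S. ennreal (sg i Q) * ennreal (c i Q powr ps i))
        \<le> 2 * ennreal (K i) * (\<integral>\<^sup>+x. ennreal (family_max S (\<lambda>Q. c i Q powr ps i) x) \<partial>D)"
    proof (rule laminar_carleson)
      fix R assume R: "R \<in> S"
      \<comment> \<open>The Carleson condition: each mass is written as volume times average,
        sparseness replaces the volumes by those of disjoint sets, and \<open>h i R\<close>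
        majorises all the averages at once.\<close>
      have "(\<Sum>Q\<in>{Q\<in>S. Q \<subseteq> R}. ennreal (sg i Q)) = ennreal (\<Sum>Q\<in>{Q\<in>S. Q \<subseteq> R}. V Q * (sg i Q / V Q))"
        using SF V_pos by (subst sum_ennreal) (force simp: sg_ge_0 intro!: arg_cong[where f=ennreal] sum.cong)+
      also have "\<dots> \<le> 2 * (\<integral>\<^sup>+x\<in>R. h i R x \<partial>M)"
      proof (rule sparse_sum_le[OF S])
        fix Q x assume "Q \<in> {Q\<in>S. Q \<subseteq> R}" "x \<in> Q"
        then show "ennreal (sg i Q / V Q) \<le> h i R x"
          using SF R by (intro h i) auto
      qed (auto simp: sg_ge_0 V_def)
      also have "\<dots> \<le> 2 * (ennreal (K i) * emeasure D R)"
        unfolding DQ[OF R] by (intro mult_left_mono hK i) (use R SF in auto)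
      finally show "(\<Sum>Q\<in>{Q\<in>S. Q \<subseteq> R}. ennreal (sg i Q)) \<le> 2 * ennreal (K i) * emeasure D R"
        by (simp add: mult.assoc)
    qed (use S' in \<open>auto simp: D_def\<close>)
    also have "(\<integral>\<^sup>+x. ennreal (family_max S (\<lambda>Q. c i Q powr ps i) x) \<partial>D)
        = (\<integral>\<^sup>+x. ennreal (family_max S (c i) x powr ps i) * ennreal (\<sigma> i x) \<partial>M)"
      unfolding D_def using S' ps[OF i]
      by (subst family_max_powr) (auto simp: c_nonneg nn_integral_density mult.commute)
    also have "2 * ennreal (K i) * \<dots> \<le> 2 * ennreal (K i) * ennreal (maximal_const (ps i) * N i)"
      by (intro mult_left_mono maximal_bound i SF) auto
    also have "\<dots> = ennreal (2 * K i * maximal_const (ps i) * N i)"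
    proof -
      have "0 \<le> maximal_const (ps i) * N i" using ps[OF i] N_nonneg[of i] by (auto simp: maximal_const_def)
      then show ?thesis using K[OF i] by (simp add: ennreal_mult mult.assoc)
    qed
    also have "(\<Sum>Q\<in>S. ennreal (sg i Q) * ennreal (c i Q powr ps i)) = ennreal (\<Sum>Q\<in>S. c i Q powr ps i * sg i Q)"
      by (subst sum_ennreal[symmetric]) (auto simp: sg_ge_0 ennreal_mult mult.commute)
    finally show ?thesis
      using D0[OF i] N_nonneg[of i] by (subst (asm) ennreal_le_iff) auto
  qed
  have "summand Q \<le> A * (\<Prod>i=1..m. (c i Q powr ps i * sg i Q) powr \<theta> i)" if Q: "Q \<in> S" for Q
  proof -
    have QF: "Q \<in> F" using Q SF by auto
    \<comment> \<open>The exponent \<open>p - \<theta> i\<close> equals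
      \<open>p / conj_exp (ps i)\<close>, the one in the A condition; the remaining power
      \<open>\<theta> i\<close> goes to the Carleson sums.\<close>
    have "(\<Prod>i=1..m. sg i Q powr p) = (\<Prod>i=1..m. sg i Q powr (p - \<theta> i)) * (\<Prod>i=1..m. sg i Q powr \<theta> i)"
      unfolding prod.distrib[symmetric] by (simp add: powr_add[symmetric])
    then have "(\<Prod>i=1..m. sg i Q powr p) * weight_on M \<omega> Q powr (p / q) / V Q powr (p * s)
      = (\<Prod>i=1..m. sg i Q powr \<theta> i) * (weight_on M \<omega> Q powr (p / q) * (\<Prod>i=1..m. sg i Q powr (p - \<theta> i))) / V Q powr (p * s)"
      by simp
    also have "\<dots> \<le> (\<Prod>i=1..m. sg i Q powr \<theta> i) * (A * V Q powr (p * s)) / V Q powr (p * s)"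
      by (intro divide_right_mono mult_left_mono H QF prod_nonneg) auto
    also have "\<dots> = A * (\<Prod>i=1..m. sg i Q powr \<theta> i)" using V_pos[OF QF] by simp
    finally have "summand Q \<le> (\<Prod>i=1..m. c i Q powr p) * (A * (\<Prod>i=1..m. sg i Q powr \<theta> i))"
      unfolding summand_eq[OF QF] by (intro mult_left_mono prod_nonneg) auto
    also have "\<dots> = A * ((\<Prod>i=1..m. (c i Q powr ps i) powr \<theta> i) * (\<Prod>i=1..m. sg i Q powr \<theta> i))"
      by (simp add: c_powr)
    also have "\<dots> = A * (\<Prod>i=1..m. (c i Q powr ps i * sg i Q) powr \<theta> i)"
      by (simp add: prod.distrib[symmetric] powr_mult sg_ge_0)
    finally show ?thesis .
  qed
  then have "(\<Sum>Q\<in>S. summand Q) \<le> (\<Sum>Q\<in>S. A * (\<Prod>i=1..m. (c i Q powr ps i * sg i Q) powr \<theta> i))"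
    by (rule sum_mono)
  also have "\<dots> = A * (\<Sum>Q\<in>S. \<Prod>i=1..m. (c i Q powr ps i * sg i Q) powr \<theta> i)"
    by (simp add: sum_distrib_left)
  also have "\<dots> \<le> A * (\<Prod>i=1..m. (\<Sum>Q\<in>S. c i Q powr ps i * sg i Q) powr \<theta> i)"
    by (intro mult_left_mono sum_prod_powr_le A) (use S' \<theta>_pos sum_\<theta> sg_ge_0 in auto)
  also have "\<dots> \<le> A * (\<Prod>i=1..m. (2 * K i * maximal_const (ps i) * N i) powr \<theta> i)"
    by (intro mult_left_mono prod_mono conjI powr_mono2 car A)
      (use \<theta>_pos sg_ge_0 in \<open>auto intro!: sum_nonneg simp: less_imp_le\<close>)
  finally show ?thesis by (intro conclusion_prod[OF S dom A D0])
qed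

text \<open>Here Hoelder's inequality comes after the Carleson embedding: there is one embedding for
  the product coefficients, with respect to the measure whose density is the product of the
  \<open>\<sigma> i x powr \<theta> i\<close>. A joint condition on the weights is therefore enough,
  instead of one on each.\<close>

theorem W_bound:
  fixes h :: "'a set \<Rightarrow> 'a \<Rightarrow> ennreal"
  assumes A: "0 \<le> A" and K: "0 \<le> K"
    and H: "\<And>Q. Q \<in> F \<Longrightarrow> weight_on M \<omega> Q powr (p / q) * (\<Prod>i=1..m. sg i Q powr (p - \<theta> i)) \<le> A * V Q powr (p * s)"
    and h: "\<And>Q R x. R \<in> F \<Longrightarrow> Q \<in> F \<Longrightarrow> Q \<subseteq> R \<Longrightarrow> x \<in> Q \<Longrightarrow> ennreal (\<Prod>i=1..m. (sg i Q / V Q) powr \<theta> i) \<le> h R x"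
    and hK: "\<And>R. R \<in> F \<Longrightarrow> (\<integral>\<^sup>+x\<in>R. h R x \<partial>M) \<le> ennreal K * (\<integral>\<^sup>+x\<in>R. ennreal (\<Prod>i=1..m. \<sigma> i x powr \<theta> i) \<partial>M)"
  shows "(\<integral>\<^sup>+x. ennreal (family_max F \<Phi> x powr q) * ennreal (\<omega> x) \<partial>M)
    \<le> ennreal ((2 powr s * (2 * A * K) powr (1 / p) * (\<Prod>i=1..m. maximal_const (ps i) powr (1 / ps i))
        * (\<Prod>i=1..m. N i powr (1 / ps i))) powr q)"
proof -
  obtain S E where S: "sparse S E" and dom: "\<And>Q. Q \<in> F \<Longrightarrow> \<exists>R\<in>S. Q \<subseteq> R \<and> \<Phi> Q \<le> 2 powr s * \<Phi> R"
    using sparse_domination by blast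
  have SF: "S \<subseteq> F" using S by (simp add: sparse_def)
  note S' = subfamily[OF SF]
  note sgm [measurable] = sg_meas
  have D0: "0 \<le> maximal_const (ps i)" if "i \<in> {1..m}" for i
    using ps[OF that] by (simp add: maximal_const_def)
  have mxm [measurable]: "family_max S b \<in> borel_measurable M" for b
    using S' by (intro borel_measurable_family_max) auto
  define D where "D = density M (\<lambda>x. ennreal (\<Prod>i=1..m. \<sigma> i x powr \<theta> i))"
  have dm [measurable]: "(\<lambda>x. ennreal (\<Prod>i=1..m. \<sigma> i x powr \<theta> i)) \<in> borel_measurable M"
    by measurable
  have DQ: "emeasure D Q = (\<integral>\<^sup>+x\<in>Q. ennreal (\<Prod>i=1..m. \<sigma> i x powr \<theta> i) \<partial>M)" if "Q \<in> S" for Q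
    using that S' unfolding D_def by (subst emeasure_density) auto
  define a where "a Q = (\<Prod>i=1..m. sg i Q powr \<theta> i)" for Q
  define l where "l Q = (\<Prod>i=1..m. c i Q powr p)" for Q
  have a0: "0 \<le> a Q" and l0: "0 \<le> l Q" for Q by (auto simp: a_def l_def intro!: prod_nonneg)
  \<comment> \<open>Because the \<open>\<theta> i\<close> sum to 1, the coefficient is the volume
    times a weighted geometric mean of averages, the form to which \<open>sparse_sum_le\<close>
    applies.\<close>
  have a_eq: "a Q = V Q * (\<Prod>i=1..m. (sg i Q / V Q) powr \<theta> i)" if "Q \<in> F" for Q
    using V_pos[OF that] prod_V_powr[OF that]
    by (simp add: a_def powr_divide sg_ge_0 prod_dividef)
  have "(\<Sum>Q\<in>S. ennreal (a Q) * ennreal (l Q)) \<le> 2 * ennreal K * (\<integral>\<^sup>+x. ennreal (family_max S l x) \<partial>D)"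
  proof (rule laminar_carleson)
    fix R assume R: "R \<in> S"
    have "(\<Sum>Q\<in>{Q\<in>S. Q \<subseteq> R}. ennreal (a Q)) = ennreal (\<Sum>Q\<in>{Q\<in>S. Q \<subseteq> R}. V Q * (\<Prod>i=1..m. (sg i Q / V Q) powr \<theta> i))"
      using SF by (subst sum_ennreal) (auto simp: a0 a_eq intro!: arg_cong[where f=ennreal] sum.cong)
    also have "\<dots> \<le> 2 * (\<integral>\<^sup>+x\<in>R. h R x \<partial>M)"
    proof (rule sparse_sum_le[OF S])
      fix Q x assume "Q \<in> {Q\<in>S. Q \<subseteq> R}" "x \<in> Q"
      then show "ennreal (\<Prod>i=1..m. (sg i Q / V Q) powr \<theta> i) \<le> h R x"
        using SF R by (intro h) auto
    qed (auto intro!: prod_nonneg)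
    also have "\<dots> \<le> 2 * (ennreal K * emeasure D R)"
      unfolding DQ[OF R] by (intro mult_left_mono hK) (use R SF in auto)
    finally show "(\<Sum>Q\<in>{Q\<in>S. Q \<subseteq> R}. ennreal (a Q)) \<le> 2 * ennreal K * emeasure D R"
      by (simp add: mult.assoc)
  qed (use S' l0 in \<open>auto simp: D_def\<close>)
  also have "(\<integral>\<^sup>+x. ennreal (family_max S l x) \<partial>D) = (\<integral>\<^sup>+x. ennreal ((\<Prod>i=1..m. \<sigma> i x powr \<theta> i) * family_max S l x) \<partial>M)"
    unfolding D_def using S' by (subst nn_integral_density) (auto simp: ennreal_mult prod_nonneg family_max_nonneg)
  also have "\<dots> \<le> (\<integral>\<^sup>+x. ennreal (\<Prod>i=1..m. (family_max S (c i) x powr ps i * \<sigma> i x) powr \<theta> i) \<partial>M)"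
  proof (intro nn_integral_mono ennreal_leI)
    fix x
    have mx0: "0 \<le> family_max S (c i) x" for i using S' by (simp add: family_max_nonneg)
    \<comment> \<open>The maximum of products is at most the product of the maxima. The density is
      then distributed among the factors so that Hoelder's inequality can separate them.\<close>
    have "family_max S l x \<le> (\<Prod>i=1..m. family_max S (c i) x powr p)"
    proof (rule family_max_le)
      show "l Q \<le> (\<Prod>i=1..m. family_max S (c i) x powr p)" if "Q \<in> S" "x \<in> Q" for Q
        unfolding l_def using that S' p_pos family_max_ge[of S Q x]
        by (intro prod_mono conjI powr_mono2) (auto simp: c_nonneg)
    qed (use S' in \<open>auto intro!: prod_nonneg\<close>)
    also have "\<dots> = (\<Prod>i=1..m. (family_max S (c i) x powr ps i) powr \<theta> i)"
      using ps by (intro prod.cong) (force simp: powr_powr \<theta>_def)+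
    finally have "(\<Prod>i=1..m. \<sigma> i x powr \<theta> i) * family_max S l x
        \<le> (\<Prod>i=1..m. \<sigma> i x powr \<theta> i) * (\<Prod>i=1..m. (family_max S (c i) x powr ps i) powr \<theta> i)"
      by (intro mult_left_mono prod_nonneg) auto
    also have "\<dots> = (\<Prod>i=1..m. (family_max S (c i) x powr ps i * \<sigma> i x) powr \<theta> i)"
      unfolding prod.distrib[symmetric] by (intro prod.cong) (auto simp: powr_mult sg_nonneg)
    finally show "(\<Prod>i=1..m. \<sigma> i x powr \<theta> i) * family_max S l x \<le> (\<Prod>i=1..m. (family_max S (c i) x powr ps i * \<sigma> i x) powr \<theta> i)" .
  qed
  also have "\<dots> \<le> ennreal (\<Prod>i=1..m. (maximal_const (ps i) * N i) powr \<theta> i)"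
  proof (rule nn_integral_prod_powr_le)
    fix i assume i: "i \<in> {1..m}"
    note [measurable] = sg_meas[OF i]
    show "(\<lambda>x. family_max S (c i) x powr ps i * \<sigma> i x) \<in> borel_measurable M" by measurable
    show "0 \<le> maximal_const (ps i) * N i" using D0[OF i] N_nonneg by simp
    show "(\<integral>\<^sup>+x. ennreal (family_max S (c i) x powr ps i * \<sigma> i x) \<partial>M) \<le> ennreal (maximal_const (ps i) * N i)"
      using maximal_bound[OF i SF] sg_nonneg[OF i] by (simp add: ennreal_mult)
  qed (use \<theta>_pos sum_\<theta> sg_nonneg in auto)
  also have "(\<Sum>Q\<in>S. ennreal (a Q) * ennreal (l Q)) = ennreal (\<Sum>Q\<in>S. l Q * a Q)"
    by (subst sum_ennreal[symmetric]) (auto simp: a0 l0 ennreal_mult mult.commute)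
  finally have car: "ennreal (\<Sum>Q\<in>S. l Q * a Q) \<le> 2 * ennreal K * ennreal (\<Prod>i=1..m. (maximal_const (ps i) * N i) powr \<theta> i)"
    by (simp add: mult_left_mono)
  have Pn: "0 \<le> (\<Prod>i=1..m. (maximal_const (ps i) * N i) powr \<theta> i)" by (intro prod_nonneg) auto
  have "2 * ennreal K * ennreal (\<Prod>i=1..m. (maximal_const (ps i) * N i) powr \<theta> i) = ennreal (2 * K * (\<Prod>i=1..m. (maximal_const (ps i) * N i) powr \<theta> i))"
    using K Pn by (simp add: ennreal_mult)
  with car have car': "(\<Sum>Q\<in>S. l Q * a Q) \<le> 2 * K * (\<Prod>i=1..m. (maximal_const (ps i) * N i) powr \<theta> i)"
    using K Pn by (simp add: ennreal_le_iff)
  have "summand Q \<le> A * (l Q * a Q)" if Q: "Q \<in> S" for Q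
  proof -
    have QF: "Q \<in> F" using Q SF by auto
    have "(\<Prod>i=1..m. sg i Q powr p) = (\<Prod>i=1..m. sg i Q powr (p - \<theta> i)) * a Q"
      unfolding a_def prod.distrib[symmetric] by (simp add: powr_add[symmetric])
    then have "(\<Prod>i=1..m. sg i Q powr p) * weight_on M \<omega> Q powr (p / q) / V Q powr (p * s)
      = a Q * (weight_on M \<omega> Q powr (p / q) * (\<Prod>i=1..m. sg i Q powr (p - \<theta> i))) / V Q powr (p * s)"
      by simp
    also have "\<dots> \<le> a Q * (A * V Q powr (p * s)) / V Q powr (p * s)"
      by (intro divide_right_mono mult_left_mono H QF a0) auto
    also have "\<dots> = A * a Q" using V_pos[OF QF] by simp
    finally have "summand Q \<le> l Q * (A * a Q)"
      unfolding summand_eq[OF QF] l_def[symmetric] by (intro mult_left_mono l0)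
    then show ?thesis by (simp add: mult.left_commute)
  qed
  then have "(\<Sum>Q\<in>S. summand Q) \<le> (\<Sum>Q\<in>S. A * (l Q * a Q))" by (rule sum_mono)
  also have "\<dots> = A * (\<Sum>Q\<in>S. l Q * a Q)" by (simp add: sum_distrib_left)
  also have "\<dots> \<le> A * (2 * K * (\<Prod>i=1..m. (maximal_const (ps i) * N i) powr \<theta> i))"
    by (intro mult_left_mono car' A)
  finally have "(\<Sum>Q\<in>S. summand Q) \<le> 2 * A * K * (\<Prod>i=1..m. (maximal_const (ps i) * N i) powr \<theta> i)"
    by (simp add: mult_ac)
  then show ?thesis using A K by (intro conclusion_prod[OF S dom _ D0]) auto
qed

end

section \<open>Shifted dyadic grids\<close>

text \<open>A half-open cube of side \<open>L / 2 ^ d\<close> whose corner is \<open>v\<close> plus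
  \<open>L / 2 ^ d\<close> times \<open>j\<close>. The floor form makes nesting a matter of integer
  division. Depth counts downwards from side \<open>L\<close>, so there is a top scale, and the
  shift by a third is taken relative to it.\<close>

definition gcube :: "real ^ 'n::finite \<Rightarrow> real \<Rightarrow> nat \<Rightarrow> ('n \<Rightarrow> int) \<Rightarrow> (real ^ 'n) set" where
  "gcube v L d j = {x. \<forall>i. \<lfloor>(x $ i - v $ i) * 2 ^ d / L\<rfloor> = j i}"

definition grid :: "real ^ 'n::finite \<Rightarrow> real \<Rightarrow> (real ^ 'n) set set" where
  "grid v L = (\<lambda>(d, j). gcube v L d j) ` UNIV"

lemma countable_grid: "countable (grid v L)"
  unfolding grid_def by (intro countable_image) simp

lemma grid_nonempty: "grid v L \<noteq> {}"
  by (simp add: grid_def)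

text \<open>The integer index at the coarser depth is the quotient of the finer index by a power of
  2, so points that share a finer cube share the coarser one.\<close>

lemma gcube_nested:
  assumes "d \<le> d'" "x \<in> gcube v L d j" "x \<in> gcube v L d' j'"
  shows "gcube v L d' j' \<subseteq> gcube v L d j"
proof
  fix y assume y: "y \<in> gcube v L d' j'"
  have key: "\<lfloor>z * 2 ^ d / L\<rfloor> = \<lfloor>z * 2 ^ d' / L\<rfloor> div 2 ^ (d' - d)" for z :: real
  proof -
    have "(2::real) ^ d' = 2 ^ d * 2 ^ (d' - d)"
      using assms(1) by (simp flip: power_add)
    then have "z * 2 ^ d / L = (z * 2 ^ d' / L) / real_of_int (2 ^ (d' - d))" by simp
    then show ?thesis by (simp only: floor_divide_real_eq_div[of "2 ^ (d' - d)"] zero_le_power)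
  qed
  show "y \<in> gcube v L d j"
    unfolding gcube_def
  proof (intro CollectI allI)
    fix i
    have "\<lfloor>(y $ i - v $ i) * 2 ^ d / L\<rfloor> = j' i div 2 ^ (d' - d)"
      using y unfolding key by (simp add: gcube_def)
    also have "\<dots> = \<lfloor>(x $ i - v $ i) * 2 ^ d / L\<rfloor>"
      using assms(3) unfolding key by (simp add: gcube_def)
    also have "\<dots> = j i" using assms(2) by (simp add: gcube_def)
    finally show "\<lfloor>(y $ i - v $ i) * 2 ^ d / L\<rfloor> = j i" .
  qed
qed

lemma laminar_grid: "laminar (grid v L)"
  unfolding laminar_def
proof (intro ballI)
  fix P Q assume "P \<in> grid v L" "Q \<in> grid v L"
  then obtain d j d' j' where PQ: "P = gcube v L d j" "Q = gcube v L d' j'"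
    by (auto simp: grid_def)
  show "P \<subseteq> Q \<or> Q \<subseteq> P \<or> P \<inter> Q = {}"
  proof (cases "P \<inter> Q = {}")
    case False
    then obtain x where x: "x \<in> P" "x \<in> Q" by blast
    show ?thesis
      using gcube_nested[of d d' x v L j j'] gcube_nested[of d' d x v L j' j] x PQ
      by (cases "d \<le> d'") auto
  qed simp
qed

lemma gcube_sandwich:
  fixes v :: "real ^ 'n::finite" and d :: nat and j :: "'n \<Rightarrow> int"
  assumes "0 < L"
  defines "a \<equiv> (\<chi> i. v $ i + L / 2 ^ d * of_int (j i))"
  shows "box a (\<chi> i. a $ i + L / 2 ^ d) \<subseteq> gcube v L d j"
    and "gcube v L d j \<subseteq> cbox a (\<chi> i. a $ i + L / 2 ^ d)"
proof -
  have h: "0 < L / 2 ^ d" using assms by simp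
  have eq: "\<lfloor>z * 2 ^ d / L\<rfloor> = k \<longleftrightarrow> L / 2 ^ d * of_int k \<le> z \<and> z < L / 2 ^ d * of_int k + L / 2 ^ d" for z k
    using assms(1) unfolding floor_eq_iff by (simp add: field_simps)
  show "box a (\<chi> i. a $ i + L / 2 ^ d) \<subseteq> gcube v L d j"
  proof
    fix x assume "x \<in> box a (\<chi> i. a $ i + L / 2 ^ d)"
    then have x: "a $ i < x $ i" "x $ i < a $ i + L / 2 ^ d" for i
      by (auto simp: mem_box_cart)
    have "L / 2 ^ d * of_int (j i) \<le> x $ i - v $ i \<and> x $ i - v $ i < L / 2 ^ d * of_int (j i) + L / 2 ^ d" for i
      using x[of i] unfolding a_def vec_lambda_beta by linarith
    then show "x \<in> gcube v L d j" unfolding gcube_def eq by blast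
  qed
  show "gcube v L d j \<subseteq> cbox a (\<chi> i. a $ i + L / 2 ^ d)"
  proof
    fix x assume "x \<in> gcube v L d j"
    then have "L / 2 ^ d * of_int (j i) \<le> x $ i - v $ i" "x $ i - v $ i < L / 2 ^ d * of_int (j i) + L / 2 ^ d" for i
      unfolding gcube_def eq by auto
    then show "x \<in> cbox a (\<chi> i. a $ i + L / 2 ^ d)"
      by (auto simp: a_def mem_box_cart) (smt (verit))+
  qed
qed

lemma vol_cube:
  fixes a :: "real ^ 'n::finite"
  assumes "0 < l"
  shows "vol (cbox a (\<chi> i. a $ i + l)) = l ^ CARD('n)"
proof -
  have "cbox a (\<chi> i. a $ i + l) \<noteq> {}"
    using assms by (simp add: interval_ne_empty_cart)
  then show ?thesis
    by (simp add: content_cbox_cart)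
qed

text \<open>The weight constants test closed cubes, while the grids consist of half-open ones. Only
  part of the boundary is at stake, a null set; measurability comes from completeness of Lebesgue
  measure.\<close>

lemma gcube_closure:
  fixes v :: "real ^ 'n::finite"
  assumes L: "0 < L"
  shows "\<exists>R\<in>cubes. vol R = (L / 2 ^ d) ^ CARD('n) \<and> gcube v L d j \<subseteq> R \<and> gcube v L d j \<in> sets lebesgue \<and>
    emeasure lebesgue (gcube v L d j) = emeasure lebesgue R \<and>
    (\<forall>g. (\<integral>\<^sup>+x\<in>gcube v L d j. g x \<partial>lebesgue) = (\<integral>\<^sup>+x\<in>R. g x \<partial>lebesgue))"
proof -
  define a :: "real ^ 'n" where "a = (\<chi> i. v $ i + L / 2 ^ d * of_int (j i))"
  define R where "R = cbox a (\<chi> i. a $ i + L / 2 ^ d)"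
  define B where "B = box a (\<chi> i. a $ i + L / 2 ^ d)"
  have BQ: "B \<subseteq> gcube v L d j" and QR: "gcube v L d j \<subseteq> R"
    using gcube_sandwich[OF L, where v = v and d = d and j = j] by (auto simp: a_def B_def R_def)
  have h: "0 < L / 2 ^ d" using L by simp
  have "R \<in> cubes" using h by (auto simp: cubes_def R_def)
  have vol: "vol R = (L / 2 ^ d) ^ CARD('n)" unfolding R_def by (rule vol_cube[OF h])
  have neg: "negligible (R - B)" unfolding R_def B_def by (rule negligible_frontier_interval)
  have neg2: "negligible (gcube v L d j - B)" "negligible (R - gcube v L d j)"
    using BQ QR by (auto intro!: negligible_subset[OF neg])
  have "gcube v L d j = B \<union> (gcube v L d j - B)" using BQ by blast
  moreover have "gcube v L d j - B \<in> sets lebesgue"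
    using neg2(1) by (simp add: negligible_imp_sets)
  moreover have "B \<in> sets lebesgue" by (simp add: B_def)
  ultimately have meas: "gcube v L d j \<in> sets lebesgue" by (metis sets.Un)
  have RM: "R \<in> sets lebesgue" by (simp add: R_def)
  have "R - gcube v L d j \<in> null_sets lebesgue" using neg2(2) by (simp add: negligible_iff_null_sets)
  then have "AE x in lebesgue. x \<notin> R - gcube v L d j" by (rule AE_not_in)
  then have AE: "AE x in lebesgue. x \<in> gcube v L d j \<longleftrightarrow> x \<in> R"
  proof eventually_elim
    case (elim x)
    then show ?case using QR by auto
  qed
  have "emeasure lebesgue (gcube v L d j) = emeasure lebesgue R"
    using AE meas RM by (intro emeasure_eq_AE) auto
  moreover have "(\<integral>\<^sup>+x\<in>gcube v L d j. g x \<partial>lebesgue) = (\<integral>\<^sup>+x\<in>R. g x \<partial>lebesgue)" for g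
  proof (rule nn_integral_cong_AE)
    show "AE x in lebesgue. g x * indicator (gcube v L d j) x = g x * indicator R x"
      using AE by eventually_elim (auto simp: indicator_def)
  qed
  ultimately show ?thesis
    using \<open>R \<in> cubes\<close> vol QR meas by blast
qed

section \<open>The one-third trick\<close>

text \<open>The endpoints of the two families of intervals of length \<open>L / 2 ^ d\<close> stay at distance
  at least a third of that length from each other, because 3 does not divide \<open>2 ^ d\<close>.\<close>

lemma one_third_shift:
  fixes a l L :: real
  assumes l: "0 < l" and L: "3 * l \<le> L / 2 ^ d"
  shows "\<exists>t\<in>{0, L / 3}. \<lfloor>(a - t) * 2 ^ d / L\<rfloor> = \<lfloor>(a + l - t) * 2 ^ d / L\<rfloor>"
proof (rule ccontr)
  assume neg: "\<not> ?thesis"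
  define h where "h = L / 2 ^ d"
  have h: "0 < h" "3 * l \<le> h" using l L by (auto simp: h_def)
  have Lh: "L = 2 ^ d * h" by (simp add: h_def)
  have scale: "z * 2 ^ d / L = z / h" for z by (simp add: h_def)
  \<comment> \<open>Two different floors mean that a multiple of \<open>h\<close> lies between the
    two ends of the interval.\<close>
  have ex: "\<exists>k::int. a - t < h * of_int k \<and> h * of_int k \<le> a + l - t" if "t \<in> {0, L / 3}" for t
  proof -
    have ne: "\<lfloor>(a - t) / h\<rfloor> \<noteq> \<lfloor>(a + l - t) / h\<rfloor>" using neg that by (auto simp: scale)
    moreover have "\<lfloor>(a - t) / h\<rfloor> \<le> \<lfloor>(a + l - t) / h\<rfloor>"
      using h l by (intro floor_mono divide_right_mono) auto
    ultimately have "\<lfloor>(a - t) / h\<rfloor> < \<lfloor>(a + l - t) / h\<rfloor>" by simp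
    then have "(a - t) / h < of_int \<lfloor>(a + l - t) / h\<rfloor>" by (simp add: floor_less_iff)
    moreover have "of_int \<lfloor>(a + l - t) / h\<rfloor> \<le> (a + l - t) / h" by (rule of_int_floor_le)
    ultimately show ?thesis
      using h(1) by (intro exI[of _ "\<lfloor>(a + l - t) / h\<rfloor>"])
        (simp only: pos_divide_less_eq pos_le_divide_eq mult.commute[of h] simp_thms)
  qed
  obtain k1 :: int where k1: "a < h * of_int k1" "h * of_int k1 \<le> a + l" using ex[of 0] by auto
  obtain k2 :: int where k2: "a - L / 3 < h * of_int k2" "h * of_int k2 \<le> a + l - L / 3" using ex[of "L / 3"] by auto
  \<comment> \<open>Both grid points lie in the same window of length l \<le> h / 3, so the left
    side is below h / 3. It is also h / 3 times the absolute value of an integer, which must then be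
    0.\<close>
  have "\<bar>h * of_int k1 - h * of_int k2 - L / 3\<bar> < h / 3" using k1 k2 h by linarith
  also have "h * of_int k1 - h * of_int k2 - L / 3 = h / 3 * (3 * (of_int k1 - of_int k2) - 2 ^ d)"
    by (simp add: Lh field_simps)
  finally have "h / 3 * \<bar>3 * (of_int k1 - of_int k2) - 2 ^ d\<bar> < h / 3 * 1"
    using h(1) by (simp add: abs_mult)
  then have "\<bar>3 * (of_int k1 - of_int k2) - 2 ^ d\<bar> < (1::real)"
    using h(1) by (subst (asm) mult_less_cancel_left_pos) auto
  then have "\<bar>real_of_int (3 * (k1 - k2) - 2 ^ d)\<bar> < 1" by simp
  then have "3 * (k1 - k2) = 2 ^ d" by linarith
  then have "(3::int) dvd 2 ^ d" by (metis dvd_triv_left)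
  moreover have "coprime (3::int) (2 ^ d)" by simp
  ultimately have "is_unit (3::int)" by (simp only: coprime_absorb_left)
  then show False by simp
qed

text \<open>\<open>T\<close> records the coordinates that are moved by a third: one choice per
  coordinate, hence 2^n shifts for each \<open>L\<close>.\<close>

definition shift :: "'n::finite set \<Rightarrow> real \<Rightarrow> real ^ 'n" where
  "shift T L = (\<chi> i. if i \<in> T then L / 3 else 0)"

text \<open>The depth is one where the side is at least \<open>3 * l\<close> but the next side is
  not, so the side is below \<open>6 * l\<close>; this is the origin of 6^n. Each coordinate may
  require its own shift, and these choices form \<open>T\<close>. Large \<open>L\<close> lets depth
  0 start the search.\<close>

lemma cube_in_grid:
  fixes Q :: "(real ^ 'n::finite) set"
  assumes "Q \<in> cubes"
  shows "\<exists>L0. \<forall>L\<ge>L0. \<exists>T d j. Q \<subseteq> gcube (shift T L) L d j \<and> (L / 2 ^ d) ^ CARD('n) \<le> 6 ^ CARD('n) * vol Q"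
proof -
  obtain a l where Q: "Q = cbox a (\<chi> i. a $ i + l)" and l: "0 < l"
    using assms by (auto simp: cubes_def)
  have "\<exists>T d j. Q \<subseteq> gcube (shift T L) L d j \<and> (L / 2 ^ d) ^ CARD('n) \<le> 6 ^ CARD('n) * vol Q" if L: "3 * l \<le> L" for L
  proof -
    have L0: "0 < L" using L l by linarith
    define P where "P d \<longleftrightarrow> 3 * l \<le> L / 2 ^ d" for d :: nat
    have "\<exists>d. P d \<and> \<not> P (Suc d)"
    proof (rule ccontr)
      assume "\<not> ?thesis"
      moreover have "P 0" using L by (simp add: P_def)
      ultimately have all: "P d" for d by (induction d) auto
      obtain d :: nat where "L / (3 * l) < 2 ^ d" using real_arch_pow[of 2 "L / (3 * l)"] by auto
      then show False using all[of d] l by (simp add: P_def field_simps)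
    qed
    then obtain d where d: "3 * l \<le> L / 2 ^ d" "L / 2 ^ d < 6 * l"
      by (auto simp: P_def not_le field_simps)
    have "\<forall>i. \<exists>t\<in>{0, L / 3}. \<lfloor>(a $ i - t) * 2 ^ d / L\<rfloor> = \<lfloor>(a $ i + l - t) * 2 ^ d / L\<rfloor>"
      using one_third_shift[OF l d(1)] by blast
    then obtain t where t: "\<And>i. t i \<in> {0, L / 3}"
        "\<And>i. \<lfloor>(a $ i - t i) * 2 ^ d / L\<rfloor> = \<lfloor>(a $ i + l - t i) * 2 ^ d / L\<rfloor>"
      by metis
    define T where "T = {i. t i = L / 3}"
    have sh: "shift T L $ i = t i" for i using t(1)[of i] by (auto simp: shift_def T_def)
    have "Q \<subseteq> gcube (shift T L) L d (\<lambda>i. \<lfloor>(a $ i - t i) * 2 ^ d / L\<rfloor>)"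
    proof
      fix x assume "x \<in> Q"
      then have x: "a $ i \<le> x $ i" "x $ i \<le> a $ i + l" for i
        by (auto simp: Q mem_box_cart)
      have "\<lfloor>(x $ i - t i) * 2 ^ d / L\<rfloor> = \<lfloor>(a $ i - t i) * 2 ^ d / L\<rfloor>" for i
      proof (rule antisym)
        show "\<lfloor>(x $ i - t i) * 2 ^ d / L\<rfloor> \<le> \<lfloor>(a $ i - t i) * 2 ^ d / L\<rfloor>"
          unfolding t(2) using x[of i] L0 by (intro floor_mono divide_right_mono mult_right_mono) auto
        show "\<lfloor>(a $ i - t i) * 2 ^ d / L\<rfloor> \<le> \<lfloor>(x $ i - t i) * 2 ^ d / L\<rfloor>"
          using x[of i] L0 by (intro floor_mono divide_right_mono mult_right_mono) auto
      qed
      then show "x \<in> gcube (shift T L) L d (\<lambda>i. \<lfloor>(a $ i - t i) * 2 ^ d / L\<rfloor>)"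
        by (simp add: gcube_def sh)
    qed
    moreover have "(L / 2 ^ d) ^ CARD('n) \<le> (6 * l) ^ CARD('n)"
      using d L0 by (intro power_mono) auto
    ultimately show ?thesis
      unfolding Q vol_cube[OF l] power_mult_distrib[symmetric] by blast
  qed
  then show ?thesis by blast
qed

text \<open>\<open>D\<close> is exhausted by the initial segments of an enumeration; their maximal
  functions increase, and monotone convergence keeps the uniform bound.\<close>

lemma nn_integral_SUP_family_le:
  fixes \<Phi> :: "'a set \<Rightarrow> real"
  assumes D: "countable D" "D \<noteq> {}" "D \<subseteq> sets M" and q: "0 < q" and \<Phi>: "\<And>Q. 0 \<le> \<Phi> Q"
    and le: "\<And>F. finite F \<Longrightarrow> F \<subseteq> D \<Longrightarrow> (\<integral>\<^sup>+x. ennreal (family_max F \<Phi> x powr q) \<partial>M) \<le> Y"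
  shows "(\<integral>\<^sup>+x. (SUP Q\<in>D. indicator Q x * ennreal (\<Phi> Q powr q)) \<partial>M) \<le> Y"
proof -
  define F where "F n = from_nat_into D ` {..n}" for n
  have F: "finite (F n)" "F n \<subseteq> D" "F n \<subseteq> sets M" for n
    using from_nat_into[OF D(2)] D(3) by (auto simp: F_def)
  define g where "g n x = ennreal (family_max (F n) \<Phi> x powr q)" for n x
  have gm: "g n \<in> borel_measurable M" for n
  proof -
    have [measurable]: "family_max (F n) \<Phi> \<in> borel_measurable M" using F by (intro borel_measurable_family_max)
    show ?thesis unfolding g_def by measurable
  qed
  have inc: "incseq g"
    unfolding incseq_def le_fun_def g_def
  proof (intro allI impI ennreal_leI powr_mono2)
    fix k n x assume "k \<le> (n::nat)"
    then have "F k \<subseteq> F n" by (auto simp: F_def)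
    then show "family_max (F k) \<Phi> x \<le> family_max (F n) \<Phi> x"
      by (intro family_max_le F family_max_nonneg) (auto intro!: family_max_ge F)
  qed (use q F in \<open>auto simp: family_max_nonneg\<close>)
  have "(\<integral>\<^sup>+x. (SUP Q\<in>D. indicator Q x * ennreal (\<Phi> Q powr q)) \<partial>M) \<le> (\<integral>\<^sup>+x. (SUP n. g n x) \<partial>M)"
  proof (intro nn_integral_mono SUP_least)
    fix x Q assume "Q \<in> D"
    then obtain n where n: "Q = from_nat_into D n"
      using D(1) by (metis from_nat_into_surj)
    have "indicator Q x * ennreal (\<Phi> Q powr q) \<le> g n x"
    proof (cases "x \<in> Q")
      case True
      then have "\<Phi> Q \<le> family_max (F n) \<Phi> x" using n by (intro family_max_ge F) (auto simp: F_def)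
      then show ?thesis using True q by (auto simp: g_def intro!: ennreal_leI powr_mono2 \<Phi>)
    qed simp
    also have "\<dots> \<le> (SUP n. g n x)" by (rule SUP_upper) simp
    finally show "indicator Q x * ennreal (\<Phi> Q powr q) \<le> (SUP n. g n x)" .
  qed
  also have "\<dots> = (SUP n. (\<integral>\<^sup>+x. g n x \<partial>M))"
    by (rule nn_integral_monotone_convergence_SUP[OF inc gm])
  also have "\<dots> \<le> Y"
    unfolding g_def by (intro SUP_least le F)
  finally show ?thesis .
qed

section \<open>Extended powers and the supremum over all cubes\<close>

lemma epowr_ennreal: "0 \<le> a \<Longrightarrow> ennreal a epowr r = ennreal (a powr r)"
  by (simp add: epowr_def)

lemma epowr_mono:
  assumes "x \<le> y" "0 \<le> r"
  shows "x epowr r \<le> y epowr r"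
proof (cases y)
  case (real b)
  then obtain a where a: "x = ennreal a" "0 \<le> a" using assms(1) by (cases x) (auto simp: top_unique)
  then have "a \<le> b" using real assms(1) by simp
  then show ?thesis using a real assms(2) by (auto simp: epowr_ennreal intro!: ennreal_leI powr_mono2)
qed (auto simp: epowr_def)

lemma SUP_epowr_le:
  assumes q: "0 < q" and le: "\<And>Q. Q \<in> D \<Longrightarrow> u Q epowr q \<le> Z"
  shows "(SUP Q\<in>D. u Q) epowr q \<le> Z"
proof (cases Z)
  case (real z)
  have "(SUP Q\<in>D. u Q) \<le> ennreal (z powr (1 / q))"
  proof (rule SUP_least)
    fix Q assume "Q \<in> D"
    then have *: "u Q epowr q \<le> ennreal z" using le real by simp
    then obtain a where a: "u Q = ennreal a" "0 \<le> a"
      by (cases "u Q") (auto simp: epowr_def top_unique)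
    then have "a powr q \<le> z" using * real by (simp add: epowr_ennreal)
    then have "(a powr q) powr (1 / q) \<le> z powr (1 / q)" using q by (intro powr_mono2) auto
    then show "u Q \<le> ennreal (z powr (1 / q))"
      using a q by (auto simp: powr_powr intro!: ennreal_leI)
  qed
  then have "(SUP Q\<in>D. u Q) epowr q \<le> ennreal (z powr (1 / q)) epowr q"
    using q by (intro epowr_mono) auto
  also have "\<dots> = Z" using real q by (simp add: epowr_ennreal powr_powr)
  finally show ?thesis .
qed simp

text \<open>For every large \<open>N\<close> a given cube lies in a comparable cube of one of the \<open>2 ^ CARD('n)\<close> grids with
  top scale \<open>2 ^ N\<close>. The grids change with \<open>N\<close>, so the limit is taken by Fatou's lemma.\<close>

lemma maximal_le_grid_bound:
  fixes M :: "(real ^ 'n::finite) measure" and \<Phi> \<phi> :: "(real ^ 'n) set \<Rightarrow> real"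
  assumes M: "sets M = sets lebesgue" and q: "0 < q" and \<Phi>: "\<And>Q. 0 \<le> \<Phi> Q" and K: "0 < K"
    and u: "\<And>Q x. Q \<in> cubes \<Longrightarrow> u Q x \<le> indicator Q x * ennreal (\<phi> Q)"
    and \<phi>: "\<And>Q L T d j. Q \<in> cubes \<Longrightarrow> 0 < L \<Longrightarrow> Q \<subseteq> gcube (shift T L) L d j \<Longrightarrow>
      (L / 2 ^ d) ^ CARD('n) \<le> 6 ^ CARD('n) * vol Q \<Longrightarrow> 0 \<le> \<phi> Q \<and> \<phi> Q \<le> K * \<Phi> (gcube (shift T L) L d j)"
    and le: "\<And>v L F. 0 < L \<Longrightarrow> finite F \<Longrightarrow> F \<subseteq> grid v L \<Longrightarrow> (\<integral>\<^sup>+x. ennreal (family_max F \<Phi> x powr q) \<partial>M) \<le> Y"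
  shows "\<exists>g\<in>borel_measurable M. (\<forall>x. (SUP Q\<in>cubes. u Q x) epowr q \<le> g x) \<and>
    (\<integral>\<^sup>+x. g x \<partial>M) \<le> ennreal (K powr q * 2 ^ CARD('n)) * Y"
proof -
  \<comment> \<open>\<open>H N T\<close> is the q-th power of the maximal function over one whole
    grid; summing over the shifts \<open>T\<close> in \<open>G\<close> spares the choice of the
    right grid.\<close>
  define H where "H N T x = (SUP Q\<in>grid (shift T (2 ^ N)) (2 ^ N). indicator Q x * ennreal (\<Phi> Q powr q))"
    for N :: nat and T :: "'n set" and x :: "real ^ 'n"
  define G where "G N x = ennreal (K powr q) * (\<Sum>T\<in>UNIV. H N T x)" for N x
  have gridM: "grid (shift T (2 ^ N)) (2 ^ N) \<subseteq> sets M" for T :: "'n set" and N :: nat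
  proof -
    have "(0::real) < 2 ^ N" by simp
    from gcube_closure[OF this, of _ "shift T (2 ^ N)"] show ?thesis
      unfolding M grid_def by auto
  qed
  have Hm [measurable]: "H N T \<in> borel_measurable M" for N T
    unfolding H_def
  proof (rule borel_measurable_SUP[OF countable_grid])
    fix Q assume "Q \<in> grid (shift T (2 ^ N)) (2 ^ N)"
    then have [measurable]: "Q \<in> sets M" using gridM by blast
    show "(\<lambda>x. indicator Q x * ennreal (\<Phi> Q powr q)) \<in> borel_measurable M" by measurable
  qed
  have Gm: "G N \<in> borel_measurable M" for N unfolding G_def by measurable
  have HY: "(\<integral>\<^sup>+x. H N T x \<partial>M) \<le> Y" for N T
    unfolding H_def
    by (rule nn_integral_SUP_family_le[OF countable_grid grid_nonempty gridM q \<Phi>]) (rule le, auto)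
  have GY: "(\<integral>\<^sup>+x. G N x \<partial>M) \<le> ennreal (K powr q * 2 ^ CARD('n)) * Y" for N
  proof -
    have "(\<integral>\<^sup>+x. G N x \<partial>M) = ennreal (K powr q) * (\<Sum>T\<in>UNIV. \<integral>\<^sup>+x. H N T x \<partial>M)"
      unfolding G_def by (subst nn_integral_cmult) (auto simp: nn_integral_sum)
    also have "\<dots> \<le> ennreal (K powr q) * (\<Sum>T\<in>(UNIV::'n set set). Y)"
      by (intro mult_left_mono sum_mono HY) auto
    also have "\<dots> = ennreal (K powr q * 2 ^ CARD('n)) * Y"
      by (simp add: ennreal_mult card_Pow[of "UNIV::'n set", simplified] mult.assoc flip: ennreal_power)
    finally show ?thesis .
  qed
  \<comment> \<open>Each cube satisfies the bound from some \<open>N0\<close> on, so it survives in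
    the liminf. The measurable majorant \<open>g\<close> stands in for the supremum over the
    uncountable set of all cubes.\<close>
  define g where "g x = liminf (\<lambda>N. G N x)" for x
  have "g \<in> borel_measurable M" unfolding g_def by (intro borel_measurable_liminf Gm)
  moreover have "(SUP Q\<in>cubes. u Q x) epowr q \<le> g x" for x
  proof (rule SUP_epowr_le[OF q])
    fix Q :: "(real ^ 'n) set" assume Q: "Q \<in> cubes"
    obtain L0 where L0: "\<And>L. L0 \<le> L \<Longrightarrow> \<exists>T d j. Q \<subseteq> gcube (shift T L) L d j \<and>
        (L / 2 ^ d) ^ CARD('n) \<le> 6 ^ CARD('n) * vol Q"
      using cube_in_grid[OF Q] by blast
    obtain N0 :: nat where N0: "L0 < 2 ^ N0" using real_arch_pow[of 2 L0] by auto
    show "u Q x epowr q \<le> g x"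
    proof (cases "x \<in> Q")
      case False
      then have "u Q x = 0" using u[OF Q, of x] by simp
      then show ?thesis by (simp add: epowr_def)
    next
      case True
      have "u Q x epowr q \<le> G N x" if N: "N0 \<le> N" for N
      proof -
        have "(2::real) ^ N0 \<le> 2 ^ N" using N by (intro power_increasing) auto
        then have "L0 \<le> 2 ^ N" using N0 by linarith
        then obtain T d j where R: "Q \<subseteq> gcube (shift T (2 ^ N)) (2 ^ N) d j"
            "(2 ^ N / 2 ^ d) ^ CARD('n) \<le> 6 ^ CARD('n) * vol Q"
          using L0 by blast
        define R where "R = gcube (shift T (2 ^ N)) (2 ^ N) d j"
        have \<phi>R: "0 \<le> \<phi> Q" "\<phi> Q \<le> K * \<Phi> R" using \<phi>[OF Q _ R] by (auto simp: R_def)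
        have "u Q x epowr q \<le> ennreal (\<phi> Q) epowr q"
          using u[OF Q, of x] True q by (intro epowr_mono) auto
        also have "\<dots> \<le> ennreal ((K * \<Phi> R) powr q)"
          using \<phi>R q by (auto simp: epowr_ennreal intro!: ennreal_leI powr_mono2)
        also have "\<dots> = ennreal (K powr q) * (indicator R x * ennreal (\<Phi> R powr q))"
          using True R K \<Phi>[of R] by (auto simp: R_def powr_mult ennreal_mult)
        also have "\<dots> \<le> ennreal (K powr q) * H N T x"
          unfolding H_def by (intro mult_left_mono SUP_upper) (auto simp: R_def grid_def)
        also have "\<dots> \<le> G N x"
          unfolding G_def by (intro mult_left_mono member_le_sum) auto
        finally show ?thesis .
      qed
      then show ?thesis
        unfolding g_def by (intro Liminf_bounded) (auto simp: eventually_sequentially)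
    qed
  qed
  moreover have "(\<integral>\<^sup>+x. g x \<partial>M) \<le> ennreal (K powr q * 2 ^ CARD('n)) * Y"
  proof -
    have "(\<integral>\<^sup>+x. g x \<partial>M) \<le> liminf (\<lambda>N. \<integral>\<^sup>+x. G N x \<partial>M)"
      unfolding g_def by (rule nn_integral_liminf[OF Gm])
    also have "\<dots> \<le> ennreal (K powr q * 2 ^ CARD('n)) * Y"
      by (rule Liminf_le) (auto simp: GY)
    finally show ?thesis .
  qed
  ultimately show ?thesis by blast
qed

section \<open>From finite families to all cubes\<close>

lemma prod_mono_ennreal:
  fixes f g :: "'b \<Rightarrow> ennreal"
  assumes "\<And>i. i \<in> A \<Longrightarrow> f i \<le> g i"
  shows "prod f A \<le> prod g A"
  using assms by (induction A rule: infinite_finite_induct) (auto intro!: mult_mono)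

lemma le_mult_of_divide_le_ennreal:
  fixes a b c :: ennreal
  assumes "b / a \<le> c" "0 < a" "a < \<infinity>"
  shows "b \<le> c * a"
proof -
  have "b = b / a * a" using assms by (simp add: ennreal_divide_times ennreal_divide_self less_top)
  also have "\<dots> \<le> c * a" by (rule mult_right_mono[OF assms(1)]) simp
  finally show ?thesis .
qed

lemma set_nn_integral_pos:
  assumes g: "g \<in> borel_measurable M" "AE x in M. 0 < g x" and R: "R \<in> sets M" "0 < emeasure M R"
  shows "0 < (\<integral>\<^sup>+x\<in>R. g x \<partial>M)"
proof (rule ccontr)
  assume "\<not> ?thesis"
  then have "(\<integral>\<^sup>+x. g x * indicator R x \<partial>M) = 0" by simp
  then have "AE x in M. g x * indicator R x = 0"
    using g R by (subst (asm) nn_integral_0_iff_AE) auto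
  then have "AE x in M. x \<notin> R"
    using g(2) by eventually_elim (auto simp: indicator_def split: if_splits)
  then have "R \<in> null_sets M" using R(1) by (simp add: AE_iff_null_sets)
  then show False using R(2) by (simp add: null_sets_def)
qed

lemma ennreal_max_zero: "ennreal (max 0 a) = ennreal a"
  by (simp add: max_def ennreal_neg)

lemma sigma_finite_lebesgue: "sigma_finite_measure (lebesgue :: 'a::euclidean_space measure)"
proof
  obtain A :: "'a set set" where A: "countable A" "A \<subseteq> sets lborel" "\<Union>A = space lborel"
    "\<forall>a\<in>A. emeasure lborel a \<noteq> \<infinity>"
    using lborel.sigma_finite_countable by blast
  show "\<exists>A::'a set set. countable A \<and> A \<subseteq> sets lebesgue \<and> \<Union>A = space lebesgue \<and>
      (\<forall>a\<in>A. emeasure lebesgue a \<noteq> \<infinity>)"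
  proof (intro exI conjI ballI)
    show "countable A" "A \<subseteq> sets lebesgue" "\<Union>A = space lebesgue" using A by auto
    fix a assume "a \<in> A"
    then show "emeasure lebesgue a \<noteq> \<infinity>" using A(2,4) by (subst emeasure_completion) (auto simp: main_part_sets)
  qed
qed

text \<open>Agreement with a closed cube up to a null set, stated through its consequences. It
  covers grid cubes and closed cubes alike, the latter with \<open>Q = R\<close>.\<close>

definition has_closure :: "(real ^ 'n::finite) set \<Rightarrow> (real ^ 'n) set \<Rightarrow> bool" where
  "has_closure Q R \<longleftrightarrow> R \<in> cubes \<and> Q \<subseteq> R \<and> Q \<in> sets lebesgue \<and>
    emeasure lebesgue Q = emeasure lebesgue R \<and>
    (\<forall>g. (\<integral>\<^sup>+x\<in>Q. g x \<partial>lebesgue) = (\<integral>\<^sup>+x\<in>R. g x \<partial>lebesgue))"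

lemma cube_props:
  assumes "R \<in> cubes"
  shows "R \<in> sets lebesgue" "compact R" "0 < vol R" "emeasure lebesgue R = ennreal (vol R)"
proof -
  obtain a l where R: "R = cbox a (\<chi> i. a $ i + l)" and l: "0 < l"
    using assms by (auto simp: cubes_def)
  show "R \<in> sets lebesgue" "compact R" unfolding R by auto
  show "0 < vol R" unfolding R vol_cube[OF l] using l by simp
  show "emeasure lebesgue R = ennreal (vol R)"
    unfolding R by (rule emeasure_eq_ennreal_measure) (simp add: emeasure_lborel_cbox_eq)
qed

lemma has_closure_cube: "R \<in> cubes \<Longrightarrow> has_closure R R"
  by (simp add: has_closure_def cube_props)

lemma has_closure_grid:
  assumes "0 < L" "Q \<in> grid v L"
  shows "\<exists>R. has_closure Q R"
proof -
  obtain d j where "Q = gcube v L d j" using assms(2) by (auto simp: grid_def)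
  then show ?thesis using gcube_closure[OF assms(1), of d v j] unfolding has_closure_def by blast
qed

lemma has_closure_vol: "has_closure Q R \<Longrightarrow> measure lebesgue Q = vol R"
  by (simp add: has_closure_def measure_def)

lemma weight_facts:
  assumes w: "weight w" and R: "R \<in> cubes"
  shows "w \<in> borel_measurable lebesgue" "AE x in lebesgue. 0 < w x"
    "0 < wmeas w R" "wmeas w R < \<infinity>"
proof -
  show m: "w \<in> borel_measurable lebesgue" and p: "AE x in lebesgue. 0 < w x"
    using w by (auto simp: weight_def)
  note R' = cube_props[OF R]
  show "0 < wmeas w R"
    unfolding wmeas_def
  proof (rule set_nn_integral_pos)
    show "AE x in lebesgue. 0 < ennreal (w x)" using p by eventually_elim simp
  qed (use m R' in auto)
  have "integrable lebesgue (\<lambda>x. indicator R x *\<^sub>R w x)"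
    using w R'(2) by (auto simp: weight_def absolutely_integrable_on_def set_integrable_def)
  then have "(\<integral>\<^sup>+x. ennreal (norm (indicator R x *\<^sub>R w x)) \<partial>lebesgue) < \<infinity>"
    by (simp add: integrable_iff_bounded)
  moreover have "wmeas w R \<le> (\<integral>\<^sup>+x. ennreal (norm (indicator R x *\<^sub>R w x)) \<partial>lebesgue)"
    unfolding wmeas_def by (intro nn_integral_mono) (auto simp: indicator_def intro!: ennreal_leI)
  ultimately show "wmeas w R < \<infinity>" by (rule le_less_trans[rotated])
qed

section \<open>Jensen's inequality for the geometric mean\<close>

text \<open>Jensen's inequality in the form
  \<open>exp (avg (ln w\<^sup>-\<^sup>1)) * (avg (sqrt w))\<^sup>2 \<ge> 1\<close>; the geometric mean may be infinite.\<close>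

lemma geom_mean_inv_sqrt:
  assumes w: "weight w" and R: "R \<in> cubes" and \<theta>: "0 < \<theta>"
    and fin: "(\<integral>\<^sup>+x\<in>R. ennreal (sqrt (max 0 (w x))) \<partial>lebesgue) < \<infinity>"
  defines "r \<equiv> weight_on lebesgue (\<lambda>x. sqrt (max 0 (w x))) R / vol R"
  shows "1 \<le> geom_mean_inv w R epowr \<theta> * ennreal ((r powr 2) powr \<theta>)"
proof -
  note R' = cube_props[OF R] and w' = weight_facts[OF w R]
  note [measurable] = w'(1) R'(1)
  let ?g = "\<lambda>x. sqrt (max 0 (w x))"
  have "0 < (\<integral>\<^sup>+x\<in>R. ennreal (?g x) \<partial>lebesgue)"
  proof (rule set_nn_integral_pos)
    show "AE x in lebesgue. 0 < ennreal (?g x)"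
      using w'(2) by eventually_elim simp
  qed (use R' in auto)
  then have "0 < weight_on lebesgue ?g R"
    using fin by (simp add: weight_on_def enn2real_positive_iff)
  then have r0: "0 < r" using R'(3) by (simp add: r_def)
  show ?thesis
  proof (cases "set_integrable lebesgue R (\<lambda>x. ln (inverse (w x)))")
    \<comment> \<open>The geometric mean is infinite here; positivity of \<open>r\<close> makes the
      product infinite rather than \<open>\<infinity> * 0 = 0\<close>.\<close>
    case False
    then show ?thesis using r0 by (simp add: geom_mean_inv_def epowr_def ennreal_top_mult)
  next
    case True
    define u where "u = (LINT x:R|lebesgue. ln (inverse (w x)))"
    \<comment> \<open>\<open>y0\<close> is the average of \<open>ln (w x) / 2\<close> over
      \<open>R\<close>; Jensen's inequality is proved with the tangent line of exp at this
      point.\<close>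
    define y0 where "y0 = - u / (2 * vol R)"
    have intg: "integrable lebesgue (\<lambda>x. indicator R x * ?g x)"
    proof (rule integrableI_nonneg)
      have "(\<integral>\<^sup>+x. ennreal (indicator R x * ?g x) \<partial>lebesgue) = (\<integral>\<^sup>+x\<in>R. ennreal (?g x) \<partial>lebesgue)"
        by (intro nn_integral_cong) (auto simp: indicator_def)
      then show "(\<integral>\<^sup>+x. ennreal (indicator R x * ?g x) \<partial>lebesgue) < \<infinity>" using fin by simp
    qed (auto intro!: AE_I2 simp: indicator_def)
    have intr: "integral\<^sup>L lebesgue (\<lambda>x. indicator R x * ?g x) = weight_on lebesgue ?g R"
      unfolding weight_on_def
      by (subst integral_eq_nn_integral)
        (auto intro!: AE_I2 arg_cong[where f=enn2real] nn_integral_cong simp: indicator_def)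
    have intl: "integrable lebesgue (\<lambda>x. indicator R x * ln (inverse (w x)))"
      using True by (simp add: set_integrable_def)
    have inti: "integrable lebesgue (\<lambda>x. indicator R x :: real)"
      using R' by (simp add: integrable_indicator_iff less_top)
    \<comment> \<open>On \<open>R\<close> this is the tangent line evaluated at
      \<open>ln (w x) / 2\<close>. Its linear term integrates to 0 by the choice of
      \<open>y0\<close>.\<close>
    define k where "k x = exp y0 * ((1 - y0) * indicator R x - 1 / 2 * (indicator R x * ln (inverse (w x))))" for x
    have intk: "integrable lebesgue k"
      unfolding k_def using intl inti by auto
    have "integral\<^sup>L lebesgue k = exp y0 * ((1 - y0) * vol R - 1 / 2 * u)"
      unfolding k_def u_def set_lebesgue_integral_def using intl inti R'(1) by simp
    also have "\<dots> = exp y0 * vol R" using R'(3) by (simp add: y0_def field_simps)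
    finally have k: "integral\<^sup>L lebesgue k = exp y0 * vol R" .
    have "integral\<^sup>L lebesgue k \<le> integral\<^sup>L lebesgue (\<lambda>x. indicator R x * ?g x)"
    proof (rule integral_mono_AE[OF intk intg])
      show "AE x in lebesgue. k x \<le> indicator R x * ?g x"
        using w'(2)
      proof eventually_elim
        case (elim x)
        define y where "y = ln (w x) / 2"
        have "exp y = ?g x"
          using elim by (simp add: y_def ln_sqrt[symmetric])
        moreover have "exp y0 * (1 + (y - y0)) \<le> exp y0 * exp (y - y0)"
          by (intro mult_left_mono exp_ge_add_one_self) auto
        moreover have "exp y0 * exp (y - y0) = exp y" by (simp add: exp_diff)
        moreover have "ln (inverse (w x)) = - 2 * y" using elim by (simp add: y_def ln_inverse)
        ultimately show ?case
          by (cases "x \<in> R") (auto simp: k_def algebra_simps)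
      qed
    qed
    then have "exp y0 * vol R \<le> r * vol R" using R'(3) by (simp add: k intr r_def)
    then have er: "exp y0 \<le> r" using R'(3) by simp
    then have "exp y0 powr 2 \<le> r powr 2" by (intro powr_mono2) auto
    also have "exp y0 powr 2 = exp (- (u / vol R))" using R'(3) by (simp add: powr_def y0_def)
    finally have "exp (u / vol R) * exp (- (u / vol R)) \<le> exp (u / vol R) * r powr 2"
      by (intro mult_left_mono) auto
    then have "1 \<le> exp (u / vol R) * r powr 2" by (simp add: exp_minus)
    then have "1 powr \<theta> \<le> (exp (u / vol R) * r powr 2) powr \<theta>"
      using \<theta> by (intro powr_mono2) auto
    also have "\<dots> = exp (u / vol R) powr \<theta> * (r powr 2) powr \<theta>" by (simp add: powr_mult)
    finally have "ennreal 1 \<le> ennreal (exp (u / vol R) powr \<theta> * (r powr 2) powr \<theta>)"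
      by (intro ennreal_leI) simp
    also have "\<dots> = geom_mean_inv w R epowr \<theta> * ennreal ((r powr 2) powr \<theta>)"
      using True by (simp add: geom_mean_inv_def epowr_ennreal ennreal_mult u_def)
    finally show ?thesis by simp
  qed
qed

section \<open>Weights on Euclidean space and families of grid cubes\<close>

locale weighted_setup =
  fixes m :: nat and \<alpha> p q :: real and ps :: "nat \<Rightarrow> real"
    and \<sigma> f :: "nat \<Rightarrow> real ^ 'n::finite \<Rightarrow> real" and \<omega> :: "real ^ 'n \<Rightarrow> real"
  assumes m: "1 \<le> m" and \<alpha>: "0 \<le> \<alpha>" "\<alpha> < real m * real CARD('n)"
    and ps: "\<And>i. i \<in> {1..m} \<Longrightarrow> 1 < ps i" and q: "1 < q" and p: "1 / p = (\<Sum>i=1..m. 1 / ps i)" and pq: "p \<le> q"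
    and \<sigma>: "\<And>i. i \<in> {1..m} \<Longrightarrow> weight (\<sigma> i)" and \<omega>: "weight \<omega>"
    and f: "\<And>i. i \<in> {1..m} \<Longrightarrow> f i \<in> weighted_Lp (ps i) (\<sigma> i)"
begin

definition s where "s = real m - \<alpha> / real CARD('n)"
text \<open>A weight is positive only almost everywhere, whereas \<open>weighted_family\<close> asks
  for nonnegative functions. Truncation leaves \<open>ennreal (\<sigma> i x)\<close> unchanged,
  because \<open>ennreal\<close> already sends negative numbers to 0.\<close>

definition \<sigma>' where "\<sigma>' i x = max 0 (\<sigma> i x)"
definition f' where "f' i x = \<bar>f i x\<bar>"

lemma \<sigma>_meas: "i \<in> {1..m} \<Longrightarrow> \<sigma> i \<in> borel_measurable lebesgue"
  using \<sigma> by (auto simp: weight_def)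

lemma f_meas: "i \<in> {1..m} \<Longrightarrow> f i \<in> borel_measurable lebesgue"
  using f by (auto simp: weighted_Lp_def)

lemma s_bounds: "0 < s" "s \<le> real m"
  using \<alpha> by (auto simp: s_def field_simps)

lemma norm_integral_eq:
  "(\<integral>\<^sup>+x. (ennreal \<bar>f i x\<bar>) epowr (ps i) * ennreal (\<sigma> i x) \<partial>lebesgue)
    = (\<integral>\<^sup>+x. ennreal (f' i x powr ps i) * ennreal (\<sigma>' i x) \<partial>lebesgue)"
  by (simp add: epowr_ennreal f'_def \<sigma>'_def ennreal_max_zero)

lemma norm_integral_fin:
  assumes i: "i \<in> {1..m}"
  shows "(\<integral>\<^sup>+x. ennreal (f' i x powr ps i) * ennreal (\<sigma>' i x) \<partial>lebesgue) < \<infinity>"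
proof (rule ccontr)
  assume "\<not> ?thesis"
  then have "wnorm (ps i) (\<sigma> i) (\<lambda>x. ennreal \<bar>f i x\<bar>) = \<infinity>"
    unfolding wnorm_def norm_integral_eq by (simp add: epowr_def not_less top_unique)
  then show False using f[OF i] by (simp add: weighted_Lp_def)
qed

lemma family:
  assumes "finite F" "laminar F" "\<And>Q. Q \<in> F \<Longrightarrow> \<exists>R. has_closure Q R"
  shows "weighted_family lebesgue F m s p q ps \<sigma>' f' \<omega>"
proof (rule weighted_family.intro)
  show "sigma_finite_measure (lebesgue :: (real ^ 'n) measure)" by (rule sigma_finite_lebesgue)
  show "finite F" "laminar F" by fact+
  show "F \<subseteq> sets lebesgue" using assms(3) by (auto simp: has_closure_def)
  show "1 \<le> m" "0 < s" "s \<le> real m" "1 / p = (\<Sum>i=1..m. 1 / ps i)" "1 < q" "p \<le> q"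
    by (fact m s_bounds p q pq)+
  show "\<omega> \<in> borel_measurable lebesgue" using \<omega> by (simp add: weight_def)
  fix Q assume "Q \<in> F"
  then obtain R where R: "has_closure Q R" using assms(3) by blast
  then have Rc: "R \<in> cubes" by (simp add: has_closure_def)
  show "0 < emeasure lebesgue Q" "emeasure lebesgue Q < \<infinity>"
    using R cube_props[OF Rc] by (auto simp: has_closure_def)
  show "(\<integral>\<^sup>+x\<in>Q. ennreal (\<omega> x) \<partial>lebesgue) < \<infinity>"
    using R weight_facts[OF \<omega> Rc] by (simp add: has_closure_def wmeas_def)
  fix i assume i: "i \<in> {1..m}"
  show "0 < (\<integral>\<^sup>+x\<in>Q. ennreal (\<sigma>' i x) \<partial>lebesgue)" "(\<integral>\<^sup>+x\<in>Q. ennreal (\<sigma>' i x) \<partial>lebesgue) < \<infinity>"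
    using R weight_facts[OF \<sigma>[OF i] Rc] by (simp_all add: has_closure_def wmeas_def \<sigma>'_def ennreal_max_zero)
next
  fix i assume i: "i \<in> {1..m}"
  note [measurable] = \<sigma>_meas[OF i] f_meas[OF i]
  show "1 < ps i" by (rule ps[OF i])
  show "\<sigma>' i \<in> borel_measurable lebesgue" unfolding \<sigma>'_def by measurable
  show "f' i \<in> borel_measurable lebesgue" unfolding f'_def by measurable
  show "0 \<le> \<sigma>' i x" "0 \<le> f' i x" for x by (auto simp: \<sigma>'_def f'_def)
  show "(\<integral>\<^sup>+x. ennreal (f' i x powr ps i) * ennreal (\<sigma>' i x) \<partial>lebesgue) < \<infinity>"
    by (rule norm_integral_fin[OF i])
qed

lemma single: "R \<in> cubes \<Longrightarrow> weighted_family lebesgue {R} m s p q ps \<sigma>' f' \<omega>"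
  by (rule family) (auto simp: laminar_def intro: has_closure_cube)

lemma closed_single:
  assumes "has_closure Q R"
  shows "weighted_family lebesgue {Q} m s p q ps \<sigma>' f' \<omega>"
  by (rule family) (use assms in \<open>auto simp: laminar_def\<close>)

lemma family_grid:
  assumes "0 < L" "finite F" "F \<subseteq> grid v L"
  shows "weighted_family lebesgue F m s p q ps \<sigma>' f' \<omega>"
  using assms by (intro family laminar_subset[OF laminar_grid]) (auto intro: has_closure_grid)

text \<open>None of these depends on the family, so facts obtained in a one-element family speak
  about the same numbers that occur in larger families.\<close>

abbreviation "Vol Q \<equiv> weighted_family.V lebesgue Q"
abbreviation "Sg i Q \<equiv> weighted_family.sg lebesgue \<sigma>' i Q"
abbreviation "Gf i Q \<equiv> weighted_family.G lebesgue \<sigma>' f' i Q"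
abbreviation "Ph Q \<equiv> weighted_family.\<Phi> lebesgue m s \<sigma>' f' Q"
abbreviation "Nm i \<equiv> weighted_family.N lebesgue ps \<sigma>' f' i"
abbreviation "Th i \<equiv> weighted_family.\<theta> p ps i"
abbreviation "Rt i Q \<equiv> weighted_family.rt lebesgue \<sigma>' i Q"

lemma wnorm_f: 
  assumes i: "i \<in> {1..m}"
  shows "wnorm (ps i) (\<sigma> i) (\<lambda>x. ennreal \<bar>f i x\<bar>) = ennreal (Nm i powr (1 / ps i))"
proof -
  interpret W: weighted_family lebesgue "{}" m s p q ps \<sigma>' f' \<omega> by (rule family) (auto simp: laminar_def)
  show ?thesis
    unfolding wnorm_def norm_integral_eq W.ennreal_N[OF i, symmetric]
    by (simp add: epowr_ennreal W.N_nonneg)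
qed

lemma Vol_eq:
  fixes Q R :: "(real ^ 'n) set"
  shows "has_closure Q R \<Longrightarrow> Vol Q = vol R"
  using weighted_family.V_def[OF closed_single, of Q R Q] has_closure_vol[of Q R] by simp

lemma Sg_eq:
  assumes "has_closure Q R" "i \<in> {1..m}"
  shows "wmeas (\<sigma> i) R = ennreal (Sg i Q)" "0 < Sg i Q"
proof -
  interpret W: weighted_family lebesgue "{Q}" m s p q ps \<sigma>' f' \<omega> by (rule closed_single[OF assms(1)])
  show "0 < Sg i Q" by (rule W.sg_gt_0) (use assms in auto)
  have "ennreal (Sg i Q) = (\<integral>\<^sup>+x\<in>Q. ennreal (\<sigma>' i x) \<partial>lebesgue)"
    by (rule W.ennreal_sg) (use assms in auto)
  then show "wmeas (\<sigma> i) R = ennreal (Sg i Q)"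
    using assms(1) by (simp add: has_closure_def wmeas_def \<sigma>'_def ennreal_max_zero)
qed

lemma om_eq:
  assumes "has_closure Q R"
  shows "wmeas \<omega> R = ennreal (weight_on lebesgue \<omega> Q)"
proof -
  interpret W: weighted_family lebesgue "{Q}" m s p q ps \<sigma>' f' \<omega> by (rule closed_single[OF assms(1)])
  show ?thesis
    using ennreal_weight_on[OF W.om_fin, of Q] assms by (simp add: has_closure_def wmeas_def)
qed

text \<open>The volume ratio 6^n of \<open>cube_in_grid\<close>, raised to the power
  \<open>s\<close> with which the volume enters \<Phi>.\<close>

definition K0 :: real where "K0 = 6 powr (real CARD('n) * s)"

text \<open>From a cube to a grid cube containing it the integrals can only grow, and the volume
  grows by at most 6^n, whence \<open>K0\<close>. The factor 2^(n/q) is the q-th root of the number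
  of grids. Integration against \<omega> dx is encoded as a measure so that the grid bound applies
  to it directly.\<close>

lemma maximal_bound:
  assumes Y: "0 \<le> Y"
    and le: "\<And>v L F. 0 < L \<Longrightarrow> finite F \<Longrightarrow> F \<subseteq> grid v L \<Longrightarrow>
      (\<integral>\<^sup>+x. ennreal (family_max F Ph x powr q) * ennreal (\<omega> x) \<partial>lebesgue) \<le> ennreal (Y powr q)"
  shows "wnorm q \<omega> (multi_frac_maximal m \<alpha> (\<lambda>i x. \<sigma> i x * f i x)) \<le> ennreal (K0 * 2 powr (real CARD('n) / q) * Y)"
proof -
  have om [measurable]: "\<omega> \<in> borel_measurable lebesgue" using \<omega> by (simp add: weight_def)
  define D where "D = density lebesgue (\<lambda>x. ennreal (\<omega> x))"
  have D: "sets D = sets lebesgue" by (simp add: D_def)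
  have K0: "0 < K0" by (simp add: K0_def)
  interpret W0: weighted_family lebesgue "{}" m s p q ps \<sigma>' f' \<omega> by (rule family) (auto simp: laminar_def)
  define \<phi> where "\<phi> Q = vol Q powr (\<alpha> / real CARD('n)) * (\<Prod>i=1..m. Gf i Q / vol Q)" for Q
  define u where "u Q x = ennreal (vol Q powr (\<alpha> / real CARD('n))) *
       (\<Prod>i=1..m. indicator Q x / ennreal (vol Q) * (\<integral>\<^sup>+y\<in>Q. ennreal \<bar>\<sigma> i y * f i y\<bar> \<partial>lebesgue))" for Q x
  have u: "u Q x \<le> indicator Q x * ennreal (\<phi> Q)" if Q: "Q \<in> cubes" for Q x
  proof (cases "x \<in> Q")
    case False
    then have "u Q x = 0" using m by (auto simp: u_def)
    then show ?thesis by simp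
  next
    case True
    interpret W: weighted_family lebesgue "{Q}" m s p q ps \<sigma>' f' \<omega> by (rule single[OF Q])
    note Q' = cube_props[OF Q]
    have "indicator Q x / ennreal (vol Q) * (\<integral>\<^sup>+y\<in>Q. ennreal \<bar>\<sigma> i y * f i y\<bar> \<partial>lebesgue) = ennreal (Gf i Q / vol Q)"
      if i: "i \<in> {1..m}" for i
    proof -
      \<comment> \<open>Positivity of the weight is known only almost everywhere, so the two
        integrands are compared off a null set.\<close>
      have pos: "AE y in lebesgue. 0 < \<sigma> i y" using \<sigma>[OF i] by (simp add: weight_def)
      have "(\<integral>\<^sup>+y\<in>Q. ennreal \<bar>\<sigma> i y * f i y\<bar> \<partial>lebesgue) = (\<integral>\<^sup>+y\<in>Q. ennreal (\<sigma>' i y * f' i y) \<partial>lebesgue)"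
      proof (rule nn_integral_cong_AE)
        show "AE y in lebesgue. ennreal \<bar>\<sigma> i y * f i y\<bar> * indicator Q y = ennreal (\<sigma>' i y * f' i y) * indicator Q y"
          using pos by eventually_elim (simp add: \<sigma>'_def f'_def abs_mult)
      qed
      also have "\<dots> = ennreal (Gf i Q)" using W.ennreal_G[OF i, of Q] by simp
      finally show ?thesis
        using True Q'(3) by (simp add: W.G_nonneg divide_ennreal ennreal_mult[symmetric] one_ennreal_def[symmetric] flip: ennreal_1)
    qed
    then have "u Q x = ennreal (vol Q powr (\<alpha> / real CARD('n))) * (\<Prod>i=1..m. ennreal (Gf i Q / vol Q))"
      by (simp add: u_def)
    also have "\<dots> = ennreal (\<phi> Q)"
      unfolding \<phi>_def by (simp add: prod_ennreal W.G_nonneg ennreal_mult prod_nonneg)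
    finally show ?thesis using True by simp
  qed
  have \<phi>: "0 \<le> \<phi> Q \<and> \<phi> Q \<le> K0 * Ph (gcube v L d j)"
    if Q: "Q \<in> cubes" and L: "0 < L" and sub: "Q \<subseteq> gcube v L d j"
      and vol: "(L / 2 ^ d) ^ CARD('n) \<le> 6 ^ CARD('n) * vol Q" for Q v L d j
  proof
    define R where "R = gcube v L d j"
    obtain R' where R': "has_closure R R'" "vol R' = (L / 2 ^ d) ^ CARD('n)"
      using gcube_closure[OF L, of d v j] unfolding has_closure_def R_def by blast
    note Q' = cube_props[OF Q]
    interpret W: weighted_family lebesgue "{R}" m s p q ps \<sigma>' f' \<omega> by (rule closed_single[OF R'(1)])
    interpret WQ: weighted_family lebesgue "{Q}" m s p q ps \<sigma>' f' \<omega> by (rule single[OF Q])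
    show "0 \<le> \<phi> Q" by (simp add: \<phi>_def W.G_nonneg prod_nonneg)
    have VR: "W.V R = (L / 2 ^ d) ^ CARD('n)" using Vol_eq[OF R'(1)] R'(2) by simp
    have VR0: "0 < W.V R" using W.V_pos by simp
    have G: "W.G i Q \<le> W.G i R" if i: "i \<in> {1..m}" for i
    proof -
      have "ennreal (W.G i Q) = (\<integral>\<^sup>+x\<in>Q. ennreal (\<sigma>' i x * f' i x) \<partial>lebesgue)" by (rule WQ.ennreal_G[OF i]) simp
      also have "\<dots> \<le> (\<integral>\<^sup>+x\<in>R. ennreal (\<sigma>' i x * f' i x) \<partial>lebesgue)"
        using sub by (intro nn_integral_mono) (auto simp: R_def indicator_def)
      also have "\<dots> = ennreal (W.G i R)" by (rule W.ennreal_G[OF i, symmetric]) simp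
      finally show ?thesis by (simp add: W.G_nonneg)
    qed
    have "\<phi> Q = (\<Prod>i=1..m. W.G i Q) * (vol Q powr (\<alpha> / real CARD('n)) / vol Q powr real m)"
      using Q'(3) by (simp add: \<phi>_def prod_dividef powr_realpow)
    also have "\<dots> = (\<Prod>i=1..m. W.G i Q) / vol Q powr s"
      using Q'(3) by (simp add: s_def powr_diff)
    also have "\<dots> \<le> (\<Prod>i=1..m. W.G i R) / (W.V R powr s / K0)"
    proof (rule frac_le)
      show "(\<Prod>i=1..m. W.G i Q) \<le> (\<Prod>i=1..m. W.G i R)"
        by (intro prod_mono) (auto simp: W.G_nonneg G)
      have "W.V R powr s \<le> (6 ^ CARD('n) * vol Q) powr s"
        unfolding VR using vol s_bounds L by (intro powr_mono2) auto
      also have "\<dots> = K0 * vol Q powr s"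
        by (simp add: K0_def powr_mult powr_realpow[symmetric] powr_powr)
      finally show "W.V R powr s / K0 \<le> vol Q powr s" using K0 by (simp add: field_simps)
    qed (use VR0 K0 in \<open>auto simp: W.G_nonneg intro!: prod_nonneg\<close>)
    also have "\<dots> = K0 * W.\<Phi> R" by (simp add: W.\<Phi>_def)
    finally show "\<phi> Q \<le> K0 * Ph (gcube v L d j)" by (simp add: R_def)
  qed
  have leD: "(\<integral>\<^sup>+x. ennreal (family_max F Ph x powr q) \<partial>D) \<le> ennreal (Y powr q)"
    if "0 < L" "finite F" "F \<subseteq> grid v L" for v L F
  proof -
    interpret W: weighted_family lebesgue F m s p q ps \<sigma>' f' \<omega> by (rule family_grid[OF that])
    have [measurable]: "family_max F Ph \<in> borel_measurable lebesgue" by (rule borel_measurable_family_max[OF W.F(1,3)])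
    have "(\<integral>\<^sup>+x. ennreal (family_max F Ph x powr q) \<partial>D) = (\<integral>\<^sup>+x. ennreal (family_max F Ph x powr q) * ennreal (\<omega> x) \<partial>lebesgue)"
      unfolding D_def by (subst nn_integral_density) (auto simp: mult.commute)
    then show ?thesis using le[OF that] by simp
  qed
  have "\<exists>g\<in>borel_measurable D. (\<forall>x. (SUP Q\<in>cubes. u Q x) epowr q \<le> g x) \<and>
    (\<integral>\<^sup>+x. g x \<partial>D) \<le> ennreal (K0 powr q * 2 ^ CARD('n)) * ennreal (Y powr q)"
    by (rule maximal_le_grid_bound[OF D _ W0.\<Phi>_nonneg K0 u \<phi> leD]) (use q in auto)
  then obtain g where g: "g \<in> borel_measurable lebesgue" "\<And>x. (SUP Q\<in>cubes. u Q x) epowr q \<le> g x"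
    "(\<integral>\<^sup>+x. g x \<partial>D) \<le> ennreal (K0 powr q * 2 ^ CARD('n)) * ennreal (Y powr q)"
    by (auto simp: D_def)
  have "(\<integral>\<^sup>+x. multi_frac_maximal m \<alpha> (\<lambda>i x. \<sigma> i x * f i x) x epowr q * ennreal (\<omega> x) \<partial>lebesgue)
      \<le> (\<integral>\<^sup>+x. g x * ennreal (\<omega> x) \<partial>lebesgue)"
    unfolding multi_frac_maximal_def u_def[symmetric]
    by (intro nn_integral_mono mult_right_mono g) auto
  also have "\<dots> = (\<integral>\<^sup>+x. g x \<partial>D)"
    unfolding D_def using g(1) by (subst nn_integral_density) (auto simp: mult.commute)
  also have "\<dots> \<le> ennreal (K0 powr q * 2 ^ CARD('n) * Y powr q)"
    using g(3) by (simp add: ennreal_mult)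
  finally have "wnorm q \<omega> (multi_frac_maximal m \<alpha> (\<lambda>i x. \<sigma> i x * f i x))
      \<le> ennreal (K0 powr q * 2 ^ CARD('n) * Y powr q) epowr (1 / q)"
    unfolding wnorm_def using q by (intro epowr_mono) auto
  also have "\<dots> = ennreal ((K0 powr q * 2 ^ CARD('n) * Y powr q) powr (1 / q))"
    by (rule epowr_ennreal) auto
  also have "(K0 powr q * 2 ^ CARD('n) * Y powr q) powr (1 / q)
      = (K0 powr q) powr (1 / q) * (2 powr real CARD('n)) powr (1 / q) * (Y powr q) powr (1 / q)"
    by (simp add: powr_mult powr_realpow)
  also have "\<dots> = K0 * 2 powr (real CARD('n) / q) * Y"
    using q Y K0 by (simp add: powr_powr)
  finally show ?thesis .
qed

section \<open>The weight constants as real inequalities on one cube\<close>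

lemma A_const_real:
  assumes fin: "A_const m \<alpha> ps p q \<sigma> \<omega> < \<infinity>" and QR: "has_closure Q R"
  shows "weight_on lebesgue \<omega> Q powr (p / q) * (\<Prod>i=1..m. Sg i Q powr (p - Th i))
    \<le> enn2real (A_const m \<alpha> ps p q \<sigma> \<omega>) * Vol Q powr (p * s)"
proof -
  interpret W: weighted_family lebesgue "{Q}" m s p q ps \<sigma>' f' \<omega> by (rule closed_single[OF QR])
  have R: "R \<in> cubes" using QR by (simp add: has_closure_def)
  define A where "A = enn2real (A_const m \<alpha> ps p q \<sigma> \<omega>)"
  define X where "X = weight_on lebesgue \<omega> Q powr (p / q) * (\<Prod>i=1..m. Sg i Q powr (p - Th i))"
  have V: "0 < Vol Q" using W.V_pos by simp
  \<comment> \<open>\<open>1 / conj_exp (ps i) = 1 - 1 / ps i\<close>; this links the exponent of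
    the A constant with the one in \<open>A_bound\<close> and \<open>W_bound\<close>.\<close>
  have th: "p / conj_exp (ps i) = p - Th i" if "i \<in> {1..m}" for i
    using ps[OF that] by (simp add: conj_exp_def W.\<theta>_def field_simps)
  have "(wmeas \<omega> R epowr (p / q) * (\<Prod>i=1..m. wmeas (\<sigma> i) R epowr (p / conj_exp (ps i))))
       / ennreal (vol R powr (p * (real m - \<alpha> / real CARD('n)))) \<le> A_const m \<alpha> ps p q \<sigma> \<omega>"
    unfolding A_const_def by (rule SUP_upper[OF R])
  also have "A_const m \<alpha> ps p q \<sigma> \<omega> = ennreal A" using fin by (simp add: A_def less_top)
  also have "(\<Prod>i=1..m. wmeas (\<sigma> i) R epowr (p / conj_exp (ps i))) = (\<Prod>i=1..m. ennreal (Sg i Q powr (p - Th i)))"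
    by (intro prod.cong) (auto simp: Sg_eq[OF QR] th epowr_ennreal W.sg_ge_0)
  also have "\<dots> = ennreal (\<Prod>i=1..m. Sg i Q powr (p - Th i))" by (rule prod_ennreal) simp
  also have "wmeas \<omega> R epowr (p / q) = ennreal (weight_on lebesgue \<omega> Q powr (p / q))"
    by (simp add: om_eq[OF QR] epowr_ennreal weight_on_nonneg)
  also have "ennreal (weight_on lebesgue \<omega> Q powr (p / q)) * ennreal (\<Prod>i=1..m. Sg i Q powr (p - Th i)) = ennreal X"
    unfolding X_def by (rule ennreal_mult[symmetric]) (auto intro: prod_nonneg)
  also have "vol R powr (p * (real m - \<alpha> / real CARD('n))) = Vol Q powr (p * s)"
    by (simp add: Vol_eq[OF QR] s_def)
  also have "ennreal X / ennreal (Vol Q powr (p * s)) = ennreal (X / Vol Q powr (p * s))"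
    using V by (intro divide_ennreal) (auto simp: X_def intro!: mult_nonneg_nonneg prod_nonneg)
  finally have "X / Vol Q powr (p * s) \<le> A" by (simp add: A_def ennreal_le_iff)
  then show ?thesis using V by (simp add: X_def A_def field_simps)
qed

text \<open>The inverse geometric means may be infinite, so they are never divided by. Jensen's
  inequality makes their product times \<open>T\<close> at least 1; inserting this factor brings the
  left side into the form that the B constant bounds.\<close>

lemma B_const_real:
  assumes fin: "B_const m \<alpha> ps p q \<sigma> \<omega> < \<infinity>" and QR: "has_closure Q R"
  shows "weight_on lebesgue \<omega> Q powr (p / q) * (\<Prod>i=1..m. Sg i Q powr p)
    \<le> enn2real (B_const m \<alpha> ps p q \<sigma> \<omega>) * Vol Q powr (p * s + 1) * (\<Prod>i=1..m. (Rt i Q powr 2) powr Th i)"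
proof -
  interpret W: weighted_family lebesgue "{Q}" m s p q ps \<sigma>' f' \<omega> by (rule closed_single[OF QR])
  have R: "R \<in> cubes" using QR by (simp add: has_closure_def)
  interpret WR: weighted_family lebesgue "{R}" m s p q ps \<sigma>' f' \<omega> by (rule single[OF R])
  define B where "B = enn2real (B_const m \<alpha> ps p q \<sigma> \<omega>)"
  have B0: "0 \<le> B" by (simp add: B_def)
  define X where "X = weight_on lebesgue \<omega> Q powr (p / q) * (\<Prod>i=1..m. Sg i Q powr p)"
  define T where "T = (\<Prod>i=1..m. (Rt i Q powr 2) powr Th i)"
  define Ge where "Ge = (\<Prod>i=1..m. geom_mean_inv (\<sigma> i) R epowr (p / ps i))"
  have T0: "0 \<le> T" unfolding T_def by (intro prod_nonneg) auto
  have V: "0 < Vol Q" using W.V_pos by simp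
  have "1 \<le> (\<Prod>i=1..m. geom_mean_inv (\<sigma> i) R epowr (p / ps i) * ennreal ((Rt i Q powr 2) powr Th i))"
  proof -
    have "1 \<le> geom_mean_inv (\<sigma> i) R epowr (p / ps i) * ennreal ((Rt i Q powr 2) powr Th i)" if i: "i \<in> {1..m}" for i
    proof -
      have "(\<integral>\<^sup>+x\<in>R. ennreal (sqrt (max 0 (\<sigma> i x))) \<partial>lebesgue) < \<infinity>"
        using WR.rt_fin[OF i, of R] by (simp add: \<sigma>'_def)
      from geom_mean_inv_sqrt[OF \<sigma>[OF i] R W.\<theta>_pos[OF i] this]
      have "1 \<le> geom_mean_inv (\<sigma> i) R epowr W.\<theta> i *
        ennreal (((weight_on lebesgue (\<lambda>x. sqrt (max 0 (\<sigma> i x))) R / vol R) powr 2) powr W.\<theta> i)" .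
      moreover have "Rt i Q = weight_on lebesgue (\<lambda>x. sqrt (max 0 (\<sigma> i x))) R / vol R"
        unfolding W.rt_def Vol_eq[OF QR] weight_on_def using QR by (simp add: has_closure_def \<sigma>'_def)
      ultimately show ?thesis by (simp add: W.\<theta>_def)
    qed
    then have "(\<Prod>i=1..m. 1) \<le> (\<Prod>i=1..m. geom_mean_inv (\<sigma> i) R epowr (p / ps i) * ennreal ((Rt i Q powr 2) powr Th i))"
      by (rule prod_mono_ennreal)
    then show ?thesis by simp
  qed
  also have "\<dots> = Ge * ennreal T"
    by (simp add: prod.distrib Ge_def T_def prod_ennreal)
  finally have GT: "1 \<le> Ge * ennreal T" .
  have "(wmeas \<omega> R epowr (p / q) * (\<Prod>i=1..m. wmeas (\<sigma> i) R epowr p))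
       / ennreal (vol R powr (p * (real m - \<alpha> / real CARD('n)) + 1)) * Ge \<le> B_const m \<alpha> ps p q \<sigma> \<omega>"
    unfolding B_const_def Ge_def by (rule SUP_upper[OF R])
  also have "B_const m \<alpha> ps p q \<sigma> \<omega> = ennreal B" using fin by (simp add: B_def less_top)
  also have "(\<Prod>i=1..m. wmeas (\<sigma> i) R epowr p) = (\<Prod>i=1..m. ennreal (Sg i Q powr p))"
    by (intro prod.cong) (auto simp: Sg_eq[OF QR] epowr_ennreal W.sg_ge_0)
  also have "\<dots> = ennreal (\<Prod>i=1..m. Sg i Q powr p)" by (rule prod_ennreal) simp
  also have "wmeas \<omega> R epowr (p / q) = ennreal (weight_on lebesgue \<omega> Q powr (p / q))"
    by (simp add: om_eq[OF QR] epowr_ennreal weight_on_nonneg)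
  also have "ennreal (weight_on lebesgue \<omega> Q powr (p / q)) * ennreal (\<Prod>i=1..m. Sg i Q powr p) = ennreal X"
    unfolding X_def by (rule ennreal_mult[symmetric]) (auto intro: prod_nonneg)
  also have "vol R powr (p * (real m - \<alpha> / real CARD('n)) + 1) = Vol Q powr (p * s + 1)"
    by (simp add: Vol_eq[OF QR] s_def)
  also have "ennreal X / ennreal (Vol Q powr (p * s + 1)) = ennreal (X / Vol Q powr (p * s + 1))"
    using V by (intro divide_ennreal) (auto simp: X_def intro!: mult_nonneg_nonneg prod_nonneg)
  finally have XG: "ennreal (X / Vol Q powr (p * s + 1)) * Ge \<le> ennreal B" .
  have "ennreal (X / Vol Q powr (p * s + 1)) \<le> ennreal (X / Vol Q powr (p * s + 1)) * (Ge * ennreal T)"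
    using mult_left_mono[OF GT, of "ennreal (X / Vol Q powr (p * s + 1))"] by simp
  also have "\<dots> = ennreal (X / Vol Q powr (p * s + 1)) * Ge * ennreal T" by (simp add: mult.assoc)
  also have "\<dots> \<le> ennreal B * ennreal T" by (rule mult_right_mono[OF XG]) simp
  also have "\<dots> = ennreal (B * T)" using B0 T0 by (simp add: ennreal_mult)
  finally have "X / Vol Q powr (p * s + 1) \<le> B * T" using B0 T0 by (simp add: ennreal_le_iff)
  then show ?thesis using V by (simp add: X_def B_def T_def field_simps)
qed

text \<open>The closed cube \<open>Q'\<close> is a competitor in the supremum at \<open>x\<close>;
  cutting \<sigma>_i off outside \<open>R'\<close> loses nothing on \<open>Q\<close>, as
  \<open>Q \<subseteq> R \<subseteq> R'\<close>.\<close>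

lemma HL_maximal_ge:
  assumes Q: "has_closure Q Q'" and R: "has_closure R R'" and sub: "Q \<subseteq> R" and x: "x \<in> Q" and i: "i \<in> {1..m}"
  shows "ennreal (Sg i Q / Vol Q) \<le> HL_maximal (\<lambda>y. \<sigma> i y * indicator R' y) x"
proof -
  interpret W: weighted_family lebesgue "{Q}" m s p q ps \<sigma>' f' \<omega> by (rule closed_single[OF Q])
  have Q': "Q' \<in> cubes" "Q \<subseteq> Q'" and R': "R \<subseteq> R'" using Q R by (auto simp: has_closure_def)
  have V: "0 < vol Q'" using cube_props[OF Q'(1)] by simp
  have "ennreal (Sg i Q / Vol Q) = ennreal (1 / vol Q') * ennreal (Sg i Q)"
    using V by (simp add: Vol_eq[OF Q] W.sg_ge_0 ennreal_mult[symmetric])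
  also have "\<dots> = indicator Q' x / ennreal (vol Q') * ennreal (Sg i Q)"
    using V x Q'(2) by (auto simp: divide_ennreal indicator_def simp flip: ennreal_1)
  also have "\<dots> \<le> indicator Q' x / ennreal (vol Q') * (\<integral>\<^sup>+y\<in>Q'. ennreal \<bar>\<sigma> i y * indicator R' y\<bar> \<partial>lebesgue)"
  proof (rule mult_left_mono)
    have "ennreal (Sg i Q) = (\<integral>\<^sup>+y\<in>Q. ennreal (\<sigma>' i y) \<partial>lebesgue)" by (rule W.ennreal_sg[OF i]) simp
    also have "\<dots> \<le> (\<integral>\<^sup>+y\<in>Q'. ennreal \<bar>\<sigma> i y * indicator R' y\<bar> \<partial>lebesgue)"
      using sub Q'(2) R' by (intro nn_integral_mono) (auto simp: indicator_def \<sigma>'_def intro!: ennreal_leI)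
    finally show "ennreal (Sg i Q) \<le> (\<integral>\<^sup>+y\<in>Q'. ennreal \<bar>\<sigma> i y * indicator R' y\<bar> \<partial>lebesgue)" .
  qed simp
  also have "\<dots> \<le> HL_maximal (\<lambda>y. \<sigma> i y * indicator R' y) x"
    unfolding HL_maximal_def by (rule SUP_upper[OF Q'(1)])
  finally show ?thesis .
qed

section \<open>The three inequalities for all cubes\<close>

definition cl :: "(real ^ 'n) set \<Rightarrow> (real ^ 'n) set" where "cl Q = (SOME R. has_closure Q R)"

lemma has_closure_cl: "0 < L \<Longrightarrow> Q \<in> grid v L \<Longrightarrow> has_closure Q (cl Q)"
  unfolding cl_def by (rule someI_ex[OF has_closure_grid])

text \<open>Three losses: the comparison with grid cubes, the number of grids, and the domination by
  a sparse subfamily.\<close>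

definition C0 :: real where "C0 = K0 * 2 powr (real CARD('n) / q) * 2 powr s"

text \<open>\<open>A\<close> is meant for the part coming from the weight constants and
  \<open>P\<close> for the part depending on the exponents, so that \<open>C0 * P\<close> is what
  enters the final constant.\<close>

lemma wnorm_le:
  assumes A: "0 \<le> A" and P: "0 \<le> P"
    and le: "\<And>v L F. 0 < L \<Longrightarrow> finite F \<Longrightarrow> F \<subseteq> grid v L \<Longrightarrow>
      (\<integral>\<^sup>+x. ennreal (family_max F Ph x powr q) * ennreal (\<omega> x) \<partial>lebesgue)
        \<le> ennreal ((2 powr s * A * P * (\<Prod>i=1..m. Nm i powr (1 / ps i))) powr q)"
  shows "wnorm q \<omega> (multi_frac_maximal m \<alpha> (\<lambda>i x. \<sigma> i x * f i x))
    \<le> ennreal (C0 * P) * ennreal A * (\<Prod>i=1..m. wnorm (ps i) (\<sigma> i) (\<lambda>x. ennreal \<bar>f i x\<bar>))"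
proof -
  define Pn where "Pn = (\<Prod>i=1..m. Nm i powr (1 / ps i))"
  have Pn: "0 \<le> Pn" unfolding Pn_def by (intro prod_nonneg) auto
  have C0: "0 \<le> C0" by (simp add: C0_def K0_def)
  have "wnorm q \<omega> (multi_frac_maximal m \<alpha> (\<lambda>i x. \<sigma> i x * f i x))
    \<le> ennreal (K0 * 2 powr (real CARD('n) / q) * (2 powr s * A * P * Pn))"
    using le A P Pn unfolding Pn_def[symmetric] by (intro maximal_bound) auto
  also have "K0 * 2 powr (real CARD('n) / q) * (2 powr s * A * P * Pn) = C0 * P * A * Pn"
    by (simp add: C0_def)
  also have "ennreal \<dots> = ennreal (C0 * P) * ennreal A * ennreal Pn"
    using C0 A P Pn by (simp add: ennreal_mult)
  also have "ennreal Pn = (\<Prod>i=1..m. wnorm (ps i) (\<sigma> i) (\<lambda>x. ennreal \<bar>f i x\<bar>))"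
    unfolding Pn_def by (subst prod_ennreal[symmetric]) (auto simp: wnorm_f intro!: prod.cong)
  finally show ?thesis .
qed

theorem B_inequality:
  assumes fin: "B_const m \<alpha> ps p q \<sigma> \<omega> < \<infinity>"
  shows "wnorm q \<omega> (multi_frac_maximal m \<alpha> (\<lambda>i x. \<sigma> i x * f i x))
    \<le> ennreal (C0 * (\<Prod>i=1..m. (2 * maximal_const 2 * maximal_const (ps i)) powr (1 / ps i))) * B_const m \<alpha> ps p q \<sigma> \<omega> epowr (1 / p)
      * (\<Prod>i=1..m. wnorm (ps i) (\<sigma> i) (\<lambda>x. ennreal \<bar>f i x\<bar>))"
proof -
  define B where "B = enn2real (B_const m \<alpha> ps p q \<sigma> \<omega>)"
  have B: "B_const m \<alpha> ps p q \<sigma> \<omega> = ennreal B" "0 \<le> B" using fin by (auto simp: B_def less_top)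
  have eB: "B_const m \<alpha> ps p q \<sigma> \<omega> epowr (1 / p) = ennreal (B powr (1 / p))"
    by (simp add: B epowr_ennreal)
  show ?thesis
    unfolding eB
  proof (rule wnorm_le)
    fix v :: "real ^ 'n" and L :: real and F assume F: "0 < L" "finite F" "F \<subseteq> grid v L"
    interpret W: weighted_family lebesgue F m s p q ps \<sigma>' f' \<omega> by (rule family_grid[OF F])
    show "(\<integral>\<^sup>+x. ennreal (family_max F Ph x powr q) * ennreal (\<omega> x) \<partial>lebesgue)
        \<le> ennreal ((2 powr s * B powr (1 / p) * (\<Prod>i=1..m. (2 * maximal_const 2 * maximal_const (ps i)) powr (1 / ps i))
          * (\<Prod>i=1..m. Nm i powr (1 / ps i))) powr q)"
    proof (rule W.B_bound[OF B(2)])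
      fix Q assume "Q \<in> F"
      then have "has_closure Q (cl Q)" using has_closure_cl F by blast
      from B_const_real[OF fin this]
      show "weight_on lebesgue \<omega> Q powr (p / q) * (\<Prod>i=1..m. W.sg i Q powr p)
        \<le> B * W.V Q powr (p * s + 1) * (\<Prod>i=1..m. (W.rt i Q powr 2) powr W.\<theta> i)"
        by (simp add: B_def)
    qed
  qed (auto intro: prod_nonneg)
qed

theorem A_inequality:
  assumes fin: "A_const m \<alpha> ps p q \<sigma> \<omega> < \<infinity>" and K: "\<And>i. i \<in> {1..m} \<Longrightarrow> Ainf_const (\<sigma> i) < \<infinity>"
  shows "wnorm q \<omega> (multi_frac_maximal m \<alpha> (\<lambda>i x. \<sigma> i x * f i x))
    \<le> ennreal (C0 * (\<Prod>i=1..m. (2 * maximal_const (ps i)) powr (1 / ps i))) * A_const m \<alpha> ps p q \<sigma> \<omega> epowr (1 / p)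
      * (\<Prod>i=1..m. Ainf_const (\<sigma> i) epowr (1 / ps i))
      * (\<Prod>i=1..m. wnorm (ps i) (\<sigma> i) (\<lambda>x. ennreal \<bar>f i x\<bar>))"
proof -
  define A where "A = enn2real (A_const m \<alpha> ps p q \<sigma> \<omega>)"
  define K where "K i = enn2real (Ainf_const (\<sigma> i))" for i
  have A: "A_const m \<alpha> ps p q \<sigma> \<omega> = ennreal A" "0 \<le> A" using fin by (auto simp: A_def less_top)
  have Ki: "Ainf_const (\<sigma> i) = ennreal (K i)" if "i \<in> {1..m}" for i
    using assms(2)[OF that] by (auto simp: K_def less_top)
  have K0: "0 \<le> K i" for i by (simp add: K_def)
  define PK where "PK = (\<Prod>i=1..m. K i powr (1 / ps i))"
  define P where "P = (\<Prod>i=1..m. (2 * maximal_const (ps i)) powr (1 / ps i))"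
  have PK0: "0 \<le> PK" unfolding PK_def by (intro prod_nonneg) auto
  have P0: "0 \<le> P" unfolding P_def by (intro prod_nonneg) auto
  have "(\<Prod>i=1..m. Ainf_const (\<sigma> i) epowr (1 / ps i)) = (\<Prod>i=1..m. ennreal (K i powr (1 / ps i)))"
    by (intro prod.cong) (auto simp: Ki K0 epowr_ennreal)
  also have "\<dots> = ennreal PK" unfolding PK_def by (rule prod_ennreal) simp
  finally have eK: "(\<Prod>i=1..m. Ainf_const (\<sigma> i) epowr (1 / ps i)) = ennreal PK" .
  have "A_const m \<alpha> ps p q \<sigma> \<omega> epowr (1 / p) = ennreal (A powr (1 / p))"
    by (simp add: A epowr_ennreal)
  then have eA: "ennreal (C0 * P) * A_const m \<alpha> ps p q \<sigma> \<omega> epowr (1 / p) * ennreal PK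
      = ennreal (C0 * P) * ennreal (A powr (1 / p) * PK)"
    using PK0 by (simp add: ennreal_mult mult.assoc)
  have "P * PK = (\<Prod>i=1..m. (2 * K i * maximal_const (ps i)) powr (1 / ps i))"
    unfolding P_def PK_def prod.distrib[symmetric]
    using ps K0 by (intro prod.cong) (auto simp: powr_mult[symmetric] mult_ac)
  then have PPK: "2 powr s * (A powr (1 / p) * PK) * P = 2 powr s * A powr (1 / p) * (\<Prod>i=1..m. (2 * K i * maximal_const (ps i)) powr (1 / ps i))"
    by (metis mult.assoc mult.commute)
  show ?thesis
    unfolding eK P_def[symmetric] eA
  proof (rule wnorm_le)
    fix v :: "real ^ 'n" and L :: real and F assume F: "0 < L" "finite F" "F \<subseteq> grid v L"
    interpret W: weighted_family lebesgue F m s p q ps \<sigma>' f' \<omega> by (rule family_grid[OF F])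
    have cl: "has_closure Q (cl Q)" if "Q \<in> F" for Q using has_closure_cl F that by blast
    show "(\<integral>\<^sup>+x. ennreal (family_max F Ph x powr q) * ennreal (\<omega> x) \<partial>lebesgue)
        \<le> ennreal ((2 powr s * (A powr (1 / p) * PK) * P * (\<Prod>i=1..m. Nm i powr (1 / ps i))) powr q)"
      unfolding PPK
    \<comment> \<open>The weight is cut off to the closed cube \<open>cl R\<close>, on which
      \<open>Ainf_const\<close> is tested; the members \<open>Q\<close> and \<open>R\<close>
      themselves are half-open.\<close>
    proof (rule W.A_bound[OF A(2) K0, where h = "\<lambda>i R. HL_maximal (\<lambda>y. \<sigma> i y * indicator (cl R) y)"])
      fix Q assume "Q \<in> F"
      from A_const_real[OF fin cl[OF this]]
      show "weight_on lebesgue \<omega> Q powr (p / q) * (\<Prod>i=1..m. W.sg i Q powr (p - W.\<theta> i)) \<le> A * W.V Q powr (p * s)"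
        by (simp add: A_def)
    next
      fix i Q R x assume "i \<in> {1..m}" "R \<in> F" "Q \<in> F" "Q \<subseteq> R" "x \<in> Q"
      then show "ennreal (W.sg i Q / W.V Q) \<le> HL_maximal (\<lambda>y. \<sigma> i y * indicator (cl R) y) x"
        by (intro HL_maximal_ge[OF cl cl])
    next
      fix i R assume i: "i \<in> {1..m}" and R: "R \<in> F"
      note R' = cl[OF R]
      then have Rc: "cl R \<in> cubes" by (simp add: has_closure_def)
      have "1 / wmeas (\<sigma> i) (cl R) * (\<integral>\<^sup>+x\<in>cl R. HL_maximal (\<lambda>y. \<sigma> i y * indicator (cl R) y) x \<partial>lebesgue) \<le> Ainf_const (\<sigma> i)"
        unfolding Ainf_const_def by (rule SUP_upper[OF Rc])
      then have "(\<integral>\<^sup>+x\<in>cl R. HL_maximal (\<lambda>y. \<sigma> i y * indicator (cl R) y) x \<partial>lebesgue) / wmeas (\<sigma> i) (cl R) \<le> ennreal (K i)"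
        by (simp add: Ki[OF i] ennreal_divide_times mult.commute divide_ennreal_def)
      then have "(\<integral>\<^sup>+x\<in>cl R. HL_maximal (\<lambda>y. \<sigma> i y * indicator (cl R) y) x \<partial>lebesgue) \<le> ennreal (K i) * wmeas (\<sigma> i) (cl R)"
        by (rule le_mult_of_divide_le_ennreal) (use weight_facts[OF \<sigma>[OF i] Rc] in auto)
      then show "(\<integral>\<^sup>+x\<in>R. HL_maximal (\<lambda>y. \<sigma> i y * indicator (cl R) y) x \<partial>lebesgue)
          \<le> ennreal (K i) * (\<integral>\<^sup>+x\<in>R. ennreal (\<sigma>' i x) \<partial>lebesgue)"
        using R' by (simp add: has_closure_def wmeas_def \<sigma>'_def ennreal_max_zero)
    qed
  qed (use PK0 P0 in auto)
qed

text \<open>This integral is the denominator in \<open>Winf_const\<close>; to clear it, it must be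
  positive and finite. Finiteness is Hoelder's inequality with the masses of the \<sigma>_i on
  \<open>R\<close>.\<close>

lemma geometric_mean_integral:
  assumes R: "R \<in> cubes"
  shows "(\<integral>\<^sup>+x\<in>R. (\<Prod>i=1..m. ennreal (\<sigma> i x) epowr (p / ps i)) \<partial>lebesgue)
      = (\<integral>\<^sup>+x\<in>R. ennreal (\<Prod>i=1..m. \<sigma>' i x powr Th i) \<partial>lebesgue)" (is "?l = ?r")
    and "0 < (\<integral>\<^sup>+x\<in>R. (\<Prod>i=1..m. ennreal (\<sigma> i x) epowr (p / ps i)) \<partial>lebesgue)"
    and "(\<integral>\<^sup>+x\<in>R. (\<Prod>i=1..m. ennreal (\<sigma> i x) epowr (p / ps i)) \<partial>lebesgue) < \<infinity>"
proof -
  interpret W: weighted_family lebesgue "{R}" m s p q ps \<sigma>' f' \<omega> by (rule single[OF R])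
  note R' = cube_props[OF R]
  have "(\<Prod>i=1..m. ennreal (\<sigma> i x) epowr (p / ps i)) = ennreal (\<Prod>i=1..m. \<sigma>' i x powr Th i)" for x
  proof -
    have "ennreal (\<sigma> i x) epowr (p / ps i) = ennreal (\<sigma>' i x powr Th i)" for i
    proof -
      have "0 \<le> \<sigma>' i x" "ennreal (\<sigma> i x) = ennreal (\<sigma>' i x)" by (simp_all add: \<sigma>'_def ennreal_max_zero)
      then show ?thesis by (simp only: epowr_ennreal W.\<theta>_def)
    qed
    then show ?thesis by (simp add: prod_ennreal)
  qed
  then show eq: "?l = ?r" by simp
  have mm [measurable]: "(\<lambda>x. \<Prod>i=1..m. \<sigma>' i x powr Th i) \<in> borel_measurable lebesgue"
    using W.sg_meas by measurable
  have "AE x in lebesgue. \<forall>i\<in>{1..m}. 0 < \<sigma> i x"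
    by (intro AE_ball_countable[THEN iffD2]) (use \<sigma> in \<open>auto simp: weight_def\<close>)
  then have "AE x in lebesgue. 0 < ennreal (\<Prod>i=1..m. \<sigma>' i x powr Th i)"
    by eventually_elim (auto simp: \<sigma>'_def intro!: prod_pos)
  then show "0 < ?l" unfolding eq using R' by (intro set_nn_integral_pos measurable_compose[OF mm measurable_ennreal]) auto
  have "?r = (\<integral>\<^sup>+x. ennreal (\<Prod>i=1..m. (\<sigma>' i x * indicator R x) powr Th i) \<partial>lebesgue)"
  proof (intro nn_integral_cong)
    fix x
    \<comment> \<open>The indicator is moved into every factor; off \<open>R\<close> the product
      vanishes because it has at least one factor, that is, because 1 \<le> m.\<close>
    have "(\<Prod>i=1..m. (\<sigma>' i x * 0) powr Th i) = 0" using m by (intro prod_zero) auto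
    then show "ennreal (\<Prod>i=1..m. \<sigma>' i x powr Th i) * indicator R x = ennreal (\<Prod>i=1..m. (\<sigma>' i x * indicator R x) powr Th i)"
      by (cases "x \<in> R") auto
  qed
  also have "\<dots> \<le> ennreal (\<Prod>i=1..m. W.sg i R powr Th i)"
  proof (rule nn_integral_prod_powr_le)
    fix i assume i: "i \<in> {1..m}"
    note [measurable] = W.sg_meas[OF i] R'(1)
    show "(\<lambda>x. \<sigma>' i x * indicator R x) \<in> borel_measurable lebesgue" by measurable
    show "0 < Th i" by (rule W.\<theta>_pos[OF i])
    have "(\<integral>\<^sup>+x. ennreal (\<sigma>' i x * indicator R x) \<partial>lebesgue) = (\<integral>\<^sup>+x\<in>R. ennreal (\<sigma>' i x) \<partial>lebesgue)"
      by (intro nn_integral_cong) (auto simp: indicator_def)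
    also have "\<dots> = ennreal (W.sg i R)" by (rule W.ennreal_sg[OF i, symmetric]) simp
    finally show "(\<integral>\<^sup>+x. ennreal (\<sigma>' i x * indicator R x) \<partial>lebesgue) \<le> ennreal (W.sg i R)" by simp
  qed (use W.sum_\<theta> in \<open>auto simp: W.sg_ge_0 \<sigma>'_def\<close>)
  finally show "?l < \<infinity>" unfolding eq by (rule le_less_trans) simp
qed

theorem W_inequality:
  assumes fin: "A_const m \<alpha> ps p q \<sigma> \<omega> < \<infinity>" and finW: "Winf_const m ps p \<sigma> < \<infinity>"
  shows "wnorm q \<omega> (multi_frac_maximal m \<alpha> (\<lambda>i x. \<sigma> i x * f i x))
    \<le> ennreal (C0 * (2 powr (1 / p) * (\<Prod>i=1..m. maximal_const (ps i) powr (1 / ps i))))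
      * (A_const m \<alpha> ps p q \<sigma> \<omega> * Winf_const m ps p \<sigma>) epowr (1 / p)
      * (\<Prod>i=1..m. wnorm (ps i) (\<sigma> i) (\<lambda>x. ennreal \<bar>f i x\<bar>))"
proof -
  define A where "A = enn2real (A_const m \<alpha> ps p q \<sigma> \<omega>)"
  define K where "K = enn2real (Winf_const m ps p \<sigma>)"
  have A: "A_const m \<alpha> ps p q \<sigma> \<omega> = ennreal A" "0 \<le> A" using fin by (auto simp: A_def less_top)
  have K: "Winf_const m ps p \<sigma> = ennreal K" "0 \<le> K" using finW by (auto simp: K_def less_top)
  have "(A_const m \<alpha> ps p q \<sigma> \<omega> * Winf_const m ps p \<sigma>) = ennreal (A * K)"
    using A K by (simp add: ennreal_mult)
  then have eA: "(A_const m \<alpha> ps p q \<sigma> \<omega> * Winf_const m ps p \<sigma>) epowr (1 / p) = ennreal ((A * K) powr (1 / p))"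
    using A K by (simp add: epowr_ennreal)
  define P where "P = (\<Prod>i=1..m. maximal_const (ps i) powr (1 / ps i))"
  have P0: "0 \<le> P" unfolding P_def by (intro prod_nonneg) auto
  \<comment> \<open>The 2 in \<open>2 * A * K\<close> is due to sparseness; it is moved from the
    weight constant into the part that depends on the exponents.\<close>
  have PP: "2 powr s * (A * K) powr (1 / p) * (2 powr (1 / p) * P) = 2 powr s * (2 * A * K) powr (1 / p) * P"
    using A K by (simp add: powr_mult)
  show ?thesis
    unfolding eA P_def[symmetric]
  proof (rule wnorm_le)
    fix v :: "real ^ 'n" and L :: real and F assume F: "0 < L" "finite F" "F \<subseteq> grid v L"
    interpret W: weighted_family lebesgue F m s p q ps \<sigma>' f' \<omega> by (rule family_grid[OF F])
    have cl: "has_closure Q (cl Q)" if "Q \<in> F" for Q using has_closure_cl F that by blast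
    show "(\<integral>\<^sup>+x. ennreal (family_max F Ph x powr q) * ennreal (\<omega> x) \<partial>lebesgue)
        \<le> ennreal ((2 powr s * (A * K) powr (1 / p) * (2 powr (1 / p) * P) * (\<Prod>i=1..m. Nm i powr (1 / ps i))) powr q)"
      unfolding PP unfolding P_def
    proof (rule W.W_bound[OF A(2) K(2), where h = "\<lambda>R x. \<Prod>i=1..m. HL_maximal (\<lambda>y. \<sigma> i y * indicator (cl R) y) x epowr (p / ps i)"])
      fix Q assume "Q \<in> F"
      from A_const_real[OF fin cl[OF this]]
      show "weight_on lebesgue \<omega> Q powr (p / q) * (\<Prod>i=1..m. W.sg i Q powr (p - W.\<theta> i)) \<le> A * W.V Q powr (p * s)"
        by (simp add: A_def)
    next
      fix Q R x assume QR: "R \<in> F" "Q \<in> F" "Q \<subseteq> R" "x \<in> Q"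
      have "ennreal (\<Prod>i=1..m. (W.sg i Q / W.V Q) powr W.\<theta> i) = (\<Prod>i=1..m. ennreal ((W.sg i Q / W.V Q) powr W.\<theta> i))"
        by (rule prod_ennreal[symmetric]) simp
      also have "\<dots> \<le> (\<Prod>i=1..m. HL_maximal (\<lambda>y. \<sigma> i y * indicator (cl R) y) x epowr (p / ps i))"
      proof (rule prod_mono_ennreal)
        fix i assume i: "i \<in> {1..m}"
        have "0 < W.V Q" by (rule W.V_pos[OF QR(2)])
        then have "ennreal ((W.sg i Q / W.V Q) powr W.\<theta> i) = ennreal (W.sg i Q / W.V Q) epowr (p / ps i)"
          by (simp add: epowr_ennreal W.sg_ge_0 W.\<theta>_def)
        also have "\<dots> \<le> HL_maximal (\<lambda>y. \<sigma> i y * indicator (cl R) y) x epowr (p / ps i)"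
          using W.\<theta>_pos[OF i] QR i by (intro epowr_mono HL_maximal_ge[OF cl cl]) (auto simp: W.\<theta>_def)
        finally show "ennreal ((W.sg i Q / W.V Q) powr W.\<theta> i) \<le> HL_maximal (\<lambda>y. \<sigma> i y * indicator (cl R) y) x epowr (p / ps i)" .
      qed
      finally show "ennreal (\<Prod>i=1..m. (W.sg i Q / W.V Q) powr W.\<theta> i)
        \<le> (\<Prod>i=1..m. HL_maximal (\<lambda>y. \<sigma> i y * indicator (cl R) y) x epowr (p / ps i))" .
    next
      fix R assume R: "R \<in> F"
      note R' = cl[OF R]
      then have Rc: "cl R \<in> cubes" by (simp add: has_closure_def)
      have "(\<integral>\<^sup>+x\<in>cl R. (\<Prod>i=1..m. HL_maximal (\<lambda>y. \<sigma> i y * indicator (cl R) y) x epowr (p / ps i)) \<partial>lebesgue)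
        / (\<integral>\<^sup>+x\<in>cl R. (\<Prod>i=1..m. ennreal (\<sigma> i x) epowr (p / ps i)) \<partial>lebesgue) \<le> Winf_const m ps p \<sigma>"
        unfolding Winf_const_def by (rule SUP_upper[OF Rc])
      then have "(\<integral>\<^sup>+x\<in>cl R. (\<Prod>i=1..m. HL_maximal (\<lambda>y. \<sigma> i y * indicator (cl R) y) x epowr (p / ps i)) \<partial>lebesgue)
        \<le> ennreal K * (\<integral>\<^sup>+x\<in>cl R. (\<Prod>i=1..m. ennreal (\<sigma> i x) epowr (p / ps i)) \<partial>lebesgue)"
        unfolding K(1) by (rule le_mult_of_divide_le_ennreal) (use geometric_mean_integral[OF Rc] in auto)
      then show "(\<integral>\<^sup>+x\<in>R. (\<Prod>i=1..m. HL_maximal (\<lambda>y. \<sigma> i y * indicator (cl R) y) x epowr (p / ps i)) \<partial>lebesgue)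
        \<le> ennreal K * (\<integral>\<^sup>+x\<in>R. ennreal (\<Prod>i=1..m. \<sigma>' i x powr W.\<theta> i) \<partial>lebesgue)"
        using R' unfolding geometric_mean_integral(1)[OF Rc] by (simp add: has_closure_def)
    qed
  qed (use P0 in auto)
qed

end

theorem theorem1p9:
  fixes m :: nat and \<alpha> p q :: real and ps :: "nat \<Rightarrow> real"
  assumes "1 \<le> m"
    and "0 \<le> \<alpha>" and "\<alpha> < real m * real CARD('n::finite)"
    and "\<And>i. i \<in> {1..m} \<Longrightarrow> 1 < ps i"
    and "1 < q"
    and "1 / p = (\<Sum>i=1..m. 1 / ps i)"
    and "p \<le> q"
  shows "\<exists>C::real. C > 0 \<and>
    (\<forall>(\<sigma> :: nat \<Rightarrow> real ^ 'n \<Rightarrow> real) (\<omega> :: real ^ 'n \<Rightarrow> real).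
      (\<forall>i\<in>{1..m}. weight (\<sigma> i)) \<and> weight \<omega> \<longrightarrow>
      (\<forall>f :: nat \<Rightarrow> real ^ 'n \<Rightarrow> real.
        (\<forall>i\<in>{1..m}. f i \<in> weighted_Lp (ps i) (\<sigma> i)) \<longrightarrow>
        (B_const m \<alpha> ps p q \<sigma> \<omega> < \<infinity> \<longrightarrow>
          wnorm q \<omega> (multi_frac_maximal m \<alpha> (\<lambda>i x. \<sigma> i x * f i x))
            \<le> ennreal C * B_const m \<alpha> ps p q \<sigma> \<omega> epowr (1 / p)
              * (\<Prod>i=1..m. wnorm (ps i) (\<sigma> i) (\<lambda>x. ennreal \<bar>f i x\<bar>))) \<and>
        (A_const m \<alpha> ps p q \<sigma> \<omega> < \<infinity> \<and> (\<forall>i\<in>{1..m}. Ainf_const (\<sigma> i) < \<infinity>) \<longrightarrow>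
          wnorm q \<omega> (multi_frac_maximal m \<alpha> (\<lambda>i x. \<sigma> i x * f i x))
            \<le> ennreal C * A_const m \<alpha> ps p q \<sigma> \<omega> epowr (1 / p)
              * (\<Prod>i=1..m. Ainf_const (\<sigma> i) epowr (1 / ps i))
              * (\<Prod>i=1..m. wnorm (ps i) (\<sigma> i) (\<lambda>x. ennreal \<bar>f i x\<bar>))) \<and>
        (A_const m \<alpha> ps p q \<sigma> \<omega> < \<infinity> \<and> Winf_const m ps p \<sigma> < \<infinity> \<longrightarrow>
          wnorm q \<omega> (multi_frac_maximal m \<alpha> (\<lambda>i x. \<sigma> i x * f i x))
            \<le> ennreal C * (A_const m \<alpha> ps p q \<sigma> \<omega> * Winf_const m ps p \<sigma>) epowr (1 / p)
              * (\<Prod>i=1..m. wnorm (ps i) (\<sigma> i) (\<lambda>x. ennreal \<bar>f i x\<bar>)))))"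
proof -
  \<comment> \<open>The constants are rebuilt from the exponents and the dimension alone, since
    \<open>C\<close> must be fixed before the weights and the functions are introduced.\<close>
  define s where "s = real m - \<alpha> / real CARD('n)"
  define c0 where "c0 = 6 powr (real CARD('n) * s) * 2 powr (real CARD('n) / q) * 2 powr s"
  define P1 where "P1 = (\<Prod>i=1..m. (2 * maximal_const 2 * maximal_const (ps i)) powr (1 / ps i))"
  define P2 where "P2 = (\<Prod>i=1..m. (2 * maximal_const (ps i)) powr (1 / ps i))"
  define P3 where "P3 = 2 powr (1 / p) * (\<Prod>i=1..m. maximal_const (ps i) powr (1 / ps i))"
  \<comment> \<open>The sum bounds all three constants, and the 1 makes \<open>C\<close> positive at
    once.\<close>
  define C where "C = c0 * (1 + P1 + P2 + P3)"
  have c0: "0 < c0" by (simp add: c0_def)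
  have P: "0 \<le> P1" "0 \<le> P2" "0 \<le> P3"
    by (auto simp: P1_def P2_def P3_def intro!: prod_nonneg mult_nonneg_nonneg)
  have "c0 * P1 \<le> C" "c0 * P2 \<le> C" "c0 * P3 \<le> C"
    unfolding C_def using c0 P by (auto intro!: mult_left_mono)
  then have CP: "ennreal (c0 * P1) \<le> ennreal C" "ennreal (c0 * P2) \<le> ennreal C" "ennreal (c0 * P3) \<le> ennreal C"
    by (auto intro: ennreal_leI)
  have C: "0 < C" unfolding C_def using c0 P by (intro mult_pos_pos) auto
  have main:
    "(B_const m \<alpha> ps p q \<sigma> \<omega> < \<infinity> \<longrightarrow>
          wnorm q \<omega> (multi_frac_maximal m \<alpha> (\<lambda>i x. \<sigma> i x * f i x))
            \<le> ennreal C * B_const m \<alpha> ps p q \<sigma> \<omega> epowr (1 / p)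
              * (\<Prod>i=1..m. wnorm (ps i) (\<sigma> i) (\<lambda>x. ennreal \<bar>f i x\<bar>))) \<and>
        (A_const m \<alpha> ps p q \<sigma> \<omega> < \<infinity> \<and> (\<forall>i\<in>{1..m}. Ainf_const (\<sigma> i) < \<infinity>) \<longrightarrow>
          wnorm q \<omega> (multi_frac_maximal m \<alpha> (\<lambda>i x. \<sigma> i x * f i x))
            \<le> ennreal C * A_const m \<alpha> ps p q \<sigma> \<omega> epowr (1 / p)
              * (\<Prod>i=1..m. Ainf_const (\<sigma> i) epowr (1 / ps i))
              * (\<Prod>i=1..m. wnorm (ps i) (\<sigma> i) (\<lambda>x. ennreal \<bar>f i x\<bar>))) \<and>
        (A_const m \<alpha> ps p q \<sigma> \<omega> < \<infinity> \<and> Winf_const m ps p \<sigma> < \<infinity> \<longrightarrow>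
          wnorm q \<omega> (multi_frac_maximal m \<alpha> (\<lambda>i x. \<sigma> i x * f i x))
            \<le> ennreal C * (A_const m \<alpha> ps p q \<sigma> \<omega> * Winf_const m ps p \<sigma>) epowr (1 / p)
              * (\<Prod>i=1..m. wnorm (ps i) (\<sigma> i) (\<lambda>x. ennreal \<bar>f i x\<bar>)))"
    if w: "\<forall>i\<in>{1..m}. weight (\<sigma> i)" "weight \<omega>" and f: "\<forall>i\<in>{1..m}. f i \<in> weighted_Lp (ps i) (\<sigma> i)"
    for \<sigma> f :: "nat \<Rightarrow> real ^ 'n \<Rightarrow> real" and \<omega> :: "real ^ 'n \<Rightarrow> real"
  proof -
    interpret W: weighted_setup m \<alpha> p q ps \<sigma> f \<omega>
      by (rule weighted_setup.intro) (use assms w f in auto)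
    have C0: "W.C0 = c0" by (simp add: W.C0_def W.K0_def W.s_def c0_def s_def)
    show ?thesis
    proof (intro conjI impI; (elim conjE)?)
      assume "B_const m \<alpha> ps p q \<sigma> \<omega> < \<infinity>"
      from W.B_inequality[OF this, folded P1_def, unfolded C0]
      show "wnorm q \<omega> (multi_frac_maximal m \<alpha> (\<lambda>i x. \<sigma> i x * f i x))
            \<le> ennreal C * B_const m \<alpha> ps p q \<sigma> \<omega> epowr (1 / p)
              * (\<Prod>i=1..m. wnorm (ps i) (\<sigma> i) (\<lambda>x. ennreal \<bar>f i x\<bar>))"
        by (rule order_trans) (intro mult_right_mono CP zero_le)
    next
      assume A: "A_const m \<alpha> ps p q \<sigma> \<omega> < \<infinity>" and "\<forall>i\<in>{1..m}. Ainf_const (\<sigma> i) < \<infinity>"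
      then have "Ainf_const (\<sigma> i) < \<infinity>" if "i \<in> {1..m}" for i using that by blast
      from W.A_inequality[OF A this, folded P2_def, unfolded C0]
      show "wnorm q \<omega> (multi_frac_maximal m \<alpha> (\<lambda>i x. \<sigma> i x * f i x))
            \<le> ennreal C * A_const m \<alpha> ps p q \<sigma> \<omega> epowr (1 / p)
              * (\<Prod>i=1..m. Ainf_const (\<sigma> i) epowr (1 / ps i))
              * (\<Prod>i=1..m. wnorm (ps i) (\<sigma> i) (\<lambda>x. ennreal \<bar>f i x\<bar>))"
        by (rule order_trans) (assumption?, intro mult_right_mono CP zero_le)
    next
      assume "A_const m \<alpha> ps p q \<sigma> \<omega> < \<infinity>" "Winf_const m ps p \<sigma> < \<infinity>"
      from W.W_inequality[OF this, folded P3_def, unfolded C0]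
      show "wnorm q \<omega> (multi_frac_maximal m \<alpha> (\<lambda>i x. \<sigma> i x * f i x))
            \<le> ennreal C * (A_const m \<alpha> ps p q \<sigma> \<omega> * Winf_const m ps p \<sigma>) epowr (1 / p)
              * (\<Prod>i=1..m. wnorm (ps i) (\<sigma> i) (\<lambda>x. ennreal \<bar>f i x\<bar>))"
        by (rule order_trans) (intro mult_right_mono CP zero_le)
    qed
  qed
  show ?thesis
    by (rule exI[of _ C], rule conjI[OF C], intro allI impI main)
      (erule conjunct1, erule conjunct2, assumption)
qed

end
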